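(* Let $\Gamma$ be a group of one of the following types: (i) a finitely generated non-elementary word-hyperbolic group; (ii) a finitely generated non-elementary subgroup of a word-hyperbolic group; (iii) a finitely generated non-elementary relatively hyperbolic group. Let $d=d(\Gamma)$ be the minimal cardinality of a generating set of $\Gamma$. Then $\kappa_{\le d+2}(\Gamma)=0$.
   Context: For a finitely generated group $\Gamma$ and a finite, not necessarily symmetric, generating set $S\subseteq\Gamma$, the Kazhdan constant is $$\kappa(\Gamma,S)=\inf_{\pi}\ \inf_{\xi\in\mathcal H,\ \|\xi\|=1}\ \max_{s\in S}\|\pi(s)\xi-\xi\|,$$ where $\pi:\Gamma\to\mathcal U(\mathcal H)$ ranges over all unitary representations of $\Gamma$ on (nonzero) Hilbert spaces $\mathcal H$ with $\mathcal H^\Gamma=\{0\}$. For an integer $r\ge d(\Gamma)$, $$\kappa_{\le r}(\Gamma)=\inf\{\kappa(\Gamma,S): S\subseteq\Gamma,\ \langle S\rangle=\Gamma,\ |S|\le r\}.$$ Non-elementary means that the limit set of the relevant action has more than two points: in (i) the action of the group on its Gromov boundary; in (ii) the action of the subgroup on the Gromov boundary of the ambient word-hyperbolic group; in (iii) the action of the group on its Bowditch boundary. The limit set of a group acting on a compact metrizable space $X$ with the convergence property is the set of points $a\in X$ for which there are a sequence $(g_n)$ of distinct group elements and a point $r\in X$ with $g_n|_{X\setminus\{r\}}\to a$ uniformly on compact subsets. *)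

theory Defs
  imports "HOL-Analysis.Analysis" "HOL-Algebra.Generated_Groups" "HOL-Algebra.Group_Action"
    "HOL-Algebra.Module"
begin

section \<open>Generating sets\<close>

definition finite_generating_set :: "('a, 'm) monoid_scheme \<Rightarrow> 'a set \<Rightarrow> bool" where
  "finite_generating_set G S \<longleftrightarrow>
     finite S \<and> S \<subseteq> carrier G \<and> generate G S = carrier G"

definition finitely_generated :: "('a, 'm) monoid_scheme \<Rightarrow> bool" where
  "finitely_generated G \<longleftrightarrow> (\<exists>S. finite_generating_set G S)"

definition generating_rank :: "('a, 'm) monoid_scheme \<Rightarrow> nat" where
  "generating_rank G = (LEAST n. \<exists>S. finite_generating_set G S \<and> card S = n)"


section \<open>Complex Hilbert spaces and unitary representations\<close>

definition complex_ring :: "complex ring" where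
  "complex_ring =
     \<lparr>carrier = UNIV, mult = (*), one = 1, zero = 0, add = (+)\<rparr>"

text \<open>The fields \<^const>\<open>mult\<close> and \<^const>\<open>one\<close>, which every \<^type>\<open>module\<close> record inherits from
  rings, play no role for modules.\<close>

record 'h inner_product_space = "(complex, 'h) module" +
  ip :: "'h \<Rightarrow> 'h \<Rightarrow> complex"

definition ip_norm :: "('h, 'm) inner_product_space_scheme \<Rightarrow> 'h \<Rightarrow> real" where
  "ip_norm H x = sqrt (Re (ip H x x))"

text \<open>The locale \<^locale>\<open>Metric_space\<close> requires a distance to be symmetric and nonnegative on the whole
  type, hence the case distinction.\<close>

definition ip_dist :: "('h, 'm) inner_product_space_scheme \<Rightarrow> 'h \<Rightarrow> 'h \<Rightarrow> real" where
  "ip_dist H x y =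
     (if x \<in> carrier H \<and> y \<in> carrier H then ip_norm H (x \<ominus>\<^bsub>H\<^esub> y) else 0)"

locale complex_inner_product_space = module complex_ring H
  for H :: "('h, 'm) inner_product_space_scheme" (structure) +
  assumes ip_add_left:
      "\<lbrakk>x \<in> carrier H; y \<in> carrier H; z \<in> carrier H\<rbrakk> \<Longrightarrow> ip H (x \<oplus> y) z = ip H x z + ip H y z"
    and ip_smult_left:
      "\<lbrakk>x \<in> carrier H; y \<in> carrier H\<rbrakk> \<Longrightarrow> ip H (c \<odot> x) y = c * ip H x y"
    and ip_commute:
      "\<lbrakk>x \<in> carrier H; y \<in> carrier H\<rbrakk> \<Longrightarrow> ip H y x = cnj (ip H x y)"
    and ip_pos:
      "\<lbrakk>x \<in> carrier H; x \<noteq> \<zero>\<rbrakk> \<Longrightarrow> 0 < Re (ip H x x)"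

locale complex_hilbert_space = complex_inner_product_space +
  assumes complete: "Metric_space.mcomplete (carrier H) (ip_dist H)"

locale unitary_representation = complex_hilbert_space H + group_action G "carrier H" \<pi>
  for G :: "('a, 'n) monoid_scheme" and H :: "('h, 'm) inner_product_space_scheme" (structure)
    and \<pi> :: "'a \<Rightarrow> 'h \<Rightarrow> 'h" +
  assumes rep_add:
      "\<lbrakk>g \<in> carrier G; x \<in> carrier H; y \<in> carrier H\<rbrakk> \<Longrightarrow> \<pi> g (x \<oplus> y) = \<pi> g x \<oplus> \<pi> g y"
    and rep_smult:
      "\<lbrakk>g \<in> carrier G; x \<in> carrier H\<rbrakk> \<Longrightarrow> \<pi> g (c \<odot> x) = c \<odot> \<pi> g x"
    and rep_ip:
      "\<lbrakk>g \<in> carrier G; x \<in> carrier H; y \<in> carrier H\<rbrakk> \<Longrightarrow> ip H (\<pi> g x) (\<pi> g y) = ip H x y"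

definition invariant_vectors ::
  "('a, 'n) monoid_scheme \<Rightarrow> ('h, 'm) inner_product_space_scheme \<Rightarrow> ('a \<Rightarrow> 'h \<Rightarrow> 'h) \<Rightarrow> 'h set" where
  "invariant_vectors G H \<pi> = {x \<in> carrier H. \<forall>g \<in> carrier G. \<pi> g x = x}"

definition displacement ::
  "('h, 'm) inner_product_space_scheme \<Rightarrow> ('a \<Rightarrow> 'h \<Rightarrow> 'h) \<Rightarrow> 'a set \<Rightarrow> 'h \<Rightarrow> ennreal" where
  "displacement H \<pi> S \<xi> = (SUP s\<in>S. ennreal (ip_norm H (\<pi> s \<xi> \<ominus>\<^bsub>H\<^esub> \<xi>)))"


section \<open>Kazhdan constants\<close>

text \<open>HOL cannot quantify over all types, so the underlying set of the Hilbert space is taken in the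
  fixed type \<^typ>\<open>nat \<Rightarrow> complex\<close>. For a countable group this does not change the infimum:
  lemma \<open>kazhdan_constant_le\<close> below shows that representations on Hilbert spaces over any other
  type \<open>'h\<close> do not give a smaller value. The values lie in \<^typ>\<open>ennreal\<close>, so that an empty infimum
  is \<open>\<infinity>\<close>; the supremum in \<^const>\<open>displacement\<close> is a maximum when \<open>S\<close> is finite.\<close>

definition kazhdan_constant :: "('a, 'n) monoid_scheme \<Rightarrow> 'a set \<Rightarrow> ennreal" where
  "kazhdan_constant G S =
     (INF (H, \<pi>) \<in> {(H :: (nat \<Rightarrow> complex) inner_product_space, \<pi>).
                     unitary_representation G H \<pi> \<and> carrier H \<noteq> {\<zero>\<^bsub>H\<^esub>} \<and>
                     invariant_vectors G H \<pi> = {\<zero>\<^bsub>H\<^esub>}}.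
        INF \<xi> \<in> {\<xi> \<in> carrier H. ip_norm H \<xi> = 1}. displacement H \<pi> S \<xi>)"

definition kazhdan_constant_upto :: "nat \<Rightarrow> ('a, 'n) monoid_scheme \<Rightarrow> ennreal" where
  "kazhdan_constant_upto r G =
     (INF S \<in> {S. finite_generating_set G S \<and> card S \<le> r}. kazhdan_constant G S)"


subsection \<open>Independence of the type of vectors\<close>

context complex_inner_product_space
begin

lemma carrier_complex_ring [simp]: "carrier complex_ring = UNIV"
  by (simp add: complex_ring_def)

lemma smult_in_carrier [simp, intro]: "x \<in> carrier H \<Longrightarrow> c \<odot> x \<in> carrier H"
  using smult_closed[of c x] by simp

lemma ip_zero_left [simp]: "y \<in> carrier H \<Longrightarrow> ip H \<zero> y = 0"
  using ip_add_left[of \<zero> \<zero> y] by simp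

lemma ip_zero_right [simp]: "y \<in> carrier H \<Longrightarrow> ip H y \<zero> = 0"
  using ip_commute[of \<zero> y] by simp

lemma ip_neg_left: "\<lbrakk>x \<in> carrier H; y \<in> carrier H\<rbrakk> \<Longrightarrow> ip H (\<ominus> x) y = - ip H x y"
  using ip_add_left[of "\<ominus> x" x y] by (simp add: M.l_neg eq_neg_iff_add_eq_0)

lemma ip_diff_left:
  "\<lbrakk>x \<in> carrier H; y \<in> carrier H; z \<in> carrier H\<rbrakk> \<Longrightarrow> ip H (x \<ominus> y) z = ip H x z - ip H y z"
  by (simp add: a_minus_def ip_add_left ip_neg_left)

lemma ip_diff_right:
  "\<lbrakk>x \<in> carrier H; y \<in> carrier H; z \<in> carrier H\<rbrakk> \<Longrightarrow> ip H z (x \<ominus> y) = ip H z x - ip H z y"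
  using ip_commute[of "x \<ominus> y" z] ip_commute[of x z] ip_commute[of y z] by (simp add: ip_diff_left)

lemma ip_smult_right:
  "\<lbrakk>x \<in> carrier H; y \<in> carrier H\<rbrakk> \<Longrightarrow> ip H y (c \<odot> x) = cnj c * ip H y x"
  using ip_commute[of "c \<odot> x" y] ip_commute[of x y] by (simp add: ip_smult_left)

lemma ip_self: "x \<in> carrier H \<Longrightarrow> ip H x x = complex_of_real ((ip_norm H x)\<^sup>2)"
proof -
  assume x: "x \<in> carrier H"
  have "Im (ip H x x) = 0"
    using arg_cong[OF ip_commute[OF x x], of Im] by simp
  moreover have "Re (ip H x x) \<ge> 0"
    using ip_pos[OF x] x by (cases "x = \<zero>") auto
  ultimately show ?thesis
    by (simp add: ip_norm_def complex_eq_iff)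
qed

lemma ip_norm_eq_0_iff: "x \<in> carrier H \<Longrightarrow> ip_norm H x = 0 \<longleftrightarrow> x = \<zero>"
  using ip_pos[of x] by (cases "x = \<zero>") (auto simp: ip_norm_def)

lemma ip_norm_nonneg: "x \<in> carrier H \<Longrightarrow> ip_norm H x \<ge> 0"
  using ip_pos[of x] by (cases "x = \<zero>") (auto simp: ip_norm_def)

lemma cauchy_schwarz:
  assumes x: "x \<in> carrier H" and y: "y \<in> carrier H"
  shows "cmod (ip H x y) \<le> ip_norm H x * ip_norm H y"
proof (cases "y = \<zero>")
  case True
  then show ?thesis using x ip_norm_nonneg by (simp add: ip_norm_def)
next
  case False
  define a where "a = ip H x y"
  define n where "n = (ip_norm H y)\<^sup>2"
  have n: "n > 0" using False ip_norm_eq_0_iff[OF y] by (simp add: n_def)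
  define z where "z = (of_real n \<odot> x) \<ominus> (a \<odot> y)"
  have z: "z \<in> carrier H" using x y by (simp add: z_def)
  have yx: "ip H y x = cnj a" using ip_commute[OF x y] by (simp add: a_def)
  have "ip H z z = of_real n * of_real n * ip H x x - of_real n * (a * cnj a)
      - of_real n * (a * cnj a) + a * cnj a * ip H y y"
    using x y by (simp add: z_def ip_diff_left ip_diff_right ip_smult_left ip_smult_right yx
        flip: a_def) (simp add: algebra_simps)
  also have "ip H y y = of_real n" using y by (simp add: ip_self n_def)
  also have "ip H x x = of_real ((ip_norm H x)\<^sup>2)" using x by (rule ip_self)
  also have "a * cnj a = of_real ((cmod a)\<^sup>2)" by (rule complex_norm_square[symmetric])
  finally have "ip H z z = of_real (n * (n * (ip_norm H x)\<^sup>2 - (cmod a)\<^sup>2))"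
    by (simp add: algebra_simps)
  then have "n * (n * (ip_norm H x)\<^sup>2 - (cmod a)\<^sup>2) = (ip_norm H z)\<^sup>2"
    using ip_self[OF z] by (metis of_real_eq_iff)
  then have "n * (n * (ip_norm H x)\<^sup>2 - (cmod a)\<^sup>2) \<ge> 0" by simp
  then have "(cmod a)\<^sup>2 \<le> n * (ip_norm H x)\<^sup>2"
    using n by (simp add: zero_le_mult_iff)
  then have "(cmod a)\<^sup>2 \<le> (ip_norm H x * ip_norm H y)\<^sup>2"
    by (simp add: n_def power_mult_distrib mult.commute)
  then show ?thesis
    using x y ip_norm_nonneg unfolding a_def by (simp add: power2_le_iff_abs_le)
qed

lemma ip_norm_minus_commute:
  "\<lbrakk>x \<in> carrier H; y \<in> carrier H\<rbrakk> \<Longrightarrow> ip_norm H (x \<ominus> y) = ip_norm H (y \<ominus> x)"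
  by (simp add: ip_norm_def ip_diff_left ip_diff_right)

lemma ip_norm_triangle:
  assumes x: "x \<in> carrier H" and y: "y \<in> carrier H" and z: "z \<in> carrier H"
  shows "ip_norm H (x \<ominus> z) \<le> ip_norm H (x \<ominus> y) + ip_norm H (y \<ominus> z)"
proof -
  let ?u = "x \<ominus> y" and ?v = "y \<ominus> z"
  have u: "?u \<in> carrier H" and v: "?v \<in> carrier H" using x y z by auto
  have "Re (ip H (x \<ominus> z) (x \<ominus> z)) = Re (ip H ?u ?u) + Re (ip H ?v ?v) + 2 * Re (ip H ?u ?v)"
    using x y z ip_commute[OF x y] ip_commute[OF x z] ip_commute[OF y z]
    by (simp add: ip_diff_left ip_diff_right)
  also have "Re (ip H ?u ?v) \<le> ip_norm H ?u * ip_norm H ?v"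
    using cauchy_schwarz[OF u v] complex_Re_le_cmod[of "ip H ?u ?v"] by linarith
  finally have "Re (ip H (x \<ominus> z) (x \<ominus> z)) \<le> (ip_norm H ?u + ip_norm H ?v)\<^sup>2"
    using ip_self[OF u] ip_self[OF v] by (simp add: power2_sum)
  then show ?thesis
    unfolding ip_norm_def[of H "x \<ominus> z"]
    using ip_norm_nonneg[OF u] ip_norm_nonneg[OF v] by (simp add: real_le_lsqrt)
qed

lemma diff_eq_zero_iff: "\<lbrakk>x \<in> carrier H; y \<in> carrier H\<rbrakk> \<Longrightarrow> x \<ominus> y = \<zero> \<longleftrightarrow> x = y"
  by (metis M.a_inv_closed M.minus_equality M.minus_minus M.r_neg a_minus_def)

lemma Metric_space_ip_dist: "Metric_space (carrier H) (ip_dist H)"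
proof
  fix x y z
  show "0 \<le> ip_dist H x y" by (simp add: ip_dist_def ip_norm_nonneg)
  show "ip_dist H x y = ip_dist H y x" by (simp add: ip_dist_def ip_norm_minus_commute)
  show "x \<in> carrier H \<Longrightarrow> y \<in> carrier H \<Longrightarrow> ip_dist H x y = 0 \<longleftrightarrow> x = y"
    by (simp add: ip_dist_def ip_norm_eq_0_iff diff_eq_zero_iff)
  show "x \<in> carrier H \<Longrightarrow> y \<in> carrier H \<Longrightarrow> z \<in> carrier H \<Longrightarrow> ip_dist H x z \<le> ip_dist H x y + ip_dist H y z"
    by (simp add: ip_dist_def ip_norm_triangle)
qed

end


lemma (in unitary_representation) rep_closed:
  "\<lbrakk>g \<in> carrier G; x \<in> carrier H\<rbrakk> \<Longrightarrow> \<pi> g x \<in> carrier H"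
  by (rule element_image) auto

lemma (in unitary_representation) rep_mult:
  "\<lbrakk>g \<in> carrier G; h \<in> carrier G; x \<in> carrier H\<rbrakk> \<Longrightarrow> \<pi> (g \<otimes>\<^bsub>G\<^esub> h) x = \<pi> g (\<pi> h x)"
  using composition_rule by auto

lemma (in unitary_representation) kazhdan_constant_le:
  assumes countable: "countable (carrier G)" and S: "S \<subseteq> carrier G"
    and inv: "invariant_vectors G H \<pi> = {\<zero>}"
    and \<xi>: "\<xi> \<in> carrier H" "ip_norm H \<xi> = 1"
  shows "kazhdan_constant G S \<le> displacement H \<pi> S \<xi>"
proof -
  interpret grp: group G using group_hom by (simp add: group_hom_def)
  have rep_one: "\<pi> \<one>\<^bsub>G\<^esub> x = x" if "x \<in> carrier H" for x
    using id_eq_one that by (metis restrict_apply')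
  \<comment> \<open>The closed linear span of the orbit of \<open>\<xi>\<close>, written as a double orthogonal complement.\<close>
  define P where "P = {y \<in> carrier H. \<forall>g\<in>carrier G. ip H y (\<pi> g \<xi>) = 0}"
  define C where "C = {x \<in> carrier H. \<forall>y\<in>P. ip H x y = 0}"
  define e where "e = from_nat_into (carrier G)"
  have ne: "carrier G \<noteq> {}" using grp.one_closed by blast
  have e: "range e = carrier G"
    unfolding e_def by (rule range_from_nat_into[OF ne countable])
  define f where "f x = (\<lambda>n. ip H x (\<pi> (e n) \<xi>))" for x
  define D where "D = f ` C"
  define k where "k = inv_into C f"
  have CH: "x \<in> carrier H" if "x \<in> C" for x using that by (simp add: C_def)
  have orb: "\<pi> g \<xi> \<in> carrier H" if "g \<in> carrier G" for g using rep_closed that \<xi> by blast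
  have C0: "\<zero> \<in> C" by (simp add: C_def P_def)
  have Cadd: "x \<oplus> y \<in> C" if "x \<in> C" "y \<in> C" for x y
    using that by (simp add: C_def P_def ip_add_left)
  have Csm: "c \<odot> x \<in> C" if "x \<in> C" for c x
    using that by (simp add: C_def P_def ip_smult_left)
  have Cneg: "\<ominus> x \<in> C" if "x \<in> C" for x
    using that by (simp add: C_def P_def ip_neg_left)
  have Cdiff: "x \<ominus> y \<in> C" if "x \<in> C" "y \<in> C" for x y
    using that by (simp add: a_minus_def Cadd Cneg)
  have C\<xi>: "\<xi> \<in> C"
  proof -
    have "ip H \<xi> y = 0" if "y \<in> P" for y
    proof -
      have y: "y \<in> carrier H" and "ip H y (\<pi> \<one>\<^bsub>G\<^esub> \<xi>) = 0" using that by (auto simp: P_def)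
      then show ?thesis using ip_commute[OF y \<xi>(1)] rep_one \<xi> by simp
    qed
    then show ?thesis using \<xi> by (simp add: C_def)
  qed
  have adj: "ip H (\<pi> g x) y = ip H x (\<pi> (inv\<^bsub>G\<^esub> g) y)"
    if "g \<in> carrier G" "x \<in> carrier H" "y \<in> carrier H" for g x y
    using rep_ip[of "inv\<^bsub>G\<^esub> g" "\<pi> g x" y] rep_mult[of "inv\<^bsub>G\<^esub> g" g x] that
    by (simp add: rep_one rep_closed)
  have Crep: "\<pi> g x \<in> C" if g: "g \<in> carrier G" and x: "x \<in> C" for g x
  proof -
    have "ip H (\<pi> g x) y = 0" if y: "y \<in> P" for y
    proof -
      have yH: "y \<in> carrier H" using y by (simp add: P_def)
      have "\<pi> (inv\<^bsub>G\<^esub> g) y \<in> P"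
      proof -
        have "ip H (\<pi> (inv\<^bsub>G\<^esub> g) y) (\<pi> h \<xi>) = 0" if h: "h \<in> carrier G" for h
        proof -
          have "ip H (\<pi> (inv\<^bsub>G\<^esub> g) y) (\<pi> h \<xi>) = ip H y (\<pi> g (\<pi> h \<xi>))"
            using adj[of "inv\<^bsub>G\<^esub> g" y "\<pi> h \<xi>"] g yH orb[OF h] by simp
          also have "\<dots> = ip H y (\<pi> (g \<otimes>\<^bsub>G\<^esub> h) \<xi>)" using rep_mult g h \<xi> by simp
          also have "\<dots> = 0" using y g h by (simp add: P_def)
          finally show ?thesis .
        qed
        then show ?thesis using rep_closed g yH by (simp add: P_def)
      qed
      then show ?thesis using adj[OF g CH[OF x] yH] x by (simp add: C_def)
    qed
    then show ?thesis using rep_closed[OF g CH[OF x]] by (simp add: C_def)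
  qed
  have "inj_on f C"
  proof (rule inj_onI)
    fix x y assume x: "x \<in> C" and y: "y \<in> C" and eq: "f x = f y"
    have z: "x \<ominus> y \<in> C" using Cdiff x y by simp
    have "ip H (x \<ominus> y) (\<pi> g \<xi>) = 0" if g: "g \<in> carrier G" for g
    proof -
      obtain n where "g = e n" using g e by auto
      then show ?thesis
        using fun_cong[OF eq, of n] CH[OF x] CH[OF y] orb[OF g] by (simp add: f_def ip_diff_left)
    qed
    then have "x \<ominus> y \<in> P" using CH[OF z] by (simp add: P_def)
    then have "ip H (x \<ominus> y) (x \<ominus> y) = 0" using z by (simp add: C_def)
    then have "x \<ominus> y = \<zero>" using ip_pos[OF CH[OF z]] by auto
    then show "x = y" using CH x y by (simp add: diff_eq_zero_iff)
  qed
  then have kf: "k (f x) = x" if "x \<in> C" for x using that by (simp add: k_def)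
  have fk: "f (k u) = u" if "u \<in> D" for u using that by (simp add: D_def k_def f_inv_into_f)
  have kC: "k u \<in> C" if "u \<in> D" for u using that by (auto simp: D_def kf)
  have kH: "k u \<in> carrier H" if "u \<in> D" for u using kC that CH by blast
  have fD: "f x \<in> D" if "x \<in> C" for x using that by (simp add: D_def)
  have k_eq: "u = v \<longleftrightarrow> k u = k v" if "u \<in> D" "v \<in> D" for u v using that fk by metis
  define T :: "(nat \<Rightarrow> complex) inner_product_space" where
    "T = \<lparr>carrier = D, mult = undefined, one = undefined, zero = f \<zero>,
       add = (\<lambda>u v. f (k u \<oplus> k v)), smult = (\<lambda>c u. f (c \<odot> k u)), ip = (\<lambda>u v. ip H (k u) (k v))\<rparr>"
  define \<rho> where "\<rho> g = (\<lambda>u\<in>D. f (\<pi> g (k u)))" for g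
  have T [simp]: "carrier T = D" "\<zero>\<^bsub>T\<^esub> = f \<zero>" "u \<oplus>\<^bsub>T\<^esub> v = f (k u \<oplus> k v)"
    "c \<odot>\<^bsub>T\<^esub> u = f (c \<odot> k u)" "ip T u v = ip H (k u) (k v)" for u v c
    by (simp_all add: T_def)
  note tr = kf fk kC kH fD CH C0 Cadd Csm Cneg Cdiff Crep
  have abT: "abelian_group T"
  proof (rule abelian_groupI)
    fix u assume "u \<in> carrier T"
    then show "\<exists>v\<in>carrier T. v \<oplus>\<^bsub>T\<^esub> u = \<zero>\<^bsub>T\<^esub>"
      by (intro bexI[of _ "f (\<ominus> k u)"]) (auto simp: tr M.l_neg)
  qed (auto simp: tr M.a_ac)
  have minusT: "k (u \<ominus>\<^bsub>T\<^esub> v) = k u \<ominus> k v" if "u \<in> D" "v \<in> D" for u v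
  proof -
    have "\<ominus>\<^bsub>T\<^esub> v = f (\<ominus> k v)"
      by (rule abelian_group.minus_equality[OF abT]) (use that in \<open>auto simp: tr M.l_neg\<close>)
    then show ?thesis using that by (simp add: a_minus_def tr)
  qed
  have normT: "ip_norm T u = ip_norm H (k u)" for u by (simp add: ip_norm_def)
  have distT: "ip_dist T u v = ip_dist H (k u) (k v)" if "u \<in> D" "v \<in> D" for u v
    using that by (simp add: ip_dist_def normT minusT kH)
  have "module complex_ring T"
    using abT R.is_cring
    by (intro moduleI) (auto simp: tr smult_r_distr smult_l_distr smult_assoc1 smult_one)
  moreover have "0 < Re (ip H (k u) (k u))" if "u \<in> D" "u \<noteq> f \<zero>" for u
  proof -
    have "k u \<noteq> \<zero>" using fk that by metis
    then show ?thesis using ip_pos[OF kH] that by blast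
  qed
  ultimately interpret T: complex_inner_product_space T
    by (intro complex_inner_product_space.intro complex_inner_product_space_axioms.intro)
      (auto simp: tr ip_add_left ip_smult_left intro: ip_commute)
  interpret TM: Metric_space "carrier T" "ip_dist T" by (rule T.Metric_space_ip_dist)
  interpret HM: Metric_space "carrier H" "ip_dist H" by (rule Metric_space_ip_dist)
  have "TM.mcomplete"
    unfolding TM.mcomplete_def
  proof (intro allI impI)
    fix \<sigma> assume \<sigma>: "TM.MCauchy \<sigma>"
    then have \<sigma>D: "\<sigma> n \<in> D" for n unfolding TM.MCauchy_def by auto
    have "HM.MCauchy (\<lambda>n. k (\<sigma> n))"
      using \<sigma> unfolding TM.MCauchy_def HM.MCauchy_def by (auto simp: distT \<sigma>D kH)
    then obtain x where "limitin HM.mtopology (\<lambda>n. k (\<sigma> n)) x sequentially"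
      using complete by (auto simp: HM.mcomplete_def)
    then have x: "x \<in> carrier H"
      and lim: "\<And>\<epsilon>. \<epsilon> > 0 \<Longrightarrow> \<exists>N. \<forall>n\<ge>N. ip_dist H (k (\<sigma> n)) x < \<epsilon>"
      unfolding HM.limit_metric_sequentially by (blast, meson)
    have "ip H x y = 0" if y: "y \<in> P" for y
    proof (rule ccontr)
      assume nz: "ip H x y \<noteq> 0"
      have yH: "y \<in> carrier H" using y by (simp add: P_def)
      define m where "m = ip_norm H y + 1"
      have m: "m > 0" "ip_norm H y \<le> m" using ip_norm_nonneg[OF yH] by (auto simp: m_def)
      obtain n where n: "ip_dist H (k (\<sigma> n)) x < cmod (ip H x y) / m"
        using lim[of "cmod (ip H x y) / m"] nz m by auto
      have kn: "k (\<sigma> n) \<in> C" using kC \<sigma>D by blast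
      have "ip H x y = - ip H (k (\<sigma> n) \<ominus> x) y"
        using kn y CH[OF kn] x yH by (simp add: ip_diff_left C_def)
      then have "cmod (ip H x y) = cmod (ip H (k (\<sigma> n) \<ominus> x) y)" by simp
      also have "\<dots> \<le> ip_norm H (k (\<sigma> n) \<ominus> x) * ip_norm H y"
        using cauchy_schwarz CH[OF kn] x yH by simp
      also have "\<dots> \<le> ip_norm H (k (\<sigma> n) \<ominus> x) * m"
        using m ip_norm_nonneg CH[OF kn] x by (intro mult_left_mono) auto
      also have "\<dots> = ip_dist H (k (\<sigma> n)) x * m" using CH[OF kn] x by (simp add: ip_dist_def)
      also have "\<dots> < cmod (ip H x y)" using n m by (simp add: pos_less_divide_eq)
      finally show False by simp
    qed
    then have xC: "x \<in> C" using x by (simp add: C_def)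
    have "limitin TM.mtopology \<sigma> (f x) sequentially"
      unfolding TM.limit_metric_sequentially using lim by (auto simp: \<sigma>D fD[OF xC] distT kf[OF xC])
    then show "\<exists>x. limitin TM.mtopology \<sigma> x sequentially" by blast
  qed
  then have hilbT: "complex_hilbert_space T"
    by (intro complex_hilbert_space.intro complex_hilbert_space_axioms.intro
          T.complex_inner_product_space_axioms)
  have \<rho>: "\<rho> g u = f (\<pi> g (k u))" if "u \<in> D" for g u using that by (simp add: \<rho>_def)
  have \<rho>D: "\<rho> g u \<in> D" if "g \<in> carrier G" "u \<in> D" for g u using that by (simp add: \<rho> tr)
  have \<rho>_mult: "\<rho> (g \<otimes>\<^bsub>G\<^esub> h) u = \<rho> g (\<rho> h u)"
    if "g \<in> carrier G" "h \<in> carrier G" "u \<in> D" for g h u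
    using that by (simp add: \<rho> tr rep_mult)
  have \<rho>_one: "\<rho> \<one>\<^bsub>G\<^esub> u = u" if "u \<in> D" for u using that by (simp add: \<rho> tr rep_one)
  have \<rho>Bij: "\<rho> g \<in> Bij D" if g: "g \<in> carrier G" for g
  proof -
    have "bij_betw (\<rho> g) D D"
      by (rule bij_betw_byWitness[where f' = "\<rho> (inv\<^bsub>G\<^esub> g)"])
        (use g in \<open>auto simp: \<rho>D \<rho>_one simp flip: \<rho>_mult\<close>)
    then show ?thesis by (simp add: Bij_def \<rho>_def)
  qed
  have "\<rho> \<in> hom G (BijGroup D)"
  proof (rule homI)
    fix g h assume gh: "g \<in> carrier G" "h \<in> carrier G"
    show "\<rho> g \<in> carrier (BijGroup D)" using \<rho>Bij gh by (simp add: BijGroup_def)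
    have "\<rho> (g \<otimes>\<^bsub>G\<^esub> h) = compose D (\<rho> g) (\<rho> h)"
    proof
      fix u show "\<rho> (g \<otimes>\<^bsub>G\<^esub> h) u = compose D (\<rho> g) (\<rho> h) u"
        using \<rho>_mult gh by (cases "u \<in> D") (auto simp: compose_def \<rho>_def)
    qed
    then show "\<rho> (g \<otimes>\<^bsub>G\<^esub> h) = \<rho> g \<otimes>\<^bsub>BijGroup D\<^esub> \<rho> h"
      using \<rho>Bij gh by (simp add: BijGroup_def)
  qed
  then have "group_action G (carrier T) \<rho>"
    by (simp add: group_action_def group_hom_def group_hom_axioms_def group_BijGroup grp.is_group)
  then have repT: "unitary_representation G T \<rho>"
    using hilbT
    by (intro unitary_representation.intro unitary_representation_axioms.intro)
      (auto simp: \<rho> tr rep_add rep_smult rep_ip)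
  have f\<xi>: "f \<xi> \<in> D" "ip_norm T (f \<xi>) = 1" using \<xi> C\<xi> by (auto simp: tr normT)
  have "\<xi> \<noteq> \<zero>" using \<xi> ip_norm_eq_0_iff by force
  then have nzT: "carrier T \<noteq> {\<zero>\<^bsub>T\<^esub>}"
    using f\<xi>(1) C\<xi> C0 kf by (metis T(1) T(2) singletonD)
  have invT: "invariant_vectors G T \<rho> = {\<zero>\<^bsub>T\<^esub>}"
  proof (intro antisym subsetI)
    fix u assume "u \<in> invariant_vectors G T \<rho>"
    then have u: "u \<in> D" and fixed: "\<forall>g\<in>carrier G. \<rho> g u = u"
      by (auto simp: invariant_vectors_def)
    have "\<pi> g (k u) = k u" if "g \<in> carrier G" for g
      using fixed that u by (metis \<rho> kf Crep kC)
    then have "k u \<in> invariant_vectors G H \<pi>" using u kH by (simp add: invariant_vectors_def)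
    then have "k u = \<zero>" using inv by simp
    then show "u \<in> {\<zero>\<^bsub>T\<^esub>}" using fk[OF u] by simp
  next
    fix u assume "u \<in> {\<zero>\<^bsub>T\<^esub>}"
    then have u: "u = f \<zero>" by simp
    have "\<zero> \<in> invariant_vectors G H \<pi>" using inv by simp
    then show "u \<in> invariant_vectors G T \<rho>"
      using C0 by (auto simp: u invariant_vectors_def \<rho> tr)
  qed
  have "ip_norm T (\<rho> s (f \<xi>) \<ominus>\<^bsub>T\<^esub> f \<xi>) = ip_norm H (\<pi> s \<xi> \<ominus> \<xi>)" if "s \<in> S" for s
    using that S C\<xi> by (simp add: normT minusT \<rho> tr subset_iff)
  then have disp: "displacement T \<rho> S (f \<xi>) = displacement H \<pi> S \<xi>"
    unfolding displacement_def by (intro SUP_cong refl arg_cong[where f = ennreal])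
  have "kazhdan_constant G S \<le>
      (INF \<xi> \<in> {\<xi> \<in> carrier T. ip_norm T \<xi> = 1}. displacement T \<rho> S \<xi>)"
    unfolding kazhdan_constant_def
    by (rule INF_lower2[where i = "(T, \<rho>)"]) (use repT nzT invT in blast, simp)
  also have "\<dots> \<le> displacement T \<rho> S (f \<xi>)"
    by (rule INF_lower) (use f\<xi> T(1) in blast)
  finally show ?thesis unfolding disp .
qed


section \<open>Gromov hyperbolic spaces and their boundary\<close>

definition gromov_product :: "('x \<Rightarrow> 'x \<Rightarrow> real) \<Rightarrow> 'x \<Rightarrow> 'x \<Rightarrow> 'x \<Rightarrow> real" where
  "gromov_product d b x y = (d x b + d y b - d x y) / 2"

definition gromov_hyperbolic :: "'x set \<Rightarrow> ('x \<Rightarrow> 'x \<Rightarrow> real) \<Rightarrow> bool" where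
  "gromov_hyperbolic M d \<longleftrightarrow>
     (\<exists>\<delta>. \<forall>w\<in>M. \<forall>x\<in>M. \<forall>y\<in>M. \<forall>z\<in>M.
        gromov_product d w x z \<ge> min (gromov_product d w x y) (gromov_product d w y z) - \<delta>)"

definition diverges_together ::
  "('x \<Rightarrow> 'x \<Rightarrow> real) \<Rightarrow> 'x \<Rightarrow> (nat \<Rightarrow> 'x) \<Rightarrow> (nat \<Rightarrow> 'x) \<Rightarrow> bool" where
  "diverges_together d b x y \<longleftrightarrow>
     filterlim (\<lambda>(i, j). gromov_product d b (x i) (y j)) at_top (sequentially \<times>\<^sub>F sequentially)"

definition sequences_to_infinity :: "'x set \<Rightarrow> ('x \<Rightarrow> 'x \<Rightarrow> real) \<Rightarrow> 'x \<Rightarrow> (nat \<Rightarrow> 'x) set" where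
  "sequences_to_infinity M d b = {x. range x \<subseteq> M \<and> diverges_together d b x x}"

definition gromov_boundary :: "'x set \<Rightarrow> ('x \<Rightarrow> 'x \<Rightarrow> real) \<Rightarrow> 'x \<Rightarrow> (nat \<Rightarrow> 'x) set set" where
  "gromov_boundary M d b = sequences_to_infinity M d b //
     {(x, y) \<in> sequences_to_infinity M d b \<times> sequences_to_infinity M d b. diverges_together d b x y}"

definition boundary_product ::
  "('x \<Rightarrow> 'x \<Rightarrow> real) \<Rightarrow> 'x \<Rightarrow> (nat \<Rightarrow> 'x) set \<Rightarrow> (nat \<Rightarrow> 'x) set \<Rightarrow> ereal" where
  "boundary_product d b \<xi> \<eta> =
     (SUP x\<in>\<xi>. SUP y\<in>\<eta>.
        Liminf (sequentially \<times>\<^sub>F sequentially) (\<lambda>(i, j). ereal (gromov_product d b (x i) (y j))))"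

text \<open>The sets \<open>{\<eta>. boundary_product d b \<xi> \<eta> > R}\<close>, for real \<open>R\<close>, form a basis of (not necessarily
  open) neighbourhoods of \<open>\<xi>\<close>.\<close>

definition boundary_topology ::
  "'x set \<Rightarrow> ('x \<Rightarrow> 'x \<Rightarrow> real) \<Rightarrow> 'x \<Rightarrow> (nat \<Rightarrow> 'x) set topology" where
  "boundary_topology M d b = topology (\<lambda>V. V \<subseteq> gromov_boundary M d b \<and>
     (\<forall>\<xi>\<in>V. \<exists>R::real. {\<eta> \<in> gromov_boundary M d b. boundary_product d b \<xi> \<eta> > ereal R} \<subseteq> V))"

lemma openin_boundary_topology:
  "openin (boundary_topology M d b) V \<longleftrightarrow> V \<subseteq> gromov_boundary M d b \<and>
     (\<forall>\<xi>\<in>V. \<exists>R::real. {\<eta> \<in> gromov_boundary M d b. boundary_product d b \<xi> \<eta> > ereal R} \<subseteq> V)"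
proof -
  define N where
    "N \<xi> R = {\<eta> \<in> gromov_boundary M d b. boundary_product d b \<xi> \<eta> > ereal R}" for \<xi> and R :: real
  have mono: "N \<xi> R \<subseteq> N \<xi> R'" if "R' \<le> R" for \<xi> R R'
    unfolding N_def using that le_less_trans[of "ereal R'" "ereal R"] by auto
  have "istopology (\<lambda>V. V \<subseteq> gromov_boundary M d b \<and> (\<forall>\<xi>\<in>V. \<exists>R. N \<xi> R \<subseteq> V))"
    unfolding istopology_def
  proof (intro conjI allI impI ballI)
    fix V W \<xi>
    assume V: "V \<subseteq> gromov_boundary M d b \<and> (\<forall>\<xi>\<in>V. \<exists>R. N \<xi> R \<subseteq> V)"
      and W: "W \<subseteq> gromov_boundary M d b \<and> (\<forall>\<xi>\<in>W. \<exists>R. N \<xi> R \<subseteq> W)"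
      and \<xi>: "\<xi> \<in> V \<inter> W"
    then obtain R R' where R: "N \<xi> R \<subseteq> V" "N \<xi> R' \<subseteq> W" by blast
    have "N \<xi> (max R R') \<subseteq> V \<inter> W"
      using R mono[of R "max R R'" \<xi>] mono[of R' "max R R'" \<xi>] by auto
    then show "\<exists>R. N \<xi> R \<subseteq> V \<inter> W" ..
  next
    fix \<K> \<xi>
    assume \<K>: "\<forall>V\<in>\<K>. V \<subseteq> gromov_boundary M d b \<and> (\<forall>\<xi>\<in>V. \<exists>R. N \<xi> R \<subseteq> V)" and "\<xi> \<in> \<Union>\<K>"
    then obtain V where V: "V \<in> \<K>" "\<xi> \<in> V" by blast
    with \<K> obtain R where "N \<xi> R \<subseteq> V" by blast
    with V show "\<exists>R. N \<xi> R \<subseteq> \<Union>\<K>" by blast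
  qed blast+
  then show ?thesis
    unfolding boundary_topology_def N_def by (simp only: topology_inverse')
qed

lemma topspace_boundary_topology: "topspace (boundary_topology M d b) = gromov_boundary M d b"
proof (rule antisym)
  show "topspace (boundary_topology M d b) \<subseteq> gromov_boundary M d b"
    using openin_topspace[of "boundary_topology M d b"] unfolding openin_boundary_topology by blast
  have "openin (boundary_topology M d b) (gromov_boundary M d b)"
    unfolding openin_boundary_topology by blast
  then show "gromov_boundary M d b \<subseteq> topspace (boundary_topology M d b)"
    by (rule openin_subset)
qed

definition boundary_action ::
  "('a \<Rightarrow> 'x \<Rightarrow> 'x) \<Rightarrow> 'a \<Rightarrow> (nat \<Rightarrow> 'x) set \<Rightarrow> (nat \<Rightarrow> 'x) set" where
  "boundary_action \<phi> g \<xi> = (\<lambda>x. \<phi> g \<circ> x) ` \<xi>"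


section \<open>Limit sets\<close>

text \<open>Uniform convergence on \<open>K\<close> to the constant map \<open>a\<close> is expressed by open neighbourhoods of \<open>a\<close>;
  for a compact metrizable space this is uniform convergence for any compatible metric.\<close>

definition limit_set :: "'x topology \<Rightarrow> 'a set \<Rightarrow> ('a \<Rightarrow> 'x \<Rightarrow> 'x) \<Rightarrow> 'x set" where
  "limit_set X A \<phi> = {a \<in> topspace X. \<exists>(g :: nat \<Rightarrow> 'a) r. range g \<subseteq> A \<and> inj g \<and> r \<in> topspace X \<and>
     (\<forall>K. compactin X K \<and> K \<subseteq> topspace X - {r} \<longrightarrow>
        (\<forall>U. openin X U \<and> a \<in> U \<longrightarrow> (\<forall>\<^sub>F n in sequentially. \<forall>x\<in>K. \<phi> (g n) x \<in> U)))}"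

definition nonelementary :: "'x topology \<Rightarrow> 'a set \<Rightarrow> ('a \<Rightarrow> 'x \<Rightarrow> 'x) \<Rightarrow> bool" where
  "nonelementary X A \<phi> \<longleftrightarrow> infinite (limit_set X A \<phi>) \<or> card (limit_set X A \<phi>) > 2"


section \<open>Word-hyperbolic groups\<close>

definition word_length :: "('a, 'm) monoid_scheme \<Rightarrow> 'a set \<Rightarrow> 'a \<Rightarrow> nat" where
  "word_length G S g = (LEAST n. \<exists>w. length w = n \<and> set w \<subseteq> S \<union> m_inv G ` S \<and>
     foldr (\<otimes>\<^bsub>G\<^esub>) w \<one>\<^bsub>G\<^esub> = g)"

definition word_metric :: "('a, 'm) monoid_scheme \<Rightarrow> 'a set \<Rightarrow> 'a \<Rightarrow> 'a \<Rightarrow> real" where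
  "word_metric G S x y = real (word_length G S (inv\<^bsub>G\<^esub> x \<otimes>\<^bsub>G\<^esub> y))"

text \<open>Hyperbolicity is Gromov's four-point inequality on the vertex set of the Cayley graph, which is
  equivalent to hyperbolicity of the Cayley graph and gives the same boundary.\<close>

definition word_hyperbolic_wrt :: "('a, 'm) monoid_scheme \<Rightarrow> 'a set \<Rightarrow> bool" where
  "word_hyperbolic_wrt G S \<longleftrightarrow>
     group G \<and> finite_generating_set G S \<and> gromov_hyperbolic (carrier G) (word_metric G S)"

definition nonelementary_in_hyperbolic :: "('a, 'm) monoid_scheme \<Rightarrow> 'a set \<Rightarrow> 'a set \<Rightarrow> bool" where
  "nonelementary_in_hyperbolic G S A \<longleftrightarrow>
     nonelementary (boundary_topology (carrier G) (word_metric G S) \<one>\<^bsub>G\<^esub>) A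
       (boundary_action (\<otimes>\<^bsub>G\<^esub>))"


section \<open>Relatively hyperbolic groups\<close>

definition conical_limit_point ::
  "('a, 'm) monoid_scheme \<Rightarrow> 'x topology \<Rightarrow> ('a \<Rightarrow> 'x \<Rightarrow> 'x) \<Rightarrow> 'x \<Rightarrow> bool" where
  "conical_limit_point G X \<phi> x \<longleftrightarrow> x \<in> topspace X \<and>
     (\<exists>(g :: nat \<Rightarrow> 'a) a b. range g \<subseteq> carrier G \<and> inj g \<and> a \<noteq> b \<and>
        limitin X (\<lambda>n. \<phi> (g n) x) a sequentially \<and>
        (\<forall>y \<in> topspace X - {x}. limitin X (\<lambda>n. \<phi> (g n) y) b sequentially))"

definition loxodromic ::
  "('a, 'm) monoid_scheme \<Rightarrow> 'x topology \<Rightarrow> ('a \<Rightarrow> 'x \<Rightarrow> 'x) \<Rightarrow> 'a \<Rightarrow> bool" where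
  "loxodromic G X \<phi> g \<longleftrightarrow>
     (\<forall>n::nat. 0 < n \<longrightarrow> g [^]\<^bsub>G\<^esub> n \<noteq> \<one>\<^bsub>G\<^esub>) \<and> card (invariants (topspace X) \<phi> g) = 2"

definition parabolic_subgroup ::
  "('a, 'm) monoid_scheme \<Rightarrow> 'x topology \<Rightarrow> ('a \<Rightarrow> 'x \<Rightarrow> 'x) \<Rightarrow> 'a set \<Rightarrow> bool" where
  "parabolic_subgroup G X \<phi> A \<longleftrightarrow> subgroup A G \<and> infinite A \<and>
     (\<exists>p \<in> topspace X. \<forall>g\<in>A. \<phi> g p = p) \<and> (\<forall>g\<in>A. \<not> loxodromic G X \<phi> g)"

definition maximal_parabolic_subgroups ::
  "('a, 'm) monoid_scheme \<Rightarrow> 'x topology \<Rightarrow> ('a \<Rightarrow> 'x \<Rightarrow> 'x) \<Rightarrow> 'a set set" where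
  "maximal_parabolic_subgroups G X \<phi> =
     {A. parabolic_subgroup G X \<phi> A \<and> (\<forall>B. parabolic_subgroup G X \<phi> B \<and> A \<subseteq> B \<longrightarrow> B = A)}"

text \<open>The last clause says that the stabilizer of \<open>p\<close> acts cocompactly on the complement of \<open>p\<close>.\<close>

definition bounded_parabolic_point ::
  "('a, 'm) monoid_scheme \<Rightarrow> 'x topology \<Rightarrow> ('a \<Rightarrow> 'x \<Rightarrow> 'x) \<Rightarrow> 'x \<Rightarrow> bool" where
  "bounded_parabolic_point G X \<phi> p \<longleftrightarrow> p \<in> topspace X \<and>
     parabolic_subgroup G X \<phi> (stabilizer G \<phi> p) \<and>
     (\<exists>K. compactin X K \<and> K \<subseteq> topspace X - {p} \<and>
        (\<Union>g \<in> stabilizer G \<phi> p. \<phi> g ` K) = topspace X - {p})"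

text \<open>Bowditch's definition: \<open>G\<close> is hyperbolic relative to the family \<open>\<P>\<close> if it acts as in the
  following locale on some space \<open>(M, d)\<close>; the Bowditch boundary of \<open>G\<close> is the Gromov boundary of
  \<open>(M, d)\<close>. A proper path metric space is geodesic, and the base point \<open>b\<close> only serves to define
  Gromov products.\<close>

locale relatively_hyperbolic = Metric_space M d + group_action G M \<phi>
  for G :: "('a, 'm) monoid_scheme" and \<P> :: "'a set set"
    and M :: "'x set" and d :: "'x \<Rightarrow> 'x \<Rightarrow> real" and b :: 'x and \<phi> :: "'a \<Rightarrow> 'x \<Rightarrow> 'x" +
  assumes basepoint: "b \<in> M"
    and proper: "\<And>x r. compactin mtopology (mcball x r)"
    and geodesic: "\<lbrakk>x \<in> M; y \<in> M\<rbrakk> \<Longrightarrow>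
      \<exists>\<gamma>. \<gamma> 0 = x \<and> \<gamma> (d x y) = y \<and> \<gamma> ` {0..d x y} \<subseteq> M \<and>
        (\<forall>s\<in>{0..d x y}. \<forall>t\<in>{0..d x y}. d (\<gamma> s) (\<gamma> t) = \<bar>s - t\<bar>)"
    and hyperbolic: "gromov_hyperbolic M d"
    and isometric: "\<lbrakk>g \<in> carrier G; x \<in> M; y \<in> M\<rbrakk> \<Longrightarrow> d (\<phi> g x) (\<phi> g y) = d x y"
    and properly_discontinuous:
      "compactin mtopology K \<Longrightarrow> finite {g \<in> carrier G. \<phi> g ` K \<inter> K \<noteq> {}}"
    and geometrically_finite: "\<xi> \<in> gromov_boundary M d b \<Longrightarrow>
      conical_limit_point G (boundary_topology M d b) (boundary_action \<phi>) \<xi> \<or>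
      bounded_parabolic_point G (boundary_topology M d b) (boundary_action \<phi>) \<xi>"
    and peripheral:
      "\<P> = maximal_parabolic_subgroups G (boundary_topology M d b) (boundary_action \<phi>)"
    and peripheral_finitely_generated: "A \<in> \<P> \<Longrightarrow> finitely_generated (G\<lparr>carrier := A\<rparr>)"

end

theory Submission
  imports Defs "HOL-Algebra.Left_Coset" "HOL-Library.Diagonal_Subsequence"
begin

text \<open>In all three cases \<open>\<Gamma>\<close> acts properly by isometries on a hyperbolic space, and its orbits have at
  least three limit points in the Gromov boundary. Properness excludes a fixed limit point (it would
  make a power of a loxodromic element central), so there are an element \<open>x\<close> and, for given generators
  \<open>s\<^sub>1, \<dots>, s\<^sub>d\<close>, an element \<open>Y\<close> such that \<open>t\<^sub>0 = Y\<close> and \<open>t\<^sub>i = Y x\<^sup>\<epsilon> s\<^sub>i Y\<close> (with suitable exponents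
  \<open>\<epsilon> \<in> {0, 1}\<close>) play ping-pong inside a fundamental domain of \<open>x\<close>. For every \<open>N\<close> the conjugates
  \<open>x\<^sup>-\<^sup>k t\<^sub>i x\<^sup>k\<close> with \<open>i N \<le> k < (i + 1) N\<close> then generate a subgroup \<open>H\<close> that contains no nontrivial
  power of \<open>x\<close>. The \<open>d + 2\<close> elements \<open>x\<close> and \<open>x\<^sup>-\<^sup>i\<^sup>N t\<^sub>i x\<^sup>i\<^sup>N\<close> generate \<open>\<Gamma>\<close>, and all of them but \<open>x\<close> fix the
  \<open>N\<close> cosets \<open>x\<^sup>j H\<close>, \<open>0 \<le> j < N\<close>, while \<open>x\<close> moves only one of these out of the set. The normalized
  indicator function of this set in \<open>\<ell>\<^sup>2(\<Gamma>/H)\<close> is therefore displaced by at most \<open>sqrt (2 / N)\<close>.\<close>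

section \<open>Permutation representations\<close>

text \<open>The budget of \<open>d + 2\<close> generators shapes the construction. Two are spent on
  \<open>x\<close> and \<open>Y\<close>, so each given generator \<open>s\<close> must be carried by
  a single ping-pong element. Wrapping it as \<open>Y q Y\<close> makes the directions of this
  element and of its inverse follow those of \<open>Y\<close> and \<open>inv Y\<close>, whatever
  \<open>s\<close> does, unless \<open>q\<close> sends \<open>Y b\<close> towards
  \<open>inv Y b\<close> so that the word cancels; the choice between \<open>q = s\<close> and
  \<open>q = x s\<close> excludes this. The generating set depends on \<open>N\<close>: no single
  one is claimed to have constant 0. The blocks of \<open>N\<close> exponents are needed because
  conjugating the generator built from \<open>t i\<close> by \<open>x^j\<close> with
  \<open>j < N\<close> must give an element of \<open>H\<close>, while different \<open>t i\<close>
  must keep to different translates. Since no nontrivial power of \<open>x\<close> lies in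
  \<open>H\<close>, the coset space is infinite, so its l2-space has no nonzero invariant vector.
  The elements \<open>x\<close> and \<open>Y\<close> come from sequences \<open>g n\<close> with
  prescribed limits of \<open>g n b\<close> and of \<open>inv (g n) b\<close>. Products of such
  sequences let these two limits be chosen independently, except when the inner limits coincide;
  then a group element has to move that limit away, which is why a globally fixed limit point must
  be excluded.\<close>

definition l2_space :: "'x set \<Rightarrow> ('x \<Rightarrow> complex) inner_product_space" where
  "l2_space X =
     \<lparr>carrier = {f. (\<forall>x. x \<notin> X \<longrightarrow> f x = 0) \<and> (\<lambda>x. (cmod (f x))\<^sup>2) summable_on X},
      mult = undefined, one = undefined, zero = (\<lambda>_. 0), add = (\<lambda>f g x. f x + g x),
      smult = (\<lambda>c f x. c * f x), ip = (\<lambda>f g. \<Sum>\<^sub>\<infinity>x\<in>X. f x * cnj (g x))\<rparr>"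

lemma l2_space_simps [simp]:
  "f \<in> carrier (l2_space X) \<longleftrightarrow> (\<forall>x. x \<notin> X \<longrightarrow> f x = 0) \<and> (\<lambda>x. (cmod (f x))\<^sup>2) summable_on X"
  "\<zero>\<^bsub>l2_space X\<^esub> = (\<lambda>_. 0)"
  "f \<oplus>\<^bsub>l2_space X\<^esub> g = (\<lambda>x. f x + g x)"
  "c \<odot>\<^bsub>l2_space X\<^esub> f = (\<lambda>x. c * f x)"
  "ip (l2_space X) f g = (\<Sum>\<^sub>\<infinity>x\<in>X. f x * cnj (g x))"
  by (simp_all add: l2_space_def)

lemma square_summable_add:
  fixes f g :: "'x \<Rightarrow> complex"
  assumes "(\<lambda>x. (cmod (f x))\<^sup>2) summable_on X" "(\<lambda>x. (cmod (g x))\<^sup>2) summable_on X"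
  shows "(\<lambda>x. (cmod (f x + g x))\<^sup>2) summable_on X"
proof (rule summable_on_comparison_test)
  show "(\<lambda>x. 2 * (cmod (f x))\<^sup>2 + 2 * (cmod (g x))\<^sup>2) summable_on X"
    by (intro summable_on_add summable_on_cmult_right assms)
  fix x
  have "(cmod (f x + g x))\<^sup>2 \<le> (cmod (f x) + cmod (g x))\<^sup>2"
    by (intro power_mono norm_triangle_ineq) auto
  also have "\<dots> \<le> 2 * (cmod (f x))\<^sup>2 + 2 * (cmod (g x))\<^sup>2"
    using sum_squares_bound[of "cmod (f x)" "cmod (g x)"] by (simp add: power2_sum)
  finally show "(cmod (f x + g x))\<^sup>2 \<le> 2 * (cmod (f x))\<^sup>2 + 2 * (cmod (g x))\<^sup>2" .
qed auto

lemma square_summable_smult: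
  fixes f :: "'x \<Rightarrow> complex"
  assumes "(\<lambda>x. (cmod (f x))\<^sup>2) summable_on X"
  shows "(\<lambda>x. (cmod (c * f x))\<^sup>2) summable_on X"
  using summable_on_cmult_right[OF assms, of "(cmod c)\<^sup>2"] by (simp add: norm_mult power_mult_distrib)

lemma summable_mult_cnj:
  fixes f g :: "'x \<Rightarrow> complex"
  assumes "(\<lambda>x. (cmod (f x))\<^sup>2) summable_on X" "(\<lambda>x. (cmod (g x))\<^sup>2) summable_on X"
  shows "(\<lambda>x. f x * cnj (g x)) summable_on X"
proof (rule abs_summable_summable, rule summable_on_comparison_test)
  show "(\<lambda>x. (cmod (f x))\<^sup>2 + (cmod (g x))\<^sup>2) summable_on X"
    by (intro summable_on_add assms)
  fix x
  have "2 * (cmod (f x) * cmod (g x)) \<le> (cmod (f x))\<^sup>2 + (cmod (g x))\<^sup>2"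
    using sum_squares_bound[of "cmod (f x)" "cmod (g x)"] by simp
  moreover have "0 \<le> cmod (f x) * cmod (g x)" by simp
  ultimately show "norm (f x * cnj (g x)) \<le> (cmod (f x))\<^sup>2 + (cmod (g x))\<^sup>2"
    unfolding norm_mult complex_mod_cnj by linarith
qed auto

lemma infsum_complex_of_real:
  "(\<Sum>\<^sub>\<infinity>x\<in>X. complex_of_real (f x)) = complex_of_real (\<Sum>\<^sub>\<infinity>x\<in>X. f x)"
proof (cases "f summable_on X")
  case True
  then show ?thesis
    by (intro infsumI) (simp add: has_sum_of_real_iff)
next
  \<comment> \<open>Without summability both sides are the default value 0 of \<open>infsum\<close>:
    if the complex series were summable, so would be its real part.\<close>
  case False
  then have "\<not> (\<lambda>x. complex_of_real (f x)) summable_on X"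
    using summable_on_Re[of "\<lambda>x. complex_of_real (f x)" X] by auto
  then show ?thesis using False by (simp add: infsum_not_exists)
qed

lemma l2_ip_self: "ip (l2_space X) f f = complex_of_real (\<Sum>\<^sub>\<infinity>x\<in>X. (cmod (f x))\<^sup>2)"
  by (simp only: l2_space_simps complex_norm_square[symmetric] infsum_complex_of_real)

lemma module_l2_space: "module complex_ring (l2_space X)"
proof -
  have cr: "cring complex_ring"
    by (intro cringI abelian_groupI comm_monoidI)
      (auto simp: complex_ring_def algebra_simps intro: exI[of _ "- x" for x])
  have ag: "abelian_group (l2_space X)"
  proof (rule abelian_groupI)
    fix f assume "f \<in> carrier (l2_space X)"
    then show "\<exists>g\<in>carrier (l2_space X). g \<oplus>\<^bsub>l2_space X\<^esub> f = \<zero>\<^bsub>l2_space X\<^esub>"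
      by (intro bexI[of _ "\<lambda>x. - f x"]) auto
  qed (auto simp: square_summable_add add_ac)
  show ?thesis
    using cr ag
    by (intro moduleI) (auto simp: complex_ring_def square_summable_smult algebra_simps)
qed

interpretation l2: complex_inner_product_space "l2_space X" for X :: "'x set"
proof (intro complex_inner_product_space.intro module_l2_space
    complex_inner_product_space_axioms.intro)
  fix f g h :: "'x \<Rightarrow> complex"
  assume "f \<in> carrier (l2_space X)" "g \<in> carrier (l2_space X)" "h \<in> carrier (l2_space X)"
  then show "ip (l2_space X) (f \<oplus>\<^bsub>l2_space X\<^esub> g) h = ip (l2_space X) f h + ip (l2_space X) g h"
    by (simp add: distrib_right summable_mult_cnj infsum_add)
next
  fix f g :: "'x \<Rightarrow> complex" and c
  show "ip (l2_space X) (c \<odot>\<^bsub>l2_space X\<^esub> f) g = c * ip (l2_space X) f g"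
    by (simp add: mult.assoc infsum_cmult_right')
  show "ip (l2_space X) g f = cnj (ip (l2_space X) f g)"
    by (simp flip: infsum_cnj add: mult.commute)
next
  fix f :: "'x \<Rightarrow> complex"
  assume f: "f \<in> carrier (l2_space X)" and "f \<noteq> \<zero>\<^bsub>l2_space X\<^esub>"
  then obtain x where x: "f x \<noteq> 0" "x \<in> X" by (auto simp: fun_eq_iff)
  have "0 < (cmod (f x))\<^sup>2" using x by simp
  also have "\<dots> \<le> (\<Sum>\<^sub>\<infinity>x\<in>X. (cmod (f x))\<^sup>2)"
    using finite_sum_le_infsum[of "\<lambda>x. (cmod (f x))\<^sup>2" X "{x}"] f x by simp
  also have "\<dots> = Re (ip (l2_space X) f f)"
    by (simp only: l2_ip_self Re_complex_of_real)
  finally show "0 < Re (ip (l2_space X) f f)" .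
qed

lemma l2_norm: "ip_norm (l2_space X) f = sqrt (\<Sum>\<^sub>\<infinity>x\<in>X. (cmod (f x))\<^sup>2)"
  by (simp only: ip_norm_def l2_ip_self Re_complex_of_real)

lemma l2_minus:
  assumes "f \<in> carrier (l2_space X)" "g \<in> carrier (l2_space X)"
  shows "f \<ominus>\<^bsub>l2_space X\<^esub> g = (\<lambda>x. f x - g x)"
proof -
  have "\<ominus>\<^bsub>l2_space X\<^esub> g = (\<lambda>x. - g x)"
    by (rule l2.M.minus_equality) (use assms in auto)
  then show ?thesis by (simp add: a_minus_def)
qed

lemma square_summable_diff:
  fixes f g :: "'x \<Rightarrow> complex"
  assumes "(\<lambda>x. (cmod (f x))\<^sup>2) summable_on X" "(\<lambda>x. (cmod (g x))\<^sup>2) summable_on X"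
  shows "(\<lambda>x. (cmod (f x - g x))\<^sup>2) summable_on X"
  using square_summable_add[of f X "\<lambda>x. - g x"] assms by simp

text \<open>The limit is taken pointwise. The estimates are made on finite sets \<open>F\<close>,
  where a limit passes through the sum, with bounds independent of \<open>F\<close>; they yield both
  square-summability of the limit and convergence in norm.\<close>

lemma hilbert_l2_space: "complex_hilbert_space (l2_space X)"
proof (intro complex_hilbert_space.intro l2.complex_inner_product_space_axioms
    complex_hilbert_space_axioms.intro)
  interpret Metric_space "carrier (l2_space X)" "ip_dist (l2_space X)"
    by (rule l2.Metric_space_ip_dist)
  show mcomplete
    unfolding mcomplete_def
  proof (intro allI impI)
    fix s assume s: "MCauchy s"
    then have sc: "s n \<in> carrier (l2_space X)" for n
      unfolding MCauchy_def by blast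
    have sX: "s n x = 0" if "x \<notin> X" for n x using sc[of n] that by simp
    have ss: "(\<lambda>x. (cmod (s n x))\<^sup>2) summable_on X" for n using sc[of n] by simp
    have dist: "ip_dist (l2_space X) f g = sqrt (\<Sum>\<^sub>\<infinity>x\<in>X. (cmod (f x - g x))\<^sup>2)"
      if "f \<in> carrier (l2_space X)" "g \<in> carrier (l2_space X)" for f g
      using that l2_minus[OF that] by (simp add: ip_dist_def l2_norm del: l2_space_simps)
    have fin: "(\<Sum>x\<in>F. (cmod (s m x - s n x))\<^sup>2) \<le> (ip_dist (l2_space X) (s m) (s n))\<^sup>2"
      if "finite F" "F \<subseteq> X" for F m n
      unfolding dist[OF sc sc]
      using finite_sum_le_infsum[OF square_summable_diff[OF ss ss] that, of m n]
      by (simp add: infsum_nonneg)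
    have cauchy: "\<exists>N. \<forall>m\<ge>N. \<forall>n\<ge>N. ip_dist (l2_space X) (s m) (s n) < e" if "e > 0" for e
      using conjunct2[OF s[unfolded MCauchy_def]] that by meson
    have "Cauchy (\<lambda>n. s n x)" for x
    proof (cases "x \<in> X")
      case True
      show ?thesis
      proof (rule CauchyI)
        fix e :: real assume "e > 0"
        then obtain N where N: "\<forall>m\<ge>N. \<forall>n\<ge>N. ip_dist (l2_space X) (s m) (s n) < e"
          using cauchy by blast
        have "norm (s m x - s n x) \<le> ip_dist (l2_space X) (s m) (s n)" for m n
          using fin[of "{x}" m n] True power2_le_imp_le[OF _ nonneg] by simp
        then show "\<exists>M. \<forall>m\<ge>M. \<forall>n\<ge>M. norm (s m x - s n x) < e"
          using N by (meson le_less_trans)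
      qed
    qed (simp add: sX Cauchy_convergent_iff convergent_const)
    then have "\<exists>l. (\<lambda>n. s n x) \<longlonglongrightarrow> l" for x
      by (simp add: Cauchy_convergent_iff convergent_def)
    then obtain f where f: "\<And>x. (\<lambda>n. s n x) \<longlonglongrightarrow> f x" by metis
    have fX: "f x = 0" if "x \<notin> X" for x
      using f[of x] sX[OF that] by (simp add: LIMSEQ_const_iff)
    have close: "(\<Sum>x\<in>F. (cmod (s m x - f x))\<^sup>2) \<le> e\<^sup>2"
      if N: "\<forall>m\<ge>N. \<forall>n\<ge>N. ip_dist (l2_space X) (s m) (s n) < e" and m: "m \<ge> N"
        and F: "finite F" "F \<subseteq> X" for e N m F
    proof (rule LIMSEQ_le_const2)
      show "(\<lambda>n. \<Sum>x\<in>F. (cmod (s m x - s n x))\<^sup>2) \<longlonglongrightarrow> (\<Sum>x\<in>F. (cmod (s m x - f x))\<^sup>2)"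
        by (intro tendsto_intros f)
      have "(\<Sum>x\<in>F. (cmod (s m x - s n x))\<^sup>2) \<le> e\<^sup>2" if n: "n \<ge> N" for n
        using fin[OF F, of m n] power_mono[OF less_imp_le, of "ip_dist (l2_space X) (s m) (s n)" e 2]
          N m n nonneg by fastforce
      then show "\<exists>N. \<forall>n\<ge>N. (\<Sum>x\<in>F. (cmod (s m x - s n x))\<^sup>2) \<le> e\<^sup>2" by blast
    qed
    have summ: "(\<lambda>x. (cmod (s m x - f x))\<^sup>2) summable_on X"
      if N: "\<forall>m\<ge>N. \<forall>n\<ge>N. ip_dist (l2_space X) (s m) (s n) < e" and m: "m \<ge> N" for e N m
      by (rule nonneg_bdd_above_summable_on) (auto intro!: bdd_aboveI2 close[OF N m])
    obtain N1 where N1: "\<forall>m\<ge>N1. \<forall>n\<ge>N1. ip_dist (l2_space X) (s m) (s n) < 1"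
      using cauchy[of 1] by auto
    \<comment> \<open>The limit \<open>f\<close> is written as \<open>s N1 - (s N1 - f)\<close>, a
      difference of two square-summable functions.\<close>
    have "(\<lambda>x. (cmod (s N1 x - (s N1 x - f x)))\<^sup>2) summable_on X"
      by (intro square_summable_diff ss summ[OF N1]) auto
    then have fc: "f \<in> carrier (l2_space X)" using fX by simp
    have "\<exists>N. \<forall>n\<ge>N. ip_dist (l2_space X) (s n) f < e" if e: "e > 0" for e
    proof -
      obtain N where N: "\<forall>m\<ge>N. \<forall>n\<ge>N. ip_dist (l2_space X) (s m) (s n) < e / 2"
        using cauchy[of "e / 2"] e by auto
      have "ip_dist (l2_space X) (s n) f < e" if n: "n \<ge> N" for n
      proof -
        have "(\<Sum>\<^sub>\<infinity>x\<in>X. (cmod (s n x - f x))\<^sup>2) \<le> (e / 2)\<^sup>2"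
          by (rule infsum_le_finite_sums[OF summ[OF N n]]) (rule close[OF N n])
        then have "ip_dist (l2_space X) (s n) f \<le> e / 2"
          unfolding dist[OF sc fc] using e by (intro real_le_lsqrt) auto
        then show ?thesis using e by simp
      qed
      then show ?thesis by blast
    qed
    then show "\<exists>x. limitin mtopology s x sequentially"
      unfolding limit_metric_sequentially using sc fc by (intro exI[of _ f]) simp
  qed
qed

text \<open>The restriction to the carrier is there because a \<open>group_action\<close> takes
  values in \<open>Bij\<close>, whose elements are extensional; the value 0 off \<open>X\<close> is
  what membership in \<open>l2_space X\<close> demands.\<close>

definition permutation_rep ::
  "('a, 'm) monoid_scheme \<Rightarrow> 'x set \<Rightarrow> ('a \<Rightarrow> 'x \<Rightarrow> 'x) \<Rightarrow> 'a \<Rightarrow> ('x \<Rightarrow> complex) \<Rightarrow> 'x \<Rightarrow> complex" where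
  "permutation_rep G X \<alpha> g =
     (\<lambda>f\<in>carrier (l2_space X). \<lambda>x. if x \<in> X then f (\<alpha> (inv\<^bsub>G\<^esub> g) x) else 0)"

lemma (in group_action) permutation_rep_unitary:
  "unitary_representation G (l2_space E) (permutation_rep G E \<phi>)"
proof -
  let ?H = "l2_space E" and ?\<rho> = "permutation_rep G E \<phi>"
  interpret grp: group G using group_hom by (simp add: group_hom_def)
  have \<rho>: "?\<rho> g f = (\<lambda>x. if x \<in> E then f (\<phi> (inv g) x) else 0)" if "f \<in> carrier ?H" for g f
    using that unfolding permutation_rep_def by (rule restrict_apply')
  have bij: "bij_betw (\<phi> g) E E" if "g \<in> carrier G" for g
    using bij_prop0[OF that] by (simp add: Bij_def)
  have \<rho>H: "?\<rho> g f \<in> carrier ?H" if g: "g \<in> carrier G" and f: "f \<in> carrier ?H" for g f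
  proof -
    have "(\<lambda>x. (cmod (f (\<phi> (inv g) x)))\<^sup>2) summable_on E"
      using summable_on_reindex_bij_betw[OF bij, of "inv g" "\<lambda>x. (cmod (f x))\<^sup>2"] f g by simp
    then have "(\<lambda>x. (cmod (?\<rho> g f x))\<^sup>2) summable_on E"
      by (subst summable_on_cong[of _ _ "\<lambda>x. (cmod (f (\<phi> (inv g) x)))\<^sup>2"]) (simp_all add: \<rho>[OF f])
    then show ?thesis by (simp add: \<rho>[OF f])
  qed
  have act: "\<phi> g x \<in> E" if "g \<in> carrier G" "x \<in> E" for g x using element_image that by blast
  have \<rho>_mult: "?\<rho> (g \<otimes> h) f = ?\<rho> g (?\<rho> h f)"
    if "g \<in> carrier G" "h \<in> carrier G" "f \<in> carrier ?H" for g h f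
  proof
    fix x
    have "?\<rho> g (?\<rho> h f) x = (if x \<in> E then ?\<rho> h f (\<phi> (inv g) x) else 0)"
      by (simp only: \<rho>[OF \<rho>H[OF that(2,3)]])
    also have "\<dots> = ?\<rho> (g \<otimes> h) f x"
      using that(1,2) by (simp add: \<rho>[OF that(3)] grp.inv_mult_group composition_rule act)
    finally show "?\<rho> (g \<otimes> h) f x = ?\<rho> g (?\<rho> h f) x" ..
  qed
  have \<rho>_one: "?\<rho> \<one> f = f" if f: "f \<in> carrier ?H" for f
  proof
    fix x
    have "\<phi> \<one> x = x" if "x \<in> E" using that id_eq_one by (metis restrict_apply')
    then show "?\<rho> \<one> f x = f x" using f unfolding \<rho>[OF f] by simp
  qed
  have Bij: "?\<rho> g \<in> Bij (carrier ?H)" if g: "g \<in> carrier G" for g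
  proof -
    have "bij_betw (?\<rho> g) (carrier ?H) (carrier ?H)"
      by (rule bij_betw_byWitness[where f' = "?\<rho> (inv g)"])
        (use g in \<open>auto simp: \<rho>H \<rho>_one simp flip: \<rho>_mult simp del: l2_space_simps\<close>)
    then show ?thesis by (simp add: Bij_def permutation_rep_def)
  qed
  have "?\<rho> \<in> hom G (BijGroup (carrier ?H))"
  proof (rule homI)
    fix g h assume gh: "g \<in> carrier G" "h \<in> carrier G"
    show "?\<rho> g \<in> carrier (BijGroup (carrier ?H))" using Bij gh by (simp add: BijGroup_def)
    have "?\<rho> (g \<otimes> h) = compose (carrier ?H) (?\<rho> g) (?\<rho> h)"
    proof
      fix f show "?\<rho> (g \<otimes> h) f = compose (carrier ?H) (?\<rho> g) (?\<rho> h) f"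
        using \<rho>_mult gh
        by (cases "f \<in> carrier ?H")
          (auto simp: compose_def permutation_rep_def simp del: l2_space_simps)
    qed
    then show "?\<rho> (g \<otimes> h) = ?\<rho> g \<otimes>\<^bsub>BijGroup (carrier ?H)\<^esub> ?\<rho> h"
      using Bij gh by (simp add: BijGroup_def)
  qed
  then have "group_action G (carrier ?H) ?\<rho>"
    by (simp add: group_action_def group_hom_def group_hom_axioms_def group_BijGroup grp.is_group)
  moreover have "ip ?H (?\<rho> g f) (?\<rho> g h) = ip ?H f h"
    if "g \<in> carrier G" "f \<in> carrier ?H" "h \<in> carrier ?H" for g f h
  proof -
    have "ip ?H (?\<rho> g f) (?\<rho> g h)
        = (\<Sum>\<^sub>\<infinity>x\<in>E. f (\<phi> (inv g) x) * cnj (h (\<phi> (inv g) x)))"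
      using that by (auto simp del: l2_space_simps(1) simp: \<rho> intro!: infsum_cong)
    also have "\<dots> = ip ?H f h"
      using infsum_reindex_bij_betw[OF bij, of "inv g" "\<lambda>x. f x * cnj (h x)"] that by simp
    finally show ?thesis .
  qed
  moreover have "?\<rho> g (f \<oplus>\<^bsub>?H\<^esub> h) = ?\<rho> g f \<oplus>\<^bsub>?H\<^esub> ?\<rho> g h"
    if "f \<in> carrier ?H" "h \<in> carrier ?H" for g f h
    using l2.M.add.m_closed[OF that] that by (auto simp del: l2_space_simps(1) simp: \<rho> fun_eq_iff)
  moreover have "?\<rho> g (c \<odot>\<^bsub>?H\<^esub> f) = c \<odot>\<^bsub>?H\<^esub> ?\<rho> g f" if "f \<in> carrier ?H" for g f c
    using l2.smult_in_carrier[OF that, of c] that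
    by (auto simp del: l2_space_simps(1) simp: \<rho> fun_eq_iff)
  ultimately show ?thesis
    by (intro unitary_representation.intro hilbert_l2_space unitary_representation_axioms.intro)
qed

lemma infsum_finite_support:
  fixes f :: "'x \<Rightarrow> real"
  assumes "finite A" "A \<subseteq> X" "\<And>x. x \<in> X - A \<Longrightarrow> f x = 0"
  shows "f summable_on X" "infsum f X = sum f A"
proof -
  have "(f has_sum sum f A) A" using assms(1) by simp
  then have "(f has_sum sum f A) X"
    by (rule has_sum_cong_neutral[THEN iffD1, rotated -1]) (use assms in auto)
  then show "f summable_on X" "infsum f X = sum f A" 
    by (auto simp: summable_on_def infsumI)
qed

text \<open>An invariant vector is constant on orbits, so it vanishes when all orbits are infinite.
  For the normalized indicator function of \<open>F\<close>, the squared displacement under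
  \<open>s\<close> is the size of the symmetric difference of \<open>F\<close> and its image,
  divided by \<open>card F\<close>; the two halves of that difference have equal size because
  \<open>s\<close> acts injectively.\<close>

lemma (in group_action) kazhdan_constant_le_permutation:
  assumes countable: "countable (carrier G)" and S: "S \<subseteq> carrier G"
    and orb: "\<And>x. x \<in> E \<Longrightarrow> infinite (orbit G \<phi> x)"
    and F: "finite F" "F \<subseteq> E" "F \<noteq> {}"
    and almost_inv: "\<And>s. s \<in> S \<Longrightarrow> card (F - \<phi> s ` F) \<le> 1"
  shows "kazhdan_constant G S \<le> ennreal (sqrt (2 / card F))"
proof -
  let ?H = "l2_space E" and ?\<rho> = "permutation_rep G E \<phi>"
  interpret grp: group G using group_hom by (simp add: group_hom_def)
  have act: "\<phi> g x \<in> E" if "g \<in> carrier G" "x \<in> E" for g x using element_image that by blast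
  have act_inv: "\<phi> (inv g) x = y \<longleftrightarrow> x = \<phi> g y" if "g \<in> carrier G" "x \<in> E" "y \<in> E" for g x y
    using that by (metis orbit_sym_aux grp.inv_closed grp.inv_inv)
  have inj: "inj_on (\<phi> g) E" if "g \<in> carrier G" for g using inj_prop that by blast
  interpret unitary_representation G ?H ?\<rho> by (rule permutation_rep_unitary)
  have \<rho>: "?\<rho> g f = (\<lambda>x. if x \<in> E then f (\<phi> (inv g) x) else 0)" if "f \<in> carrier ?H" for g f
    using that unfolding permutation_rep_def by (rule restrict_apply')
  have inv0: "f = (\<lambda>_. 0)" if f: "f \<in> invariant_vectors G ?H ?\<rho>" for f
  proof (rule ccontr)
    assume "f \<noteq> (\<lambda>_. 0)"
    moreover have fH: "f \<in> carrier ?H" using f by (simp add: invariant_vectors_def)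
    ultimately obtain x where x: "f x \<noteq> 0" "x \<in> E" by (auto simp: fun_eq_iff)
    have const: "f y = f x" if y: "y \<in> orbit G \<phi> x" for y
    proof -
      obtain g where g: "g \<in> carrier G" "y = \<phi> g x" using y by (auto simp: orbit_def)
      then have "f y = ?\<rho> g f y" using f by (simp add: invariant_vectors_def)
      also have "\<phi> (inv g) y = x" using g act_inv[OF g(1) act[OF g(1) x(2)] x(2)] by simp
      then have "?\<rho> g f y = f x" using g x act by (simp add: \<rho>[OF fH])
      finally show ?thesis .
    qed
    define a where "a = (cmod (f x))\<^sup>2"
    have a: "a > 0" using x by (simp add: a_def)
    define b where "b = (\<Sum>\<^sub>\<infinity>x\<in>E. (cmod (f x))\<^sup>2)"
    \<comment> \<open>More than \<open>b / a\<close> points of one orbit already carry more than the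
      total squared norm \<open>b\<close>.\<close>
    obtain n :: nat where n: "b < n * a" using reals_Archimedean3[OF a] by blast
    obtain A where A: "finite A" "card A = n" "A \<subseteq> orbit G \<phi> x"
      using infinite_arbitrarily_large[OF orb[OF x(2)]] by blast
    have "A \<subseteq> E" using A(3) act x by (auto simp: orbit_def)
    then have "(\<Sum>x\<in>A. (cmod (f x))\<^sup>2) \<le> b"
      unfolding b_def using fH A by (intro finite_sum_le_infsum) auto
    also have "(\<Sum>x\<in>A. (cmod (f x))\<^sup>2) = (\<Sum>x\<in>A. a)"
      using A const by (intro sum.cong) (auto simp: a_def)
    finally show False using n A by simp
  qed
  have inv: "invariant_vectors G ?H ?\<rho> = {\<zero>\<^bsub>?H\<^esub>}"
    using inv0 by (auto simp: invariant_vectors_def \<rho>)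
  define c where "c = 1 / sqrt (card F)"
  have c: "c\<^sup>2 = 1 / card F" by (simp add: c_def power_divide)
  have cF: "card F > 0" using F by (simp add: card_gt_0_iff)
  define \<xi> where "\<xi> x = (if x \<in> F then complex_of_real c else 0)" for x
  have \<xi>_sum: "(\<lambda>x. (cmod (\<xi> x))\<^sup>2) summable_on E" "(\<Sum>\<^sub>\<infinity>x\<in>E. (cmod (\<xi> x))\<^sup>2) = (\<Sum>x\<in>F. (cmod (\<xi> x))\<^sup>2)"
    using infsum_finite_support[OF F(1,2), of "\<lambda>x. (cmod (\<xi> x))\<^sup>2"] by (auto simp: \<xi>_def)
  have \<xi>: "\<xi> \<in> carrier ?H" using \<xi>_sum F by (auto simp: \<xi>_def)
  have "ip_norm ?H \<xi> = 1"
    unfolding l2_norm \<xi>_sum using cF by (simp add: \<xi>_def c)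
  moreover have "displacement ?H ?\<rho> S \<xi> \<le> ennreal (sqrt (2 / card F))"
    unfolding displacement_def
  proof (rule SUP_least)
    fix s assume s: "s \<in> S"
    have sG: "s \<in> carrier G" by (rule subsetD[OF S s])
    define D where "D = (F - \<phi> s ` F) \<union> (\<phi> s ` F - F)"
    have sF: "\<phi> s ` F \<subseteq> E" by (rule image_subsetI, rule act[OF sG], rule subsetD[OF F(2)])
    have \<rho>\<xi>: "?\<rho> s \<xi> x = (if x \<in> \<phi> s ` F then complex_of_real c else 0)" for x
    proof (cases "x \<in> E")
      case True
      have "\<phi> (inv s) x \<in> F \<longleftrightarrow> x \<in> \<phi> s ` F"
      proof
        assume a: "\<phi> (inv s) x \<in> F"
        then have "x = \<phi> s (\<phi> (inv s) x)" using act_inv[OF sG True subsetD[OF F(2) a]] by blast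
        then show "x \<in> \<phi> s ` F" using a by (rule image_eqI)
      next
        assume "x \<in> \<phi> s ` F"
        then obtain y where "y \<in> F" "x = \<phi> s y" by blast
        then show "\<phi> (inv s) x \<in> F" using act_inv[OF sG True, of y] F(2) by auto
      qed
      then show ?thesis using True unfolding \<rho>[OF \<xi>] by (simp add: \<xi>_def)
    next
      case False
      then show ?thesis using sF unfolding \<rho>[OF \<xi>] by auto
    qed
    have "(\<Sum>\<^sub>\<infinity>x\<in>E. (cmod (?\<rho> s \<xi> x - \<xi> x))\<^sup>2) = (\<Sum>x\<in>D. (cmod (?\<rho> s \<xi> x - \<xi> x))\<^sup>2)"
      by (rule infsum_finite_support) (use F sF in \<open>auto simp: \<rho>\<xi> \<xi>_def D_def\<close>)
    also have "\<dots> = (\<Sum>x\<in>D. c\<^sup>2)"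
      by (rule sum.cong) (auto simp: \<rho>\<xi> \<xi>_def D_def)
    also have "\<dots> = card D / card F" by (simp add: c)
    finally have "ip_norm ?H (?\<rho> s \<xi> \<ominus>\<^bsub>?H\<^esub> \<xi>) = sqrt (card D / card F)"
      using l2_minus[OF rep_closed[OF sG \<xi>] \<xi>] by (simp add: l2_norm)
    moreover have "card D \<le> 2"
    proof -
      have "card (\<phi> s ` F) = card F"
        using inj[OF sG] F by (meson card_image inj_on_subset)
      then have "card (\<phi> s ` F - F) = card (F - \<phi> s ` F)"
        using F by (metis card_le_sym_Diff dual_order.antisym finite_imageI order_refl)
      moreover have "card D \<le> card (F - \<phi> s ` F) + card (\<phi> s ` F - F)"
        unfolding D_def by (rule card_Un_le)
      ultimately show ?thesis using almost_inv[OF s] by simp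
    qed
    ultimately show "ennreal (ip_norm ?H (?\<rho> s \<xi> \<ominus>\<^bsub>?H\<^esub> \<xi>)) \<le> ennreal (sqrt (2 / card F))"
      by (auto intro!: ennreal_leI divide_right_mono)
  qed
  \<comment> \<open>\<open>kazhdan_constant_le\<close> carries the bound over to the fixed type of
    vectors; this is where countability enters.\<close>
  ultimately show ?thesis
    using kazhdan_constant_le[OF countable S inv \<xi>] by (meson order_trans)
qed

section \<open>Ping-pong\<close>

definition letter :: "('a, 'm) monoid_scheme \<Rightarrow> ('i \<Rightarrow> 'a) \<Rightarrow> 'i \<times> bool \<Rightarrow> 'a" where
  "letter G z l = (if snd l then z (fst l) else inv\<^bsub>G\<^esub> z (fst l))"

definition opposite :: "'i \<times> bool \<Rightarrow> 'i \<times> bool" where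
  "opposite l = (fst l, \<not> snd l)"

text \<open>These are the values of nonempty words in which no letter stands next to its opposite.
  Only the leftmost letter is recorded: it decides both which letters may be added and where
  ping-pong sends a point.\<close>

inductive reduced_product ::
  "('a, 'm) monoid_scheme \<Rightarrow> 'i set \<Rightarrow> ('i \<Rightarrow> 'a) \<Rightarrow> 'a \<Rightarrow> 'i \<times> bool \<Rightarrow> bool"
  for G I z where
    single: "fst l \<in> I \<Longrightarrow> reduced_product G I z (letter G z l) l"
  | extend: "\<lbrakk>reduced_product G I z h l; fst m \<in> I; m \<noteq> opposite l\<rbrakk> \<Longrightarrow>
      reduced_product G I z (letter G z m \<otimes>\<^bsub>G\<^esub> h) m"

text \<open>The values of reduced words, together with the unit, are stable under left
  multiplication by a letter: it either cancels the leftmost letter and uncovers a shorter reduced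
  word, or lengthens the word.\<close>

lemma (in group) generate_imp_reduced_product:
  assumes z: "z ` I \<subseteq> carrier G" and h: "h \<in> generate G (z ` I)"
  shows "h = \<one> \<or> (\<exists>l. reduced_product G I z h l)"
proof -
  have lG: "letter G z l \<in> carrier G" if "fst l \<in> I" for l
    using z that by (auto simp: letter_def)
  have lopp: "letter G z (opposite l) = inv (letter G z l)" if "fst l \<in> I" for l
    using z that by (auto simp: letter_def opposite_def)
  have rG: "g \<in> carrier G \<and> fst l \<in> I" if "reduced_product G I z g l" for g l
    using that by induction (auto simp: lG)
  define R where "R = {g. g = \<one> \<or> (\<exists>l. reduced_product G I z g l)}"
  have RG: "R \<subseteq> carrier G" using rG by (auto simp: R_def)
  have step: "letter G z m \<otimes> g \<in> R" if g: "g \<in> R" and m: "fst m \<in> I" for m g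
  proof (cases "g = \<one>")
    case True
    then show ?thesis using reduced_product.single[OF m, of G z] lG[OF m] unfolding R_def
      by (metis mem_Collect_eq r_one)
  next
    case False
    then obtain l where l: "reduced_product G I z g l" using g by (auto simp: R_def)
    show ?thesis
    proof (cases "m = opposite l")
      case True
      from l have "fst l \<in> I" using rG by blast
      note lm = lopp[OF this] lG[OF this]
      from l show ?thesis
      proof cases
        case single
        then show ?thesis using lm by (simp add: True R_def)
      next
        case (extend h l')
        then have "letter G z m \<otimes> g = h"
          using lm rG[OF extend(2)] by (simp add: True flip: m_assoc)
        then show ?thesis using extend(2) unfolding R_def by blast
      qed
    next
      case False
      then show ?thesis using reduced_product.extend[OF l m] unfolding R_def by blast
    qed
  qed
  \<comment> \<open>Strengthened for the induction: maps that preserve \<open>R\<close> compose,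
    whereas \<open>R\<close> is not visibly closed under products. Applying \<open>h\<close> to the
    unit gives the claim.\<close>
  have "\<forall>g\<in>R. h \<otimes> g \<in> R"
    using h
  proof induction
    case one
    then show ?case using RG by auto
  next
    case (incl h)
    then obtain i where "i \<in> I" "h = z i" by blast
    then show ?case using step[of _ "(i, True)"] by (auto simp: letter_def)
  next
    case (inv h)
    then obtain i where "i \<in> I" "h = z i" by blast
    then show ?case using step[of _ "(i, False)"] by (auto simp: letter_def)
  next
    case (eng h1 h2)
    moreover have "h1 \<in> carrier G" "h2 \<in> carrier G"
      using eng z generate_incl by blast+
    ultimately show ?case using RG by (auto simp: m_assoc subset_iff)
  qed
  moreover have "h \<in> carrier G" using h z generate_incl by blast
  ultimately have "h \<in> R" by (force simp: R_def)
  then show ?thesis by (simp add: R_def)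
qed

text \<open>Unlike \<^locale>\<open>group_action\<close>, this does not require the maps to be extensional; left
  multiplication and the action on a metric space are instances without restriction.\<close>

locale set_action = group G for G :: "('a, 'm) monoid_scheme" (structure) +
  fixes X :: "'x set" and \<phi> :: "'a \<Rightarrow> 'x \<Rightarrow> 'x"
  assumes act_closed [simp]: "\<lbrakk>g \<in> carrier G; p \<in> X\<rbrakk> \<Longrightarrow> \<phi> g p \<in> X"
    and act_one [simp]: "p \<in> X \<Longrightarrow> \<phi> \<one> p = p"
    and act_mult: "\<lbrakk>g \<in> carrier G; h \<in> carrier G; p \<in> X\<rbrakk> \<Longrightarrow> \<phi> (g \<otimes> h) p = \<phi> g (\<phi> h p)"
begin

lemma act_inv_cancel [simp]:
  "\<lbrakk>g \<in> carrier G; p \<in> X\<rbrakk> \<Longrightarrow> \<phi> (inv g) (\<phi> g p) = p"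
  "\<lbrakk>g \<in> carrier G; p \<in> X\<rbrakk> \<Longrightarrow> \<phi> g (\<phi> (inv g) p) = p"
  by (simp_all flip: act_mult)

text \<open>Along a reduced word the image of \<open>p\<close> stays in the set of the leftmost
  letter \<open>l\<close>. The next letter \<open>m\<close> is not opposite to \<open>l\<close>, so
  \<open>D l\<close> misses \<open>D (opposite m)\<close>, the only set on which \<open>m\<close> is
  not controlled.\<close>

lemma ping_pong:
  fixes z :: "'i \<Rightarrow> 'a" and D :: "'i \<times> bool \<Rightarrow> 'x set"
  assumes z: "z ` I \<subseteq> carrier G"
    and moves: "\<And>l p. \<lbrakk>fst l \<in> I; p \<in> X; p \<notin> D (opposite l)\<rbrakk> \<Longrightarrow> \<phi> (letter G z l) p \<in> D l"
    and disjoint: "\<And>l m. \<lbrakk>fst l \<in> I; fst m \<in> I; l \<noteq> m\<rbrakk> \<Longrightarrow> D l \<inter> D m = {}"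
    and sub: "\<And>l. fst l \<in> I \<Longrightarrow> D l \<subseteq> X"
    and p: "p \<in> X" "\<And>l. fst l \<in> I \<Longrightarrow> p \<notin> D l"
    and h: "h \<in> generate G (z ` I)" "h \<noteq> \<one>"
  shows "\<exists>l. fst l \<in> I \<and> \<phi> h p \<in> D l"
proof -
  have "fst l \<in> I \<and> g \<in> carrier G \<and> \<phi> g p \<in> D l" if "reduced_product G I z g l" for g l
    using that
  proof induction
    case (single l)
    then show ?case using moves[of l p] p z by (auto simp: letter_def opposite_def)
  next
    case (extend g l m)
    have "letter G z m \<in> carrier G" using z extend by (auto simp: letter_def)
    moreover have "\<phi> g p \<notin> D (opposite m)"
    proof -
      have "l \<noteq> opposite m" using extend.hyps by (auto simp: opposite_def)
      then show ?thesis
        using disjoint[of l "opposite m"] extend by (auto simp: opposite_def)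
    qed
    ultimately show ?case using moves[of m "\<phi> g p"] extend p by (simp add: act_mult)
  qed
  then show ?thesis using generate_imp_reduced_product[OF z h(1)] h(2) by blast
qed

text \<open>The translates \<open>x\<^sup>k W\<close> of the complement \<open>W\<close> of \<open>A \<union> B\<close> are pairwise disjoint, so the
  conjugates of the \<open>t i\<close> by distinct powers of \<open>x\<close> play ping-pong in distinct translates of \<open>W\<close>, while
  the powers of \<open>x\<close> permute these translates.\<close>

lemma conjugates_avoid_powers:
  fixes t :: "'i \<Rightarrow> 'a" and e :: "'i \<Rightarrow> nat" and U V :: "'i \<Rightarrow> 'x set"
  assumes x: "x \<in> carrier G" and t: "t ` I \<subseteq> carrier G" and e: "inj_on e I" and i0: "i0 \<in> I"
    and xA: "\<And>p. \<lbrakk>p \<in> X; p \<notin> B\<rbrakk> \<Longrightarrow> \<phi> x p \<in> A"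
    and AB: "A \<inter> B = {}"
    and tU: "\<And>i p. \<lbrakk>i \<in> I; p \<in> X; p \<notin> V i\<rbrakk> \<Longrightarrow> \<phi> (t i) p \<in> U i"
    and tV: "\<And>i p. \<lbrakk>i \<in> I; p \<in> X; p \<notin> U i\<rbrakk> \<Longrightarrow> \<phi> (inv (t i)) p \<in> V i"
    and UV: "\<And>i. i \<in> I \<Longrightarrow> U i \<inter> V i = {}"
    and UVX: "\<And>i. i \<in> I \<Longrightarrow> U i \<union> V i \<subseteq> X - (A \<union> B)"
    and U0: "U i0 \<noteq> {}"
    and j: "j > 0"
  shows "x [^] (j::nat) \<notin> generate G ((\<lambda>i. inv (x [^] e i) \<otimes> t i \<otimes> x [^] e i) ` I)"
proof
  define z where "z i = inv (x [^] e i) \<otimes> t i \<otimes> x [^] e i" for i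
  define W where "W = X - (A \<union> B)"
  \<comment> \<open>The sets of \<open>t i\<close> pulled back by \<open>x^(e i)\<close>. They lie
    in the translate of \<open>W\<close> by the inverse of this power, so distinct exponents give
    disjoint sets.\<close>
  define D where
    "D l = {p \<in> X. \<phi> (x [^] e (fst l)) p \<in> (if snd l then U (fst l) else V (fst l))}" for l
  assume "x [^] j \<in> generate G ((\<lambda>i. inv (x [^] e i) \<otimes> t i \<otimes> x [^] e i) ` I)"
  then have h: "x [^] j \<in> generate G (z ` I)" by (simp add: z_def)
  have xG: "x [^] (n::nat) \<in> carrier G" for n using x by simp
  have tG: "t i \<in> carrier G" if "i \<in> I" for i using t that by blast
  have zG: "z ` I \<subseteq> carrier G" using xG tG by (auto simp: z_def)
  have powA: "\<phi> (x [^] Suc n) p \<in> A" if "p \<in> X" "p \<notin> B" for n p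
  proof (induction n)
    case 0
    then show ?case using xA that x by simp
  next
    case (Suc n)
    have "\<phi> (x [^] Suc (Suc n)) p = \<phi> x (\<phi> (x [^] Suc n) p)"
      using that x xG nat_pow_Suc2[OF x, of "Suc n"] by (metis act_mult)
    moreover have "\<phi> (x [^] Suc n) p \<notin> B" using Suc AB by blast
    ultimately show ?case using xA[OF act_closed[OF xG that(1)]] by metis
  qed
  have powW: "\<phi> (x [^] n) p \<notin> W" if "p \<in> W" "n > 0" for n :: nat and p
    using powA[of p "n - 1"] that by (auto simp: W_def)
  have W_once: "m = n" if "p \<in> X" "\<phi> (x [^] m) p \<in> W" "\<phi> (x [^] n) p \<in> W" for m n :: nat and p
  proof -
    have *: "\<not> m < n" if mn: "p \<in> X" "\<phi> (x [^] m) p \<in> W" "\<phi> (x [^] n) p \<in> W" for m n :: nat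
    proof
      assume "m < n"
      then have "x [^] n = x [^] (n - m) \<otimes> x [^] m" using x by (simp add: nat_pow_mult)
      then have "\<phi> (x [^] n) p = \<phi> (x [^] (n - m)) (\<phi> (x [^] m) p)" using act_mult mn x by simp
      then show False using powW[of "\<phi> (x [^] m) p" "n - m"] mn \<open>m < n\<close> by simp
    qed
    show ?thesis using *[of m n] *[of n m] that by force
  qed
  have DW: "\<phi> (x [^] e (fst l)) p \<in> W" if "p \<in> D l" "fst l \<in> I" for p l
    using that UVX[of "fst l"] by (auto simp: D_def W_def split: if_splits)
  obtain w where w: "w \<in> U i0" using U0 by blast
  then have wW: "w \<in> W" using UVX i0 by (auto simp: W_def)
  then have wX: "w \<in> X" by (simp add: W_def)
  \<comment> \<open>The point \<open>w\<close> may itself lie in some \<open>D l\<close>. Positive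
    powers of \<open>x\<close> never bring \<open>w\<close> back to \<open>W\<close>, so no
    \<open>x^n p\<close> with \<open>n >= 0\<close> lies in any \<open>D l\<close>; ping-pong,
    however, would put \<open>x^j p\<close> into one of them.\<close>
  define p where "p = \<phi> x w"
  have pX: "p \<in> X" using wX x by (simp add: p_def)
  have notD: "\<phi> (x [^] n) p \<notin> D l" if l: "fst l \<in> I" for n :: nat and l
  proof
    assume "\<phi> (x [^] n) p \<in> D l"
    then have "\<phi> (x [^] e (fst l)) (\<phi> (x [^] n) p) \<in> W" using DW l by blast
    moreover have "\<phi> (x [^] e (fst l)) (\<phi> (x [^] n) p) = \<phi> (x [^] (e (fst l) + n + 1)) w"
      using x wX by (simp add: p_def m_assoc flip: act_mult nat_pow_mult)
    ultimately show False using powW[OF wW, of "e (fst l) + n + 1"] by simp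
  qed
  have "\<exists>l. fst l \<in> I \<and> \<phi> (x [^] j) p \<in> D l"
  proof (rule ping_pong[OF zG _ _ _ pX _ h])
    fix l p assume l: "fst l \<in> I" and p: "p \<in> X" "p \<notin> D (opposite l)"
    define i where "i = fst l"
    note G = xG[of "e i"] tG[OF l, folded i_def]
    let ?q = "\<phi> (x [^] e i) p"
    have q: "?q \<in> X" using p G by simp
    show "\<phi> (letter G z l) p \<in> D l"
    proof (cases "snd l")
      case True
      have "\<phi> (z i) p = \<phi> (inv (x [^] e i)) (\<phi> (t i) ?q)"
        using G p by (simp add: z_def act_mult)
      moreover have "\<phi> (t i) ?q \<in> U i"
        using tU[of i ?q] p q l True by (auto simp: D_def opposite_def i_def)
      ultimately show ?thesis using True G q by (simp add: letter_def D_def flip: i_def)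
    next
      case False
      have "inv (z i) = inv (x [^] e i) \<otimes> inv (t i) \<otimes> x [^] e i"
        using G by (simp add: z_def inv_mult_group m_assoc)
      then have "\<phi> (inv (z i)) p = \<phi> (inv (x [^] e i)) (\<phi> (inv (t i)) ?q)"
        using G p by (simp add: act_mult)
      moreover have "\<phi> (inv (t i)) ?q \<in> V i"
        using tV[of i ?q] p q l False by (auto simp: D_def opposite_def i_def)
      ultimately show ?thesis using False G q by (simp add: letter_def D_def flip: i_def)
    qed
  next
    fix l m :: "'i \<times> bool" assume l: "fst l \<in> I" and m: "fst m \<in> I" and "l \<noteq> m"
    show "D l \<inter> D m = {}"
    proof (rule ccontr)
      assume "D l \<inter> D m \<noteq> {}"
      then obtain p where p: "p \<in> D l" "p \<in> D m" by blast
      then have "p \<in> X" by (simp add: D_def)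
      then have "e (fst l) = e (fst m)"
        by (rule W_once[OF _ DW[OF p(1) l] DW[OF p(2) m]])
      then have i: "fst l = fst m" using e l m by (auto simp: inj_on_def)
      then have "snd l \<noteq> snd m" using \<open>l \<noteq> m\<close> by (auto simp: prod_eq_iff)
      then show False using p i UV[OF l] by (auto simp: D_def split: if_splits)
    qed
  next
    fix l show "D l \<subseteq> X" by (auto simp: D_def)
  next
    fix l :: "'i \<times> bool" assume "fst l \<in> I"
    then show "p \<notin> D l" using notD[of l 0] pX by simp
  next
    show "x [^] j \<noteq> \<one>"
      using powW[OF wW j] wW wX by auto
  qed
  then show False using notD by blast
qed

end

subsection \<open>Almost invariant vectors on a coset space\<close>

lemma (in group) l_coset_eq_iff:
  assumes H: "subgroup H G" and a: "a \<in> carrier G" and c: "c \<in> carrier G"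
  shows "a <# H = c <# H \<longleftrightarrow> inv a \<otimes> c \<in> H"
proof
  assume "a <# H = c <# H"
  then have "c \<in> a <# H" using lcos_self[OF c H] by simp
  then show "inv a \<otimes> c \<in> H"
    using subgroup.lcos_module_imp[OF H is_group a] by blast
next
  assume "inv a \<otimes> c \<in> H"
  then have "c \<in> a <# H"
    using subgroup.lcos_module_rev[OF H is_group a c] by blast
  then show "a <# H = c <# H"
    using l_repr_independence[OF _ a H] by blast
qed

lemma (in group) action_on_lcosets:
  assumes H: "subgroup H G"
  shows "group_action G (lcosets H) (\<lambda>g. \<lambda>C\<in>lcosets H. g <# C)"
proof -
  let ?\<phi> = "\<lambda>g. \<lambda>C\<in>lcosets H. g <# C"
  have HG: "H \<subseteq> carrier G" using H by (rule subgroup.subset)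
  have coset: "\<exists>a\<in>carrier G. C = a <# H" if "C \<in> lcosets H" for C
    using that by (auto simp: LCOSETS_def)
  have mem: "a <# H \<in> lcosets H" if "a \<in> carrier G" for a
    using that by (auto simp: LCOSETS_def)
  have closed: "g <# C \<in> lcosets H" if "g \<in> carrier G" "C \<in> lcosets H" for g C
    using coset[OF that(2)] that(1) mem by (auto simp: lcos_m_assoc HG)
  have mult: "g <# (h <# C) = (g \<otimes> h) <# C" if "g \<in> carrier G" "h \<in> carrier G" "C \<in> lcosets H" for g h C
    using that lcosets_subset_PowG[OF H] by (auto simp: lcos_m_assoc)
  have one: "\<one> <# C = C" if "C \<in> lcosets H" for C
    using that lcosets_subset_PowG[OF H] by (auto simp: lcos_mult_one)
  have Bij: "?\<phi> g \<in> Bij (lcosets H)" if g: "g \<in> carrier G" for g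
  proof -
    have "bij_betw (?\<phi> g) (lcosets H) (lcosets H)"
      by (rule bij_betw_byWitness[where f' = "?\<phi> (inv g)"])
        (use g in \<open>auto simp: closed mult one\<close>)
    then show ?thesis by (simp add: Bij_def)
  qed
  have "?\<phi> \<in> hom G (BijGroup (lcosets H))"
  proof (rule homI)
    fix g h assume gh: "g \<in> carrier G" "h \<in> carrier G"
    show "?\<phi> g \<in> carrier (BijGroup (lcosets H))" using Bij gh by (simp add: BijGroup_def)
    have "?\<phi> (g \<otimes> h) = compose (lcosets H) (?\<phi> g) (?\<phi> h)"
      using gh by (auto simp: compose_def fun_eq_iff closed mult)
    then show "?\<phi> (g \<otimes> h) = ?\<phi> g \<otimes>\<^bsub>BijGroup (lcosets H)\<^esub> ?\<phi> h"
      using Bij gh by (simp add: BijGroup_def)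
  qed
  then show ?thesis
    by (simp add: group_action_def group_hom_def group_hom_axioms_def group_BijGroup is_group)
qed

text \<open>The finite set consists of the cosets \<open>x^j H\<close> with \<open>j < N\<close>. By
  \<open>SH\<close> every \<open>s\<close> other than \<open>x\<close> fixes each of them, and the
  image under \<open>x\<close> misses only \<open>c 0\<close>. The cosets \<open>x^j H\<close> are
  pairwise distinct and the action is transitive, so every orbit is infinite.\<close>

lemma (in group) kazhdan_constant_le_coset:
  assumes countable: "countable (carrier G)" and H: "subgroup H G" and S: "S \<subseteq> carrier G"
    and x: "x \<in> carrier G" and xH: "\<And>j::nat. j > 0 \<Longrightarrow> x [^] j \<notin> H" and N: "N > (0::nat)"
    and SH: "\<And>s j. \<lbrakk>s \<in> S; s \<noteq> x; j < N\<rbrakk> \<Longrightarrow> inv (x [^] (j::nat)) \<otimes> s \<otimes> x [^] j \<in> H"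
  shows "kazhdan_constant G S \<le> ennreal (sqrt (2 / N))"
proof -
  define \<phi> where "\<phi> = (\<lambda>g. \<lambda>C\<in>lcosets H. g <# C)"
  interpret group_action G "lcosets H" \<phi> unfolding \<phi>_def by (rule action_on_lcosets[OF H])
  have HG: "H \<subseteq> carrier G" using H by (rule subgroup.subset)
  have mem: "a <# H \<in> lcosets H" if "a \<in> carrier G" for a
    using that by (auto simp: LCOSETS_def)
  have \<phi>: "\<phi> g (a <# H) = (g \<otimes> a) <# H" if "g \<in> carrier G" "a \<in> carrier G" for g a
    using that by (simp add: \<phi>_def mem lcos_m_assoc HG)
  have xG: "x [^] j \<in> carrier G" for j :: nat using x by simp
  define c where "c j = x [^] (j::nat) <# H" for j
  have "inj c"
  proof (rule injI)
    have *: "\<not> i < j" if "c i = c j" for i j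
    proof
      assume "i < j"
      then have "x [^] j = x [^] i \<otimes> x [^] (j - i)" using x by (simp add: nat_pow_mult)
      then have "inv (x [^] i) \<otimes> x [^] j = x [^] (j - i)"
        using xG by (simp flip: m_assoc)
      then show False
        using that xH[of "j - i"] \<open>i < j\<close> l_coset_eq_iff[OF H xG xG, of i j] by (simp add: c_def)
    qed
    show "i = j" if "c i = c j" for i j using *[of i j] *[of j i] that by simp
  qed
  have orb: "infinite (orbit G \<phi> C)" if C: "C \<in> lcosets H" for C
  proof -
    obtain a where a: "a \<in> carrier G" "C = a <# H" using C by (auto simp: LCOSETS_def)
    have "c j = \<phi> (x [^] j \<otimes> inv a) C" for j
      using a xG by (simp add: \<phi> c_def m_assoc)
    then have "range c \<subseteq> orbit G \<phi> C" using a xG unfolding orbit_def by blast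
    then show ?thesis using range_inj_infinite[OF \<open>inj c\<close>] infinite_super by blast
  qed
  define F where "F = c ` {..<N}"
  have "card F = N" using \<open>inj c\<close> by (simp add: F_def card_image inj_on_subset)
  moreover have "card (F - \<phi> s ` F) \<le> 1" if s: "s \<in> S" for s
  proof (cases "s = x")
    case True
    have "F - \<phi> s ` F \<subseteq> {c 0}"
    proof
      fix C assume C: "C \<in> F - \<phi> s ` F"
      then obtain j where j: "j < N" "C = c j" by (auto simp: F_def)
      have "j = 0"
      proof (rule ccontr)
        assume "j \<noteq> 0"
        then have "c j = \<phi> x (c (j - 1))"
          using x xG nat_pow_Suc2[OF x, of "j - 1"] by (simp add: c_def \<phi>)
        then show False using C j True by (auto simp: F_def)
      qed
      then show "C \<in> {c 0}" using j by simp
    qed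
    then show ?thesis using card_mono[of "{c 0}"] by simp
  next
    case False
    have "\<phi> s (c j) = c j" if j: "j < N" for j
    proof -
      have sG: "s \<in> carrier G" using s S by blast
      have "x [^] j <# H = (s \<otimes> x [^] j) <# H"
        using SH[OF s False j] sG xG by (subst l_coset_eq_iff[OF H]) (simp_all add: m_assoc)
      then show ?thesis unfolding c_def \<phi>[OF sG xG] by (rule sym)
    qed
    then have "F - \<phi> s ` F = {}" by (force simp: F_def)
    then show ?thesis by (simp only: card.empty zero_le)
  qed
  ultimately show ?thesis
    using kazhdan_constant_le_permutation[OF countable S orb, of F] N xG mem
    by (auto simp: F_def c_def)
qed

section \<open>Schottky elements of a group acting on a hyperbolic space\<close>

text \<open>The assumption \<open>shadows\<close> replaces properness of the space: the points far from \<open>b\<close> are covered by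
  finitely many shadows of depth \<open>R\<close>, so that unbounded sequences subconverge to the boundary.\<close>

locale hyperbolic_action = set_action G M \<phi>
  for G :: "('a, 'm) monoid_scheme" (structure) and M :: "'x set" and \<phi> :: "'a \<Rightarrow> 'x \<Rightarrow> 'x" +
  fixes d :: "'x \<Rightarrow> 'x \<Rightarrow> real" and b :: 'x and \<delta> :: real
  assumes base [simp]: "b \<in> M"
    and dist_self [simp]: "p \<in> M \<Longrightarrow> d p p = 0"
    and dist_sym: "\<lbrakk>p \<in> M; q \<in> M\<rbrakk> \<Longrightarrow> d p q = d q p"
    and dist_nonneg: "\<lbrakk>p \<in> M; q \<in> M\<rbrakk> \<Longrightarrow> 0 \<le> d p q"
    and dist_triangle: "\<lbrakk>p \<in> M; q \<in> M; r \<in> M\<rbrakk> \<Longrightarrow> d p r \<le> d p q + d q r"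
    and dist_act: "\<lbrakk>g \<in> carrier G; p \<in> M; q \<in> M\<rbrakk> \<Longrightarrow> d (\<phi> g p) (\<phi> g q) = d p q"
    and delta_nonneg: "0 \<le> \<delta>"
    and four_point: "\<lbrakk>p \<in> M; q \<in> M; r \<in> M\<rbrakk> \<Longrightarrow>
      gromov_product d b p q - \<delta> \<le> gromov_product d b p r \<or>
      gromov_product d b q r - \<delta> \<le> gromov_product d b p r"
    and finite_orbit_ball: "finite {g \<in> carrier G. d b (\<phi> g b) \<le> R}"
    and shadows: "\<exists>P R'. finite P \<and> P \<subseteq> M \<and>
      (\<forall>p\<in>M. R' \<le> d b p \<longrightarrow> (\<exists>q\<in>P. R \<le> gromov_product d b p q))"
begin

section \<open>Gromov products at the base point, half-spaces and the Schottky criterion\<close>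

abbreviation gprod :: "'x \<Rightarrow> 'x \<Rightarrow> real" where "gprod \<equiv> gromov_product d b"

abbreviation pt :: "'a \<Rightarrow> 'x" where "pt g \<equiv> \<phi> g b"

definition len :: "'a \<Rightarrow> real" where "len g = d b (pt g)"

lemma gprod_sym: "\<lbrakk>p \<in> M; q \<in> M\<rbrakk> \<Longrightarrow> gprod p q = gprod q p"
  by (simp add: gromov_product_def dist_sym[of p q])

lemma gprod_nonneg: "\<lbrakk>p \<in> M; q \<in> M\<rbrakk> \<Longrightarrow> 0 \<le> gprod p q"
  using dist_triangle[of p b q] by (simp add: gromov_product_def dist_sym[of q b])

lemma gprod_le: "\<lbrakk>p \<in> M; q \<in> M\<rbrakk> \<Longrightarrow> gprod p q \<le> d b p" "\<lbrakk>p \<in> M; q \<in> M\<rbrakk> \<Longrightarrow> gprod p q \<le> d b q"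
  using dist_triangle[of q p b] dist_triangle[of p q b]
  by (simp_all add: gromov_product_def dist_sym[of q b] dist_sym[of p b] dist_sym[of p q])

lemma dist_eq: "\<lbrakk>p \<in> M; q \<in> M\<rbrakk> \<Longrightarrow> d p q = d b p + d b q - 2 * gprod p q"
  by (simp add: gromov_product_def dist_sym[of q b] dist_sym[of p b] field_simps)

lemma gprod_lipschitz:
  "\<lbrakk>p \<in> M; q \<in> M; r \<in> M\<rbrakk> \<Longrightarrow> gprod p r \<le> gprod q r + d p q"
  using dist_triangle[of p q b] dist_triangle[of q p r] by (simp add: gromov_product_def dist_sym[of q p] field_simps)

lemma gprod_self: "p \<in> M \<Longrightarrow> gprod p p = d b p"
  by (simp add: gromov_product_def dist_sym[of p b])

lemma pt_closed [simp]: "g \<in> carrier G \<Longrightarrow> pt g \<in> M"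
  by simp

lemma pt_mult: "\<lbrakk>g \<in> carrier G; h \<in> carrier G\<rbrakk> \<Longrightarrow> pt (g \<otimes> h) = \<phi> g (pt h)"
  by (simp add: act_mult)

lemma dist_act_left: "\<lbrakk>g \<in> carrier G; p \<in> M; q \<in> M\<rbrakk> \<Longrightarrow> d (\<phi> g p) q = d p (\<phi> (inv g) q)"
  using dist_act[of g p "\<phi> (inv g) q"] by simp

lemma len_inv [simp]: "g \<in> carrier G \<Longrightarrow> len (inv g) = len g"
  using dist_act_left[of g b b] by (simp add: len_def dist_sym[of b])

lemma len_nonneg: "g \<in> carrier G \<Longrightarrow> 0 \<le> len g"
  by (simp add: len_def dist_nonneg)

lemma dist_act_base_le: "\<lbrakk>g \<in> carrier G; p \<in> M\<rbrakk> \<Longrightarrow> d b (\<phi> g p) \<le> len g + d b p"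
  using dist_triangle[of b "pt g" "\<phi> g p"] dist_act[of g b p] by (simp add: len_def)

lemma dist_act_base_ge: "\<lbrakk>g \<in> carrier G; p \<in> M\<rbrakk> \<Longrightarrow> d b p - len g \<le> d b (\<phi> g p)"
  using dist_act_base_le[of "inv g" "\<phi> g p"] by simp

lemma len_mult: "\<lbrakk>g \<in> carrier G; h \<in> carrier G\<rbrakk> \<Longrightarrow> len (g \<otimes> h) \<le> len g + len h"
  using dist_act_base_le[of g "pt h"] by (simp add: len_def pt_mult)

lemma gprod_le_len:
  "\<lbrakk>g \<in> carrier G; p \<in> M\<rbrakk> \<Longrightarrow> gprod p (pt g) \<le> len g"
  "\<lbrakk>g \<in> carrier G; p \<in> M\<rbrakk> \<Longrightarrow> gprod (pt g) p \<le> len g"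
  by (simp_all add: len_def gprod_le)

text \<open>An exact identity: the triangles \<open>b, g p, g b\<close> and
  \<open>b, p, inv g b\<close> have the same side lengths, with the roles of two sides exchanged. It
  turns "\<open>p\<close> is not in the direction of \<open>inv g b\<close>" into
  "\<open>g p\<close> is in the direction of \<open>g b\<close>" without any error term.\<close>

lemma gprod_act:
  assumes "g \<in> carrier G" "p \<in> M"
  shows "gprod (\<phi> g p) (pt g) = len g - gprod p (pt (inv g))"
proof -
  have "d (\<phi> g p) (pt g) = d b p"
    using assms dist_act[of g p b] by (simp add: dist_sym[of p b])
  moreover have "d p (pt (inv g)) = d b (\<phi> g p)"
    using assms dist_act_left[of g p b] by (simp add: dist_sym[of b])
  ultimately show ?thesis
    using dist_eq[of "\<phi> g p" "pt g"] dist_eq[of p "pt (inv g)"] assms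
    by (simp flip: len_def)
qed

lemma gprod_act_left:
  assumes "g \<in> carrier G" "p \<in> M" "q \<in> M"
  shows "gprod (\<phi> g p) q \<le> gprod p (\<phi> (inv g) q) + len g"
  using dist_eq[of "\<phi> g p" q] dist_eq[of p "\<phi> (inv g) q"] dist_act_left[of g p q]
    dist_act_base_le[of g p] dist_act_base_le[of g "\<phi> (inv g) q"] assms by simp

lemma dist_act_base:
  assumes "g \<in> carrier G" "p \<in> M"
  shows "d b (\<phi> g p) = len g + d b p - 2 * gprod p (pt (inv g))"
  using gprod_act[OF assms] dist_eq[of "\<phi> g p" "pt g"] dist_act[of g p b] assms
  by (simp add: dist_sym[of p b] flip: len_def)

text \<open>Unfolding the product, these are the points at least as close to \<open>g b\<close> as
  to \<open>b\<close>. Hence \<open>g\<close> maps the complement of the half-space of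
  \<open>inv g\<close> into that of \<open>g\<close>.\<close>

definition halfspace :: "'a \<Rightarrow> 'x set" where
  "halfspace g = {p \<in> M. len g / 2 \<le> gprod p (pt g)}"

lemma act_halfspace:
  assumes "g \<in> carrier G" "p \<in> M" "p \<notin> halfspace (inv g)"
  shows "\<phi> g p \<in> halfspace g"
  using assms gprod_act[of g p] by (simp add: halfspace_def)

lemma halfspaces_disjoint:
  assumes "g \<in> carrier G" "h \<in> carrier G"
    and "gprod (pt g) (pt h) < len g / 2 - \<delta>" "gprod (pt g) (pt h) < len h / 2 - \<delta>"
  shows "halfspace g \<inter> halfspace h = {}"
proof (rule ccontr)
  assume "halfspace g \<inter> halfspace h \<noteq> {}"
  then obtain p where p: "p \<in> M" "len g / 2 \<le> gprod p (pt g)" "len h / 2 \<le> gprod p (pt h)"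
    by (auto simp: halfspace_def)
  then show False
    using four_point[of "pt g" p "pt h"] gprod_sym[of p "pt g"] assms by auto
qed

lemma countable_group: "countable (carrier G)"
proof -
  have "carrier G \<subseteq> (\<Union>n::nat. {g \<in> carrier G. d b (pt g) \<le> n})"
    using real_arch_simple by auto
  moreover have "countable (\<Union>n::nat. {g \<in> carrier G. d b (pt g) \<le> n})"
    by (intro countable_UN countableI_type countable_finite finite_orbit_ball)
  ultimately show ?thesis by (rule countable_subset)
qed

text \<open>The inequalities that \<open>halfspaces_disjoint\<close> asks for among
  \<open>t\<close>, \<open>inv t\<close>, \<open>x\<close>, \<open>inv x\<close>, except for the
  pair \<open>x\<close>, \<open>inv x\<close>, which is required separately because it does not
  involve \<open>t\<close>.\<close>

definition schottky :: "'a \<Rightarrow> 'a \<Rightarrow> bool" where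
  "schottky x t \<longleftrightarrow> gprod (pt t) (pt (inv t)) < len t / 2 - \<delta> \<and>
     (\<forall>u\<in>{t, inv t}. \<forall>v\<in>{x, inv x}. gprod (pt u) (pt v) < min (len x) (len t) / 2 - \<delta>)"

text \<open>For each \<open>N\<close> a generating set of at most \<open>card T + 1\<close> elements
  with constant at most \<open>sqrt (2 / N)\<close> is built; the infimum over generating sets is
  then 0.\<close>

lemma kazhdan_constant_upto_eq_0_if_schottky:
  assumes x: "x \<in> carrier G" "gprod (pt x) (pt (inv x)) < len x / 2 - \<delta>"
    and T: "finite T" "T \<noteq> {}" "T \<subseteq> carrier G" "generate G (insert x T) = carrier G"
    and schottky: "\<And>t. t \<in> T \<Longrightarrow> schottky x t" and r: "card T < r"
  shows "kazhdan_constant_upto r G = 0"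
proof -
  obtain f :: "'a \<Rightarrow> nat" where f: "inj_on f T"
    using finite_imp_inj_to_nat_seg[OF T(1)] by auto
  have xG: "x [^] n \<in> carrier G" for n :: nat using x by simp
  have tG: "t \<in> carrier G" if "t \<in> T" for t using T that by blast
  have small: "kazhdan_constant_upto r G \<le> ennreal (sqrt (2 / N))" if N: "N > 0" for N :: nat
  proof -
    define I where "I = T \<times> {..<N}"
    \<comment> \<open>Numbers the pairs in \<open>T \<times> {..<N}\<close> without repetition:
      \<open>f\<close> numbers the blocks, and quotient and remainder modulo \<open>N\<close>
      recover the pair.\<close>
    define e where "e i = f (fst i) * N + snd i" for i
    define z where "z i = inv (x [^] e i) \<otimes> fst i \<otimes> x [^] e i" for i
    define H where "H = generate G (z ` I)"
    define s where "s t = inv (x [^] (f t * N)) \<otimes> t \<otimes> x [^] (f t * N)" for t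
    define S where "S = insert x (s ` T)"
    have sG: "s t \<in> carrier G" if "t \<in> T" for t using tG[OF that] xG by (simp add: s_def)
    have SG: "S \<subseteq> carrier G" using sG x by (auto simp: S_def)
    have zG: "z ` I \<subseteq> carrier G" using tG xG by (auto simp: z_def I_def)
    have HG: "subgroup H G" unfolding H_def by (rule generate_is_subgroup[OF zG])
    have e: "inj_on e I"
    proof (rule inj_onI)
      fix i j assume i: "i \<in> I" and j: "j \<in> I" and eq: "e i = e j"
      have "snd i = e i mod N" "f (fst i) = e i div N" "snd j = e j mod N" "f (fst j) = e j div N"
        using i j by (auto simp: e_def I_def)
      then have "snd i = snd j" "f (fst i) = f (fst j)" unfolding eq by simp_all
      then show "i = j" using inj_onD[OF f] i j by (auto simp: I_def prod_eq_iff)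
    qed
    obtain t0 where t0: "t0 \<in> T" using T by blast
    have xH: "x [^] j \<notin> H" if j: "j > 0" for j :: nat
      unfolding H_def z_def
    proof (rule conjugates_avoid_powers[where A = "halfspace x" and B = "halfspace (inv x)"
          and U = "\<lambda>i. halfspace (fst i)" and V = "\<lambda>i. halfspace (inv (fst i))" and ?i0.0 = "(t0, 0)"])
      show "fst ` I \<subseteq> carrier G" using tG by (auto simp: I_def)
      show "(t0, 0) \<in> I" using t0 N by (simp add: I_def)
      show "halfspace x \<inter> halfspace (inv x) = {}"
        using x by (intro halfspaces_disjoint) auto
      show "halfspace (fst (t0, 0)) \<noteq> {}"
        using tG[OF t0] by (auto simp: halfspace_def gprod_self len_def dist_nonneg intro!: exI[of _ "pt t0"])
    next
      fix i assume "i \<in> I"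
      then have t: "fst i \<in> T" by (auto simp: I_def)
      note G = tG[OF t] x(1)
      have sch: "gprod (pt (fst i)) (pt (inv fst i)) < len (fst i) / 2 - \<delta>"
        "\<And>u v. \<lbrakk>u \<in> {fst i, inv fst i}; v \<in> {x, inv x}\<rbrakk> \<Longrightarrow>
          gprod (pt u) (pt v) < min (len x) (len (fst i)) / 2 - \<delta>"
        using schottky[OF t] by (auto simp: schottky_def)
      show "halfspace (fst i) \<inter> halfspace (inv fst i) = {}"
        using G sch(1) by (intro halfspaces_disjoint) auto
      have disj: "halfspace u \<inter> halfspace v = {}" if "u \<in> {fst i, inv fst i}" "v \<in> {x, inv x}" for u v
      proof (rule halfspaces_disjoint)
        have "len u = len (fst i)" "len v = len x" using that G by auto
        then show "gprod (pt u) (pt v) < len u / 2 - \<delta>" "gprod (pt u) (pt v) < len v / 2 - \<delta>"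
          using sch(2)[OF that] by auto
      qed (use that G in auto)
      have "halfspace u \<subseteq> M" for u by (auto simp: halfspace_def)
      then show "halfspace (fst i) \<union> halfspace (inv fst i) \<subseteq> M - (halfspace x \<union> halfspace (inv x))"
        using disj[of "fst i" x] disj[of "fst i" "inv x"]
          disj[of "inv fst i" x] disj[of "inv fst i" "inv x"] by blast
    next
      fix i p assume "i \<in> I" "p \<in> M" "p \<notin> halfspace (fst i)"
      then show "\<phi> (inv fst i) p \<in> halfspace (inv fst i)"
        using act_halfspace[of "inv fst i" p] tG by (auto simp: I_def)
    qed (use x e j tG in \<open>auto simp: I_def intro!: act_halfspace\<close>)
    have "inv (x [^] j) \<otimes> u \<otimes> x [^] j \<in> H" if u: "u \<in> S" "u \<noteq> x" and j: "j < N" for u and j :: nat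
    proof -
      obtain t where t: "t \<in> T" "u = s t" using u by (auto simp: S_def)
      \<comment> \<open>Conjugating by \<open>x^j\<close> moves the exponent from the start of the
        block of \<open>t\<close> to \<open>f t * N + j\<close>, still inside the block because
        \<open>j < N\<close>.\<close>
      have "inv (x [^] j) \<otimes> u \<otimes> x [^] j = z (t, j)"
        using tG[OF t(1)] x xG
        by (simp add: t(2) s_def z_def e_def m_assoc inv_mult_group flip: nat_pow_mult)
      then show ?thesis using t j by (auto simp: H_def I_def intro!: generate.incl)
    qed
    then have "kazhdan_constant G S \<le> ennreal (sqrt (2 / N))"
      by (intro kazhdan_constant_le_coset[OF countable_group HG SG x(1) xH N]) auto
    moreover have "finite_generating_set G S"
    proof -
      have sub: "subgroup (generate G S) G" by (rule generate_is_subgroup[OF SG])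
      have xS: "x \<in> generate G S" by (auto simp: S_def intro: generate.incl)
      have "t \<in> generate G S" if t: "t \<in> T" for t
      proof -
        have xp: "x [^] n \<in> generate G S" for n :: nat
          by (induction n) (use xS subgroup.one_closed[OF sub] subgroup.m_closed[OF sub] in auto)
        have "s t \<in> generate G S" using t by (auto simp: S_def intro: generate.incl)
        then have "x [^] (f t * N) \<otimes> s t \<otimes> inv (x [^] (f t * N)) \<in> generate G S"
          using xp sub by (auto intro!: subgroup.m_closed subgroup.m_inv_closed)
        moreover have "x [^] (f t * N) \<otimes> s t \<otimes> inv (x [^] (f t * N)) = t"
          using tG[OF t] xG[of "f t * N"] by (simp add: s_def m_assoc) (simp flip: m_assoc)
        ultimately show ?thesis by simp
      qed
      then have "generate G (insert x T) \<subseteq> generate G S"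
        using xS by (intro generate_subgroup_incl[OF _ sub]) auto
      then show ?thesis
        using T SG generate_incl[OF SG] by (auto simp: finite_generating_set_def S_def)
    qed
    moreover have "card S \<le> r"
    proof -
      have "card S \<le> Suc (card (s ` T))" unfolding S_def by (rule card_insert_le_m1) auto
      then show ?thesis using card_image_le[OF T(1), of s] r by linarith
    qed
    ultimately show ?thesis
      unfolding kazhdan_constant_upto_def by (intro INF_lower2[of S]) auto
  qed
  have lim: "(\<lambda>N. ennreal (sqrt (2 / real N))) \<longlonglongrightarrow> ennreal (sqrt 0)"
    by (intro tendsto_ennrealI tendsto_real_sqrt lim_const_over_n)
  have "kazhdan_constant_upto r G \<le> ennreal (sqrt 0)"
    by (rule LIMSEQ_le_const[OF lim]) (use small in \<open>auto intro!: exI[of _ 1]\<close>)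
  then show ?thesis by simp
qed

section \<open>Turning an arbitrary generating set into Schottky elements\<close>

lemma four_point_le:
  assumes "p \<in> M" "q \<in> M" "r \<in> M" "A \<le> gprod p q" "A \<le> gprod q r"
  shows "A - \<delta> \<le> gprod p r"
  using four_point[OF assms(1-3)] assms(4,5) by linarith

text \<open>If \<open>s\<close> takes \<open>Y b\<close> too close to the direction of \<open>Y\<^sup>-\<^sup>1 b\<close>, then \<open>x\<close> moves it away from there.\<close>

lemma schottky_multiple:
  assumes G: "x \<in> carrier G" "Y \<in> carrier G" "s \<in> carrier G"
    and Yx: "\<And>u v. \<lbrakk>u \<in> {Y, inv Y}; v \<in> {x, inv x}\<rbrakk> \<Longrightarrow> gprod (pt u) (pt v) < len x / 2 - 3 * \<delta>"
    and K: "3 * len x + len s + 3 * \<delta> < K"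
    and Y: "K \<le> len Y" "gprod (pt Y) (pt (inv Y)) \<le> len Y / 2 - K"
  shows "\<exists>q\<in>{s, x \<otimes> s}. schottky x (Y \<otimes> q \<otimes> Y)"
proof -
  have nonneg: "0 \<le> len x" "0 \<le> len s" "0 \<le> len Y" using G by (auto intro: len_nonneg)
  \<comment> \<open>If \<open>p = s Y b\<close> is close to the direction of \<open>inv Y b\<close>,
    it lies outside the half-space of \<open>inv x\<close>, from which \<open>inv Y b\<close> is
    separated. So \<open>x p\<close> enters the half-space of \<open>x\<close>, from which
    \<open>inv Y b\<close> is separated too.\<close>
  have "\<exists>q\<in>{s, x \<otimes> s}. gprod (pt (inv Y)) (\<phi> q (pt Y)) < len x"
  proof (rule ccontr)
    assume "\<not> ?thesis"
    then have *: "len x \<le> gprod (pt (inv Y)) (\<phi> s (pt Y))"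
      "len x \<le> gprod (pt (inv Y)) (\<phi> (x \<otimes> s) (pt Y))" by auto
    define p where "p = \<phi> s (pt Y)"
    have p: "p \<in> M" using G by (simp add: p_def)
    have xp: "\<phi> (x \<otimes> s) (pt Y) = \<phi> x p" using G by (simp add: p_def act_mult)
    have "gprod p (pt (inv x)) < len x / 2"
    proof (rule ccontr)
      assume "\<not> ?thesis"
      then have "len x / 2 - \<delta> \<le> gprod (pt (inv Y)) (pt (inv x))"
        using *(1) p G nonneg by (intro four_point_le[of _ p]) (auto simp flip: p_def)
      then show False using Yx[of "inv Y" "inv x"] delta_nonneg by simp
    qed
    then have "len x / 2 < gprod (\<phi> x p) (pt x)" using gprod_act[OF G(1) p] by simp
    then have "len x / 2 - \<delta> \<le> gprod (pt (inv Y)) (pt x)"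
      using *(2) p G nonneg by (intro four_point_le[of _ "\<phi> x p"]) (auto simp: xp)
    then show False using Yx[of "inv Y" x] delta_nonneg by simp
  qed
  then obtain q where q: "q \<in> {s, x \<otimes> s}" "gprod (pt (inv Y)) (\<phi> q (pt Y)) < len x" by blast
  have qG: "q \<in> carrier G" using q G by auto
  have qlen: "len q \<le> len x + len s" using q(1) G nonneg len_mult[of x s] by auto
  define t where "t = Y \<otimes> q \<otimes> Y"
  have tG: "t \<in> carrier G" using G qG by (simp add: t_def)
  have ptt: "pt t = \<phi> Y (\<phi> q (pt Y))" using G qG by (simp add: t_def act_mult)
  have "inv t = inv Y \<otimes> inv q \<otimes> inv Y" using G qG by (simp add: t_def inv_mult_group m_assoc)
  then have ptt': "pt (inv t) = \<phi> (inv Y) (\<phi> (inv q) (pt (inv Y)))" using G qG by (simp add: act_mult)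
  have tY: "len Y - len x \<le> gprod (pt t) (pt Y)"
    using gprod_act[of Y "\<phi> q (pt Y)"] q(2) G qG gprod_sym[of "pt (inv Y)" "\<phi> q (pt Y)"]
    by (simp add: ptt)
  \<comment> \<open>The bound for \<open>q\<close> is passed on to \<open>inv q\<close> at the price
    of \<open>len q\<close>, hence the weaker constant for \<open>inv t\<close> than for
    \<open>t\<close>.\<close>
  have "gprod (\<phi> (inv q) (pt (inv Y))) (pt Y) \<le> gprod (pt (inv Y)) (\<phi> q (pt Y)) + len q"
    using gprod_act_left[of "inv q" "pt (inv Y)" "pt Y"] G qG by simp
  then have tY': "len Y - 2 * len x - len s \<le> gprod (pt (inv t)) (pt (inv Y))"
    using gprod_act[of "inv Y" "\<phi> (inv q) (pt (inv Y))"] q(2) qlen G qG by (simp add: ptt')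
  have tlen: "2 * len Y - 3 * len x - len s \<le> len t"
  proof -
    have "len t = len Y + d b (\<phi> q (pt Y)) - 2 * gprod (\<phi> q (pt Y)) (pt (inv Y))"
      unfolding len_def[of t] ptt using dist_act_base[of Y "\<phi> q (pt Y)"] G qG by simp
    moreover have "len Y - len q \<le> d b (\<phi> q (pt Y))"
      using dist_act_base_ge[of q "pt Y"] G qG by (simp add: len_def)
    moreover have "gprod (\<phi> q (pt Y)) (pt (inv Y)) < len x"
      using q(2) gprod_sym[of "pt (inv Y)" "\<phi> q (pt Y)"] G qG by simp
    ultimately show ?thesis using qlen by linarith
  qed
  have bound: "gprod (pt u) (pt v) < min (len x) (len t) / 2 - \<delta>"
    if "u \<in> {t, inv t}" "v \<in> {x, inv x}" for u v
  proof -
    \<comment> \<open>The element \<open>Y\<close> or \<open>inv Y\<close> whose direction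
      \<open>u b\<close> follows; separation of \<open>w\<close> from \<open>v\<close> is inherited
      by \<open>u\<close> up to \<delta>.\<close>
    define w where "w = (if u = t then Y else inv Y)"
    have w: "w \<in> {Y, inv Y}" "len x \<le> gprod (pt u) (pt w)" "w \<in> carrier G" "u \<in> carrier G"
      using that(1) tY tY' K Y nonneg delta_nonneg G tG by (auto simp: w_def)
    have v: "v \<in> carrier G" "len v = len x" using that(2) G by auto
    have "gprod (pt u) (pt v) \<le> len x" using gprod_le_len(1)[of v "pt u"] v w by simp
    then have "gprod (pt u) (pt v) - \<delta> \<le> gprod (pt w) (pt v)"
      using w v by (intro four_point_le[of _ "pt u"]) (auto simp: gprod_sym[of "pt w" "pt u"])
    then have "gprod (pt u) (pt v) < len x / 2 - 2 * \<delta>" using Yx[OF w(1) that(2)] by linarith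
    moreover have "len x \<le> len t" using tlen K Y nonneg delta_nonneg by linarith
    ultimately show ?thesis using delta_nonneg by simp
  qed
  have "gprod (pt t) (pt (inv t)) < len t / 2 - \<delta>"
  proof (rule ccontr)
    assume *: "\<not> ?thesis"
    \<comment> \<open>A common lower bound for the products along the chain \<open>Y b\<close>,
      \<open>t b\<close>, \<open>inv t b\<close>, \<open>inv Y b\<close>. Two four-point steps would
      make \<open>Y b\<close> and \<open>inv Y b\<close> closer than the choice of \<open>K\<close>
      allows.\<close>
    define A where "A = len Y - 2 * len x - len s - \<delta>"
    have tt': "A \<le> gprod (pt t) (pt (inv t))"
      using * tlen nonneg by (simp add: A_def)
    have "A - \<delta> \<le> gprod (pt Y) (pt (inv t))"
      using tY tt' nonneg delta_nonneg G tG
      by (intro four_point_le[of _ "pt t"]) (auto simp: A_def gprod_sym[of "pt Y" "pt t"])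
    then have "A - \<delta> - \<delta> \<le> gprod (pt Y) (pt (inv Y))"
      using tY' nonneg delta_nonneg G tG
      by - (rule four_point_le[of _ "pt (inv t)"], auto simp: A_def)
    then show False using K Y nonneg by (simp add: A_def)
  qed
  then have "schottky x t" using bound by (simp add: schottky_def)
  then show ?thesis using q(1) by (auto simp: t_def)
qed

text \<open>One \<open>Y\<close> serves all generators at once. Keeping \<open>Y\<close> in the
  ping-pong family allows \<open>q s\<close> to be recovered as \<open>inv Y (Y q Y) inv Y\<close>,
  and then \<open>s\<close> with the help of \<open>x\<close>; so \<open>T\<close> has at most
  \<open>card S + 1\<close> elements, and \<open>x\<close> is the last one.\<close>

lemma kazhdan_constant_upto_eq_0_if_schottky_sequence:
  assumes x: "x \<in> carrier G" "gprod (pt x) (pt (inv x)) < len x / 2 - \<delta>"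
    and Y: "\<And>K. \<exists>Y\<in>carrier G. K \<le> len Y \<and> gprod (pt Y) (pt (inv Y)) \<le> len Y / 2 - K \<and>
      (\<forall>u\<in>{Y, inv Y}. \<forall>v\<in>{x, inv x}. gprod (pt u) (pt v) < len x / 2 - 3 * \<delta>)"
    and S: "finite_generating_set G S" and r: "card S + 2 \<le> r"
  shows "kazhdan_constant_upto r G = 0"
proof -
  have finS: "finite S" and SG: "S \<subseteq> carrier G" and genS: "generate G S = carrier G"
    using S by (auto simp: finite_generating_set_def)
  \<comment> \<open>The sum of all lengths dominates each \<open>len s\<close>, so
    \<open>schottky_multiple\<close> applies to every \<open>s\<close> with the same
    \<open>Y\<close>.\<close>
  define K where "K = 3 * len x + (\<Sum>s\<in>S. len s) + 3 * \<delta> + 1"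
  obtain Y where YG: "Y \<in> carrier G" and YK: "K \<le> len Y" "gprod (pt Y) (pt (inv Y)) \<le> len Y / 2 - K"
    and Yx: "\<And>u v. \<lbrakk>u \<in> {Y, inv Y}; v \<in> {x, inv x}\<rbrakk> \<Longrightarrow> gprod (pt u) (pt v) < len x / 2 - 3 * \<delta>"
    using Y[of K] by blast
  have sum0: "0 \<le> (\<Sum>s\<in>S. len s)" using SG by (intro sum_nonneg len_nonneg) auto
  have x0: "0 \<le> len x" "0 \<le> len Y" using x YG by (auto intro: len_nonneg)
  have "\<exists>q. q \<in> {s, x \<otimes> s} \<and> schottky x (Y \<otimes> q \<otimes> Y)" if s: "s \<in> S" for s
  proof -
    have "len s \<le> (\<Sum>s\<in>S. len s)" using SG by (intro member_le_sum s finS) (auto intro: len_nonneg)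
    then have "3 * len x + len s + 3 * \<delta> < K" by (simp add: K_def)
    then show ?thesis
      using schottky_multiple[OF x(1) YG _ Yx _ YK, of s] s SG by blast
  qed
  then obtain q where q: "\<And>s. s \<in> S \<Longrightarrow> q s \<in> {s, x \<otimes> s}"
    "\<And>s. s \<in> S \<Longrightarrow> schottky x (Y \<otimes> q s \<otimes> Y)" by metis
  have qG: "q s \<in> carrier G" if "s \<in> S" for s using q(1)[OF that] that SG x by auto
  define T where "T = insert Y ((\<lambda>s. Y \<otimes> q s \<otimes> Y) ` S)"
  have TG: "T \<subseteq> carrier G" using YG qG by (auto simp: T_def)
  show ?thesis
  proof (rule kazhdan_constant_upto_eq_0_if_schottky[OF x])
    show "finite T" "T \<noteq> {}" using finS by (auto simp: T_def)
    show "T \<subseteq> carrier G" by (rule TG)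
    have sub: "subgroup (generate G (insert x T)) G"
      using x TG by (intro generate_is_subgroup) auto
    have mem: "y \<in> generate G (insert x T)" if "y \<in> insert x T" for y
      using that by (rule generate.incl)
    have "s \<in> generate G (insert x T)" if s: "s \<in> S" for s
    proof -
      have sG: "s \<in> carrier G" using s SG by blast
      have YT: "inv Y \<in> generate G (insert x T)" "inv x \<in> generate G (insert x T)"
        by (rule subgroup.m_inv_closed[OF sub mem], simp add: T_def)+
      have "Y \<otimes> q s \<otimes> Y \<in> generate G (insert x T)" using mem s by (auto simp: T_def)
      then have "inv Y \<otimes> (Y \<otimes> q s \<otimes> Y) \<otimes> inv Y \<in> generate G (insert x T)"
        by (intro subgroup.m_closed[OF sub _ YT(1)] subgroup.m_closed[OF sub YT(1)])
      moreover have "inv Y \<otimes> (Y \<otimes> q s \<otimes> Y) \<otimes> inv Y = q s"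
        using YG qG[OF s] by (simp add: m_assoc) (simp flip: m_assoc)
      ultimately have qs: "q s \<in> generate G (insert x T)" by simp
      show ?thesis
      proof (cases "q s = s")
        case False
        then have "inv x \<otimes> q s = s" using q(1)[OF s] x sG by (simp flip: m_assoc)
        then show ?thesis using subgroup.m_closed[OF sub YT(2) qs] by simp
      qed (use qs in simp)
    qed
    then have "generate G S \<subseteq> generate G (insert x T)"
      by (intro generate_subgroup_incl[OF _ sub]) auto
    then show "generate G (insert x T) = carrier G"
      using genS generate_incl[of "insert x T"] x TG by auto
    show "schottky x t" if "t \<in> T" for t
    proof (cases "t = Y")
      case True
      have "gprod (pt u) (pt v) < min (len x) (len Y) / 2 - \<delta>"
        if "u \<in> {Y, inv Y}" "v \<in> {x, inv x}" for u v
        using Yx[OF that] YK(1) sum0 x0 delta_nonneg by (simp add: K_def min_def)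
      moreover have "gprod (pt Y) (pt (inv Y)) < len Y / 2 - \<delta>"
        using YK(2) sum0 x0 delta_nonneg by (simp add: K_def)
      ultimately show ?thesis using True by (simp add: schottky_def)
    qed (use that q in \<open>auto simp: T_def\<close>)
    have "card T \<le> Suc (card ((\<lambda>s. Y \<otimes> q s \<otimes> Y) ` S))"
      unfolding T_def by (rule card_insert_le_m1) auto
    then show "card T < r" using card_image_le[OF finS, of "\<lambda>s. Y \<otimes> q s \<otimes> Y"] r by linarith
  qed
qed

section \<open>The Gromov boundary and limits of group elements\<close>

abbreviation diverges :: "(nat \<Rightarrow> 'x) \<Rightarrow> (nat \<Rightarrow> 'x) \<Rightarrow> bool" where
  "diverges \<equiv> diverges_together d b"

abbreviation bdry :: "(nat \<Rightarrow> 'x) set set" where "bdry \<equiv> gromov_boundary M d b"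

lemma diverges_iff:
  "diverges p q \<longleftrightarrow> (\<forall>C. \<exists>n. \<forall>i\<ge>n. \<forall>j\<ge>n. C \<le> gprod (p i) (q j))"
  unfolding diverges_together_def filterlim_at_top eventually_prod_sequentially prod.case by blast

lemma diverges_sym:
  assumes "range p \<subseteq> M" "range q \<subseteq> M" "diverges p q"
  shows "diverges q p"
proof -
  have "gprod (p i) (q j) = gprod (q j) (p i)" for i j using assms by (intro gprod_sym) auto
  then show ?thesis using assms(3) unfolding diverges_iff by metis
qed

lemma diverges_trans:
  assumes M: "range p \<subseteq> M" "range q \<subseteq> M" "range r \<subseteq> M" and pq: "diverges p q" and qr: "diverges q r"
  shows "diverges p r"
  unfolding diverges_iff
proof
  fix C
  obtain n where n: "\<forall>i\<ge>n. \<forall>j\<ge>n. C + \<delta> \<le> gprod (p i) (q j)"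
    using pq unfolding diverges_iff by blast
  obtain m where m: "\<forall>i\<ge>m. \<forall>j\<ge>m. C + \<delta> \<le> gprod (q i) (r j)"
    using qr unfolding diverges_iff by blast
  have "C \<le> gprod (p i) (r j)" if "i \<ge> max n m" "j \<ge> max n m" for i j
    using four_point_le[of "p i" "q (max n m)" "r j" "C + \<delta>"] n m that M
    by (simp add: image_subset_iff)
  then show "\<exists>n. \<forall>i\<ge>n. \<forall>j\<ge>n. C \<le> gprod (p i) (r j)" by blast
qed

lemma equiv_diverges:
  "equiv (sequences_to_infinity M d b)
     {(x, y) \<in> sequences_to_infinity M d b \<times> sequences_to_infinity M d b. diverges x y}"
  by (rule equivI)
    (auto simp: refl_on_def sym_def trans_def sequences_to_infinity_def intro: diverges_sym diverges_trans)

lemma bdry_nonempty: "\<xi> \<in> bdry \<Longrightarrow> \<exists>p. p \<in> \<xi>"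
  unfolding gromov_boundary_def using in_quotient_imp_non_empty[OF equiv_diverges] by fast

lemma bdry_range: "\<lbrakk>\<xi> \<in> bdry; p \<in> \<xi>\<rbrakk> \<Longrightarrow> p i \<in> M"
  unfolding gromov_boundary_def using in_quotient_imp_subset[OF equiv_diverges]
  by (fastforce simp: sequences_to_infinity_def)

lemma bdry_diverges: "\<lbrakk>\<xi> \<in> bdry; p \<in> \<xi>; q \<in> \<xi>\<rbrakk> \<Longrightarrow> diverges p q"
  unfolding gromov_boundary_def using quotient_eq_iff[OF equiv_diverges, of \<xi> \<xi> p q] by blast

lemma bdry_eq: "\<lbrakk>\<xi> \<in> bdry; \<eta> \<in> bdry; p \<in> \<xi>; q \<in> \<eta>; diverges p q\<rbrakk> \<Longrightarrow> \<xi> = \<eta>"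
  using quotient_eqI[OF equiv_diverges, of \<xi> \<eta> p q]
    in_quotient_imp_subset[OF equiv_diverges, of \<xi>] in_quotient_imp_subset[OF equiv_diverges, of \<eta>]
  unfolding gromov_boundary_def by blast

lemma bdry_class:
  assumes "range p \<subseteq> M" "diverges p p"
  shows "\<exists>\<xi>\<in>bdry. p \<in> \<xi>"
proof -
  have p: "p \<in> sequences_to_infinity M d b" using assms by (simp add: sequences_to_infinity_def)
  show ?thesis
    unfolding gromov_boundary_def
    by (rule bexI[OF _ quotientI[OF p]]) (rule equiv_class_self[OF equiv_diverges p])
qed

lemma bdry_memI:
  assumes \<xi>: "\<xi> \<in> bdry" and p: "p \<in> \<xi>" and q: "range q \<subseteq> M" and pq: "diverges p q"
  shows "q \<in> \<xi>"
proof -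
  have pM: "range p \<subseteq> M" using bdry_range[OF \<xi> p] by blast
  have "diverges q q" using diverges_trans[OF q pM q diverges_sym[OF pM q pq] pq] .
  then obtain \<eta> where "\<eta> \<in> bdry" "q \<in> \<eta>" using bdry_class q by blast
  then show ?thesis using bdry_eq[OF \<xi> _ p _ pq] by blast
qed

lemma bdry_unbounded: "\<lbrakk>\<xi> \<in> bdry; p \<in> \<xi>\<rbrakk> \<Longrightarrow> \<exists>n. \<forall>i\<ge>n. C \<le> d b (p i)"
proof -
  assume \<xi>: "\<xi> \<in> bdry" "p \<in> \<xi>"
  obtain n where n: "\<forall>i\<ge>n. \<forall>j\<ge>n. C \<le> gprod (p i) (p j)"
    using bdry_diverges[OF \<xi> \<xi>(2)] unfolding diverges_iff by blast
  have "C \<le> d b (p i)" if "i \<ge> n" for i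
    using n that gprod_self[OF bdry_range[OF \<xi>, of i]] by force
  then show ?thesis by blast
qed

text \<open>Failure of divergence yields only one late pair of indices with a small product. Late
  terms of the same sequence have large mutual products, so two four-point steps spread this bound
  to all late pairs.\<close>

lemma bdry_bounded:
  assumes \<xi>: "\<xi> \<in> bdry" "p \<in> \<xi>" and \<eta>: "\<eta> \<in> bdry" "q \<in> \<eta>" and ne: "\<xi> \<noteq> \<eta>"
  shows "\<exists>D n. \<forall>i\<ge>n. \<forall>j\<ge>n. gprod (p i) (q j) \<le> D"
proof -
  have "\<not> diverges p q" using bdry_eq[OF \<xi>(1) \<eta>(1) \<xi>(2) \<eta>(2)] ne by blast
  then obtain C where C: "\<And>n. \<exists>i\<ge>n. \<exists>j\<ge>n. gprod (p i) (q j) < C"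
    unfolding diverges_iff by (auto simp: not_le)
  obtain n where n: "\<forall>i\<ge>n. \<forall>j\<ge>n. C + 2 * \<delta> \<le> gprod (p i) (p j)"
    using bdry_diverges[OF \<xi> \<xi>(2)] unfolding diverges_iff by blast
  obtain m where m: "\<forall>i\<ge>m. \<forall>j\<ge>m. C + 2 * \<delta> \<le> gprod (q i) (q j)"
    using bdry_diverges[OF \<eta> \<eta>(2)] unfolding diverges_iff by blast
  obtain i j where ij: "i \<ge> max n m" "j \<ge> max n m" "gprod (p i) (q j) < C" using C by blast
  have "gprod (p i') (q j') \<le> C + 2 * \<delta>" if "i' \<ge> max n m" "j' \<ge> max n m" for i' j'
  proof (rule ccontr)
    assume "\<not> ?thesis"
    then have "C + 2 * \<delta> - \<delta> \<le> gprod (p i) (q j')"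
      using n ij that bdry_range \<xi> \<eta> by (intro four_point_le[of _ "p i'"]) auto
    then have "C + 2 * \<delta> - \<delta> - \<delta> \<le> gprod (p i) (q j)"
    proof (rule four_point_le[of "p i" "q j'" "q j", rotated 3])
      have "C + 2 * \<delta> \<le> gprod (q j') (q j)" using m ij(2) that by simp
      then show "C + 2 * \<delta> - \<delta> \<le> gprod (q j') (q j)" using delta_nonneg by linarith
    qed (use bdry_range \<xi> \<eta> in auto)
    then show False using ij by simp
  qed
  then show ?thesis by blast
qed

text \<open>Closeness at equal indices suffices: late terms of \<open>p\<close> are close to each
  other, so \<open>q j\<close> is close to \<open>p i\<close> for different late indices as
  well.\<close>

lemma bdry_shadow:
  assumes \<xi>: "\<xi> \<in> bdry" "p \<in> \<xi>" and q: "range q \<subseteq> M"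
    and close: "\<And>C. \<exists>n. \<forall>i\<ge>n. C \<le> gprod (p i) (q i)"
  shows "q \<in> \<xi>"
proof (rule bdry_memI[OF \<xi> q])
  show "diverges p q"
    unfolding diverges_iff
  proof
    fix C
    obtain n where n: "\<forall>i\<ge>n. \<forall>j\<ge>n. C + \<delta> \<le> gprod (p i) (p j)"
      using bdry_diverges[OF \<xi> \<xi>(2)] unfolding diverges_iff by blast
    obtain m where m: "\<forall>i\<ge>m. C + \<delta> \<le> gprod (p i) (q i)" using close by blast
    have "C \<le> gprod (p i) (q j)" if "i \<ge> max n m" "j \<ge> max n m" for i j
      using four_point_le[of "p i" "p j" "q j" "C + \<delta>"] n m that bdry_range[OF \<xi>] q
        by (simp add: image_subset_iff)
    then show "\<exists>n. \<forall>i\<ge>n. \<forall>j\<ge>n. C \<le> gprod (p i) (q j)" by blast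
  qed
qed

lemma bdry_subseq:
  assumes \<xi>: "\<xi> \<in> bdry" "p \<in> \<xi>" and r: "strict_mono r"
  shows "p \<circ> r \<in> \<xi>"
proof (rule bdry_memI[OF \<xi>])
  show "range (p \<circ> r) \<subseteq> M" using bdry_range[OF \<xi>] by auto
  show "diverges p (p \<circ> r)"
    using bdry_diverges[OF \<xi> \<xi>(2)] seq_suble[OF r] unfolding diverges_iff o_def
    by (meson order_trans)
qed

text \<open>A diagonal argument: at stage \<open>n\<close> a subsequence is selected whose mutual
  products are all at least \<open>n\<close>, using finitely many shadows of depth
  \<open>n + \<delta>\<close>.\<close>

lemma bdry_compact:
  fixes p :: "nat \<Rightarrow> 'x"
  assumes p: "range p \<subseteq> M" and unbounded: "\<And>C. \<exists>n. \<forall>i\<ge>n. C \<le> d b (p i)"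
  shows "\<exists>r. strict_mono r \<and> (\<exists>\<xi>\<in>bdry. p \<circ> r \<in> \<xi>)"
proof -
  define P where "P n s \<longleftrightarrow> (\<forall>i j. real n \<le> gprod (p (s i)) (p (s j)))" for n :: nat and s :: "nat \<Rightarrow> nat"
  interpret subseqs P
  proof
    fix n and s :: "nat \<Rightarrow> nat" assume s: "strict_mono s"
    obtain Q R where Q: "finite Q" "Q \<subseteq> M"
      and shadow: "\<And>x. \<lbrakk>x \<in> M; R \<le> d b x\<rbrakk> \<Longrightarrow> \<exists>q\<in>Q. real n + \<delta> \<le> gprod x q"
      using shadows[of "real n + \<delta>"] by blast
    obtain N where N: "\<forall>i\<ge>N. R \<le> d b (p i)" using unbounded by blast
    have "\<exists>q\<in>Q. real n + \<delta> \<le> gprod (p (s i)) q" if "i \<ge> N" for i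
      using shadow[of "p (s i)"] N that seq_suble[OF s, of i] p by force
    then obtain f where f: "\<And>i. i \<ge> N \<Longrightarrow> f i \<in> Q \<and> real n + \<delta> \<le> gprod (p (s i)) (f i)" by metis
    \<comment> \<open>One of the finitely many shadows contains infinitely many terms; two points in
      the shadow of the same \<open>q\<close> have product at least \<open>n\<close>.\<close>
    have "\<exists>i\<in>{N..}. infinite {k \<in> {N..}. f k = f i}"
      by (rule pigeonhole_infinite) (use f Q in \<open>auto simp: infinite_Ici intro: finite_subset\<close>)
    then obtain q where q: "infinite {k \<in> {N..}. f k = q}" by blast
    define r where "r = enumerate {k \<in> {N..}. f k = q}"
    have r: "strict_mono r" unfolding r_def using q by (rule strict_mono_enumerate)
    have rk: "N \<le> r i" "f (r i) = q" for i
      using enumerate_in_set[OF q, of i] by (auto simp: r_def)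
    have "real n \<le> gprod (p (s (r i))) (p (s (r j)))" for i j
    proof -
      have "real n + \<delta> - \<delta> \<le> gprod (p (s (r i))) (p (s (r j)))"
      proof (rule four_point_le[where q = q])
        show "real n + \<delta> \<le> gprod (p (s (r i))) q" using f[OF rk(1)] rk(2) by metis
        show qM: "q \<in> M" using f[OF rk(1)] rk(2) Q(2) by (metis subsetD)
        have "real n + \<delta> \<le> gprod (p (s (r j))) q" using f[OF rk(1)] rk(2) by metis
        then show "real n + \<delta> \<le> gprod q (p (s (r j)))"
          using gprod_sym[of q "p (s (r j))"] qM p by (simp add: image_subset_iff)
      qed (use p in auto)
      then show ?thesis by simp
    qed
    then show "\<exists>r'. strict_mono r' \<and> P n (s \<circ> r')" using r by (auto simp: P_def)
  qed
  \<comment> \<open>\<open>P k\<close> passes to subsequences, and from index \<open>Suc k\<close>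
    on the diagonal sequence is a subsequence of the one chosen at stage \<open>k\<close>.\<close>
  have "P k (diagseq \<circ> (+) (Suc k))" for k
    by (rule diagseq_holds) (auto simp: P_def)
  then have shifted: "real k \<le> gprod (p (diagseq (Suc k + i))) (p (diagseq (Suc k + j)))" for i j k
    by (simp add: P_def)
  have *: "real k \<le> gprod (p (diagseq i)) (p (diagseq j))" if "i \<ge> Suc k" "j \<ge> Suc k" for i j k
    using shifted[of k "i - Suc k" "j - Suc k"] that by simp
  have "diverges (p \<circ> diagseq) (p \<circ> diagseq)"
    unfolding diverges_iff o_def
  proof
    fix C :: real
    obtain k :: nat where "C \<le> k" using real_arch_simple by blast
    then show "\<exists>n. \<forall>i\<ge>n. \<forall>j\<ge>n. C \<le> gprod (p (diagseq i)) (p (diagseq j))"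
      using *[of k] by (meson order_trans)
  qed
  then have "\<exists>\<xi>\<in>bdry. p \<circ> diagseq \<in> \<xi>" using p by (intro bdry_class) auto
  then show ?thesis using subseq_diagseq by blast
qed

section \<open>The action on the boundary and the limits of sequences of group elements\<close>

abbreviation bact :: "'a \<Rightarrow> (nat \<Rightarrow> 'x) set \<Rightarrow> (nat \<Rightarrow> 'x) set" where
  "bact \<equiv> boundary_action \<phi>"

lemma bact_memI: "p \<in> \<xi> \<Longrightarrow> (\<lambda>n. \<phi> g (p n)) \<in> bact g \<xi>"
  by (auto simp: boundary_action_def o_def)

lemma diverges_act:
  assumes g: "g \<in> carrier G" and M: "range p \<subseteq> M" "range q \<subseteq> M" and "diverges p q"
  shows "diverges (\<lambda>n. \<phi> g (p n)) (\<lambda>n. \<phi> g (q n))"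
  unfolding diverges_iff
proof
  fix C
  obtain n where n: "\<forall>i\<ge>n. \<forall>j\<ge>n. C + len g \<le> gprod (p i) (q j)"
    using assms(4) unfolding diverges_iff by blast
  have "gprod (p i) (q j) \<le> gprod (\<phi> g (p i)) (\<phi> g (q j)) + len g" for i j
    using gprod_act_left[of "inv g" "\<phi> g (p i)" "q j"] g M by (simp add: image_subset_iff)
  then show "\<exists>n. \<forall>i\<ge>n. \<forall>j\<ge>n. C \<le> gprod (\<phi> g (p i)) (\<phi> g (q j))"
    using n by (meson add_le_cancel_right order_trans)
qed

text \<open>The image of a class must be a whole class, not only part of one; the reverse inclusion
  comes from applying \<open>inv g\<close>.\<close>

lemma bact_closed:
  assumes g: "g \<in> carrier G" and \<xi>: "\<xi> \<in> bdry"
  shows "bact g \<xi> \<in> bdry"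
proof -
  obtain p where p: "p \<in> \<xi>" using bdry_nonempty[OF \<xi>] by blast
  have pM: "range p \<subseteq> M" using bdry_range[OF \<xi> p] by blast
  have act: "range (\<lambda>n. \<phi> h (q n)) \<subseteq> M" if "h \<in> carrier G" "range q \<subseteq> M" for h q
    using that by auto
  obtain \<eta> where \<eta>: "\<eta> \<in> bdry" "(\<lambda>n. \<phi> g (p n)) \<in> \<eta>"
    using bdry_class[OF act[OF g pM] diverges_act[OF g pM pM bdry_diverges[OF \<xi> p p]]] by blast
  have "bact g \<xi> = \<eta>"
  proof (intro subset_antisym subsetI)
    fix q assume "q \<in> bact g \<xi>"
    then obtain q' where q': "q' \<in> \<xi>" "q = (\<lambda>n. \<phi> g (q' n))"
      by (auto simp: boundary_action_def o_def)
    have q'M: "range q' \<subseteq> M" using bdry_range[OF \<xi> q'(1)] by blast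
    show "q \<in> \<eta>" unfolding q'(2)
      by (rule bdry_memI[OF \<eta> act[OF g q'M] diverges_act[OF g pM q'M bdry_diverges[OF \<xi> p q'(1)]]])
  next
    fix q assume q: "q \<in> \<eta>"
    have qM: "range q \<subseteq> M" using bdry_range[OF \<eta>(1) q] by blast
    have ig: "inv g \<in> carrier G" using g by simp
    have "diverges (\<lambda>n. \<phi> (inv g) (\<phi> g (p n))) (\<lambda>n. \<phi> (inv g) (q n))"
      by (rule diverges_act[OF ig act[OF g pM] qM bdry_diverges[OF \<eta> q]])
    moreover have "(\<lambda>n. \<phi> (inv g) (\<phi> g (p n))) = p" using g pM by (simp add: fun_eq_iff image_subset_iff)
    ultimately have "(\<lambda>n. \<phi> (inv g) (q n)) \<in> \<xi>"
      using bdry_memI[OF \<xi> p act[OF ig qM]] by simp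
    from bact_memI[OF this, of g] show "q \<in> bact g \<xi>"
      using qM g by (simp add: image_subset_iff)
  qed
  then show ?thesis using \<eta>(1) by simp
qed

text \<open>The attracting point \<xi> and the repelling point \<eta> of a sequence of group
  elements: outside neighbourhoods of \<eta> the sequence converges to \<xi>. The two points may
  coincide.\<close>

definition limit_pair :: "(nat \<Rightarrow> 'x) set \<Rightarrow> (nat \<Rightarrow> 'x) set \<Rightarrow> bool" where
  "limit_pair \<xi> \<eta> \<longleftrightarrow> \<xi> \<in> bdry \<and> \<eta> \<in> bdry \<and>
     (\<exists>g. range g \<subseteq> carrier G \<and> (\<lambda>n. pt (g n)) \<in> \<xi> \<and> (\<lambda>n. pt (inv (g n))) \<in> \<eta>)"

lemma limit_pairE:
  assumes "limit_pair \<xi> \<eta>"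
  obtains g where "\<xi> \<in> bdry" "\<eta> \<in> bdry" "\<And>n. g n \<in> carrier G"
    "(\<lambda>n. pt (g n)) \<in> \<xi>" "(\<lambda>n. pt (inv (g n))) \<in> \<eta>"
  using assms unfolding limit_pair_def by blast

lemma limit_pairI:
  assumes "\<xi> \<in> bdry" "\<eta> \<in> bdry" "\<And>n. g n \<in> carrier G"
    "(\<lambda>n. pt (g n)) \<in> \<xi>" "(\<lambda>n. pt (inv (g n))) \<in> \<eta>"
  shows "limit_pair \<xi> \<eta>"
  using assms unfolding limit_pair_def by blast

lemma limit_pair_sym:
  assumes "limit_pair \<xi> \<eta>"
  shows "limit_pair \<eta> \<xi>"
proof -
  obtain g where g: "\<xi> \<in> bdry" "\<eta> \<in> bdry" "\<And>n. g n \<in> carrier G"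
    "(\<lambda>n. pt (g n)) \<in> \<xi>" "(\<lambda>n. pt (inv (g n))) \<in> \<eta>" using assms by (rule limit_pairE) blast
  then show ?thesis by (intro limit_pairI[of _ _ "\<lambda>n. inv (g n)"]) simp_all
qed

lemma bdry_len_unbounded:
  assumes "\<xi> \<in> bdry" "(\<lambda>n. pt (g n)) \<in> \<xi>"
  shows "\<exists>n. \<forall>i\<ge>n. C \<le> len (g i)"
  using bdry_unbounded[OF assms] by (simp add: len_def)

text \<open>By \<open>gprod_act\<close> the product of \<open>g n b\<close> and
  \<open>g n h n b\<close> equals \<open>len (g n)\<close> minus a bounded term, so both sequences
  have the same limit.\<close>

lemma pt_mult_mem:
  assumes \<xi>: "\<xi> \<in> bdry" "(\<lambda>n. pt (g n)) \<in> \<xi>" and G: "\<And>n. g n \<in> carrier G" "\<And>n. h n \<in> carrier G"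
    and bounded: "\<And>n. n \<ge> N \<Longrightarrow> gprod (pt (inv (g n))) (pt (h n)) \<le> D"
  shows "(\<lambda>n. pt (g n \<otimes> h n)) \<in> \<xi>"
proof (rule bdry_shadow[OF \<xi>])
  show "range (\<lambda>n. pt (g n \<otimes> h n)) \<subseteq> M" using G by auto
  fix C
  obtain m where m: "\<forall>i\<ge>m. C + D \<le> len (g i)" using bdry_len_unbounded[OF \<xi>] by blast
  have "C \<le> gprod (pt (g i)) (pt (g i \<otimes> h i))" if i: "i \<ge> max m N" for i
  proof -
    have "gprod (pt (g i)) (pt (g i \<otimes> h i)) = gprod (\<phi> (g i) (pt (h i))) (pt (g i))"
      using G by (simp add: pt_mult gprod_sym[of "pt (g i)"])
    also have "\<dots> = len (g i) - gprod (pt (inv (g i))) (pt (h i))"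
      using G by (simp add: gprod_act gprod_sym[of "pt (inv (g i))"])
    also have "\<dots> \<ge> len (g i) - D" using bounded[of i] i by simp
    finally show ?thesis using m i by (metis add_le_imp_le_diff max.boundedE order_trans)
  qed
  then show "\<exists>n. \<forall>i\<ge>n. C \<le> gprod (pt (g i)) (pt (g i \<otimes> h i))" by blast
qed

text \<open>The sequence is \<open>g n h n\<close>. Since \<eta> differs from \<xi>', the products
  of \<open>inv (g n) b\<close> and \<open>h n b\<close> are bounded, and this one bound controls
  \<open>g n h n\<close> as well as its inverse.\<close>

lemma limit_pair_compose:
  assumes "limit_pair \<xi> \<eta>" "limit_pair \<xi>' \<eta>'" "\<eta> \<noteq> \<xi>'"
  shows "limit_pair \<xi> \<eta>'"
proof -
  obtain g where g: "\<xi> \<in> bdry" "\<eta> \<in> bdry" "\<And>n. g n \<in> carrier G"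
    "(\<lambda>n. pt (g n)) \<in> \<xi>" "(\<lambda>n. pt (inv (g n))) \<in> \<eta>" using assms(1) by (rule limit_pairE) blast
  obtain h where h: "\<xi>' \<in> bdry" "\<eta>' \<in> bdry" "\<And>n. h n \<in> carrier G"
    "(\<lambda>n. pt (h n)) \<in> \<xi>'" "(\<lambda>n. pt (inv (h n))) \<in> \<eta>'" using assms(2) by (rule limit_pairE) blast
  obtain D N where D: "\<forall>i\<ge>N. \<forall>j\<ge>N. gprod (pt (inv (g i))) (pt (h j)) \<le> D"
    using bdry_bounded[OF g(2,5) h(1,4) assms(3)] by blast
  have "(\<lambda>n. pt (g n \<otimes> h n)) \<in> \<xi>"
    using D by (intro pt_mult_mem[OF g(1,4) g(3) h(3)]) auto
  moreover have "(\<lambda>n. pt (inv (h n) \<otimes> inv (g n))) \<in> \<eta>'"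
    using D g(3) h(3)
    by (intro pt_mult_mem[OF h(2,5), of _ N D]) (auto simp: gprod_sym[of "pt (h n)" "pt (inv (g n))" for n])
  ultimately show ?thesis
    using g h by (intro limit_pairI[of _ _ "\<lambda>n. g n \<otimes> h n"]) (simp_all add: inv_mult_group)
qed

text \<open>The sequence \<open>g n inv k\<close> works: a fixed factor on the right does not change
  the limit, while the inverses \<open>k inv (g n)\<close> are translated by
  \<open>k\<close>.\<close>

lemma limit_pair_translate:
  assumes "limit_pair \<xi> \<eta>" and k: "k \<in> carrier G"
  shows "limit_pair \<xi> (bact k \<eta>)"
proof -
  obtain g where g: "\<xi> \<in> bdry" "\<eta> \<in> bdry" "\<And>n. g n \<in> carrier G"
    "(\<lambda>n. pt (g n)) \<in> \<xi>" "(\<lambda>n. pt (inv (g n))) \<in> \<eta>" using assms(1) by (rule limit_pairE) blast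
  have "(\<lambda>n. pt (g n \<otimes> inv k)) \<in> \<xi>"
  proof (rule pt_mult_mem[OF g(1,4)])
    show "gprod (pt (inv (g n))) (pt (inv k)) \<le> len k" for n
      using gprod_le_len(1)[of "inv k" "pt (inv (g n))"] g(3) k by simp
  qed (use g k in auto)
  moreover have "(\<lambda>n. pt (inv (g n \<otimes> inv k))) \<in> bact k \<eta>"
    using bact_memI[OF g(5), of k] g(3) k by (simp add: inv_mult_group pt_mult)
  ultimately show ?thesis
    using g(1-3) k bact_closed by (intro limit_pairI[of _ _ "\<lambda>n. g n \<otimes> inv k"]) auto
qed

lemma inj_len_unbounded:
  assumes g: "inj (g :: nat \<Rightarrow> 'a)" "\<And>n. g n \<in> carrier G"
  shows "\<exists>n. \<forall>i\<ge>n. C \<le> len (g i)"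
proof -
  have "finite (g -` {h \<in> carrier G. d b (pt h) \<le> C})"
    by (rule finite_vimageI[OF finite_orbit_ball g(1)])
  then obtain n where n: "\<forall>i \<in> g -` {h \<in> carrier G. d b (pt h) \<le> C}. i < n"
    by (meson finite_nat_set_iff_bounded)
  have "C \<le> len (g i)" if "i \<ge> n" for i
    using n g(2)[of i] that by (fastforce simp: len_def)
  then show ?thesis by blast
qed

lemma limit_subsequence:
  fixes g :: "nat \<Rightarrow> 'a"
  assumes G: "\<And>n. g n \<in> carrier G" and unbounded: "\<And>C. \<exists>n. \<forall>i\<ge>n. C \<le> len (g i)"
  shows "\<exists>r \<xi> \<eta>. strict_mono r \<and> \<xi> \<in> bdry \<and> \<eta> \<in> bdry \<and>
    (\<lambda>n. pt (g (r n))) \<in> \<xi> \<and> (\<lambda>n. pt (inv (g (r n)))) \<in> \<eta>"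
proof -
  have "range (\<lambda>n. pt (g n)) \<subseteq> M" "\<And>C. \<exists>n. \<forall>i\<ge>n. C \<le> d b (pt (g i))"
    using G unbounded by (auto simp: len_def)
  from bdry_compact[of "\<lambda>n. pt (g n)", OF this] obtain r \<xi>
    where r: "strict_mono r" "\<xi> \<in> bdry" "(\<lambda>n. pt (g n)) \<circ> r \<in> \<xi>" by blast
  have "\<exists>n. \<forall>i\<ge>n. C \<le> d b (pt (inv (g (r i))))" for C
  proof -
    obtain n where "\<forall>i\<ge>n. C \<le> len (g i)" using unbounded by blast
    then have "\<forall>i\<ge>n. C \<le> len (inv (g (r i)))" using seq_suble[OF r(1)] G by (auto intro: order_trans)
    then show ?thesis by (auto simp: len_def)
  qed
  then obtain s \<eta> where s: "strict_mono s" "\<eta> \<in> bdry" "(\<lambda>n. pt (inv (g (r n)))) \<circ> s \<in> \<eta>"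
    using bdry_compact[of "\<lambda>n. pt (inv (g (r n)))"] G by (auto simp: image_subset_iff)
  have "(\<lambda>n. pt (g n)) \<circ> r \<circ> s \<in> \<xi>" by (rule bdry_subseq[OF r(2,3) s(1)])
  then show ?thesis
    using r s strict_mono_o[OF r(1) s(1)] by (intro exI[of _ "r \<circ> s"] exI[of _ \<xi>] exI[of _ \<eta>]) (simp add: o_def)
qed

section \<open>Construction of \<open>x\<close> and \<open>Y\<close> from limit points\<close>

text \<open>When the directions of \<open>inv k\<close>, \<open>w\<close>, \<open>inv w\<close> are
  pairwise separated, a path to \<open>Y b\<close> runs along \<open>k\<close>, then
  \<open>w\<close>, then \<open>inv k\<close> with bounded cancellation. So \<open>len Y\<close> is
  about \<open>2 len k + len w\<close>, and \<open>Y b\<close> and \<open>inv Y b\<close> part near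
  \<open>k b\<close>. Conjugation thus points both \<open>Y\<close> and \<open>inv Y\<close> in the
  direction of \<open>k\<close>, while a long \<open>w\<close> keeps them apart.\<close>

lemma conjugate_estimates:
  assumes G: "k \<in> carrier G" "w \<in> carrier G"
    and D: "gprod (pt (inv k)) (pt w) \<le> D" "gprod (pt (inv k)) (pt (inv w)) \<le> D"
      "gprod (pt w) (pt (inv w)) \<le> D"
    and w: "2 * D + 2 * \<delta> < len w"
  defines "Y \<equiv> k \<otimes> w \<otimes> inv k"
  shows "2 * len k + len w - 4 * D - 2 * \<delta> \<le> len Y"
    and "gprod (pt Y) (pt (inv Y)) \<le> len Y / 2 - len w / 2 + 3 * D + 2 * \<delta>"
    and "len k - D - \<delta> \<le> gprod (pt Y) (pt k)"
    and "len k - D - \<delta> \<le> gprod (pt (inv Y)) (pt k)"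
proof -
  define p where "p = pt (inv k)"
  have p: "p \<in> M" "d b p = len k" using G by (simp_all add: p_def flip: len_def)
  have YG: "Y \<in> carrier G" using G by (simp add: Y_def)
  have ptY: "pt Y = \<phi> k (\<phi> w p)" using G by (simp add: Y_def p_def act_mult)
  have "inv Y = k \<otimes> inv w \<otimes> inv k" using G by (simp add: Y_def inv_mult_group m_assoc)
  then have ptY': "pt (inv Y) = \<phi> k (\<phi> (inv w) p)" using G by (simp add: p_def act_mult)
  have wM: "\<phi> w p \<in> M" "\<phi> (inv w) p \<in> M" using G p by auto
  have 1: "gprod (\<phi> w p) (pt w) \<ge> len w - D" "gprod (\<phi> (inv w) p) (pt (inv w)) \<ge> len w - D"
    using gprod_act[of w p] gprod_act[of "inv w" p] D G p by (simp_all flip: p_def)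
  have 2: "gprod p (\<phi> w p) \<le> D + \<delta>"
    using four_point[OF p(1) wM(1), of "pt w"] 1(1) D(1) w G delta_nonneg by (auto simp flip: p_def)
  have 3: "gprod p (\<phi> (inv w) p) \<le> D + \<delta>"
    using four_point[OF p(1) wM(2), of "pt (inv w)"] 1(2) D(2) w G delta_nonneg by (auto simp flip: p_def)
  have "gprod (pt w) (\<phi> (inv w) p) \<le> D + \<delta>"
    using four_point[OF _ wM(2), of "pt w" "pt (inv w)"] 1(2) D(3) w G delta_nonneg by auto
  then have 4: "gprod (\<phi> w p) (\<phi> (inv w) p) \<le> D + 2 * \<delta>"
    using four_point[OF _ wM, of "pt w"] 1(1) w G delta_nonneg gprod_sym[OF wM(1), of "pt w"] by auto
  have 5: "len w + len k - 2 * D \<le> d b (\<phi> w p)" "len w + len k - 2 * D \<le> d b (\<phi> (inv w) p)"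
    using dist_act_base[of w p] dist_act_base[of "inv w" p] D G p by (simp_all flip: p_def)
  have lenY: "len Y = len k + d b (\<phi> w p) - 2 * gprod (\<phi> w p) p"
    using dist_act_base[OF G(1) wM(1)] unfolding len_def[of Y] ptY p_def .
  show "2 * len k + len w - 4 * D - 2 * \<delta> \<le> len Y"
    using lenY 5(1) 2 gprod_sym[OF p(1) wM(1)] by linarith
  have "len Y \<le> 2 * len k + len w"
    using lenY dist_act_base_le[OF G(2) p(1)] p gprod_nonneg[OF wM(1) p(1)] by linarith
  moreover have "gprod (pt Y) (pt (inv Y)) = len Y - d (\<phi> w p) (\<phi> (inv w) p) / 2"
    using dist_eq[of "pt Y" "pt (inv Y)"] dist_act[OF G(1) wM] len_inv[OF YG] YG
    by (simp add: len_def flip: ptY ptY')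
  ultimately show "gprod (pt Y) (pt (inv Y)) \<le> len Y / 2 - len w / 2 + 3 * D + 2 * \<delta>"
    using dist_eq[OF wM] 4 5 by linarith
  show "len k - D - \<delta> \<le> gprod (pt Y) (pt k)"
    using gprod_act[OF G(1) wM(1)] 2 gprod_sym[OF p(1) wM(1)] by (simp add: ptY flip: p_def)
  show "len k - D - \<delta> \<le> gprod (pt (inv Y)) (pt k)"
    using gprod_act[OF G(1) wM(2)] 3 gprod_sym[OF p(1) wM(2)] by (simp add: ptY' flip: p_def)
qed

text \<open>\<open>x\<close> is one \<open>g m\<close>, and \<open>Y\<close> conjugates a longer
  \<open>g i\<close> by some \<open>h j\<close>. As \<open>h j b\<close> tends to \<zeta>, both
  \<open>Y\<close> and \<open>inv Y\<close> point near \<zeta>, away from the directions \<xi>,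
  \<eta> of \<open>x\<close>; as \<open>inv (h j) b\<close> tends to \<zeta> too, there is little
  cancellation in the conjugate.\<close>

lemma schottky_sequence_if_limit_pairs:
  assumes pairs: "limit_pair \<xi> \<eta>" "limit_pair \<zeta> \<zeta>" and ne: "\<xi> \<noteq> \<eta>" "\<zeta> \<noteq> \<xi>" "\<zeta> \<noteq> \<eta>"
  obtains x where "x \<in> carrier G" "gprod (pt x) (pt (inv x)) < len x / 2 - \<delta>"
    "\<And>K. \<exists>Y\<in>carrier G. K \<le> len Y \<and> gprod (pt Y) (pt (inv Y)) \<le> len Y / 2 - K \<and>
      (\<forall>u\<in>{Y, inv Y}. \<forall>v\<in>{x, inv x}. gprod (pt u) (pt v) < len x / 2 - 3 * \<delta>)"
proof -
  obtain g where g: "\<xi> \<in> bdry" "\<eta> \<in> bdry" "\<And>n. g n \<in> carrier G"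
    "(\<lambda>n. pt (g n)) \<in> \<xi>" "(\<lambda>n. pt (inv (g n))) \<in> \<eta>" using pairs(1) by (rule limit_pairE) blast
  obtain h where h: "\<zeta> \<in> bdry" "\<zeta> \<in> bdry" "\<And>n. h n \<in> carrier G"
    "(\<lambda>n. pt (h n)) \<in> \<zeta>" "(\<lambda>n. pt (inv (h n))) \<in> \<zeta>" using pairs(2) by (rule limit_pairE) blast
  obtain D1 N1 where D1: "\<forall>i\<ge>N1. \<forall>j\<ge>N1. gprod (pt (g i)) (pt (inv (g j))) \<le> D1"
    using bdry_bounded[OF g(1,4) g(2,5) ne(1)] by blast
  obtain D2 N2 where D2: "\<forall>i\<ge>N2. \<forall>j\<ge>N2. gprod (pt (h i)) (pt (g j)) \<le> D2"
    using bdry_bounded[OF h(1,4) g(1,4) ne(2)] by blast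
  obtain D3 N3 where D3: "\<forall>i\<ge>N3. \<forall>j\<ge>N3. gprod (pt (h i)) (pt (inv (g j))) \<le> D3"
    using bdry_bounded[OF h(1,4) g(2,5) ne(3)] by blast
  obtain D4 N4 where D4: "\<forall>i\<ge>N4. \<forall>j\<ge>N4. gprod (pt (inv (h i))) (pt (g j)) \<le> D4"
    using bdry_bounded[OF h(1,5) g(1,4) ne(2)] by blast
  obtain D5 N5 where D5: "\<forall>i\<ge>N5. \<forall>j\<ge>N5. gprod (pt (inv (h i))) (pt (inv (g j))) \<le> D5"
    using bdry_bounded[OF h(1,5) g(2,5) ne(3)] by blast
  define D where "D = \<bar>D1\<bar> + \<bar>D2\<bar> + \<bar>D3\<bar> + \<bar>D4\<bar> + \<bar>D5\<bar>"
  define N where "N = N1 + N2 + N3 + N4 + N5"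
  have DN: "D1 \<le> D" "D2 \<le> D" "D3 \<le> D" "D4 \<le> D" "D5 \<le> D" "0 \<le> D"
    "N1 \<le> N" "N2 \<le> N" "N3 \<le> N" "N4 \<le> N" "N5 \<le> N" by (auto simp: D_def N_def)
  have gg: "gprod (pt (g i)) (pt (inv (g j))) \<le> D"
    and hg: "gprod (pt (h i)) (pt (g j)) \<le> D" "gprod (pt (h i)) (pt (inv (g j))) \<le> D"
    and h'g: "gprod (pt (inv (h i))) (pt (g j)) \<le> D" "gprod (pt (inv (h i))) (pt (inv (g j))) \<le> D"
    if "i \<ge> N" "j \<ge> N" for i j
    using D1 D2 D3 D4 D5 that DN by (meson order_trans)+
  have gbig: "\<exists>i\<ge>N. C \<le> len (g i)" and hbig: "\<exists>i\<ge>N. C \<le> len (h i)" for C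
    using bdry_len_unbounded[OF g(1,4), of C] bdry_len_unbounded[OF h(1,4), of C]
    by (meson max.cobounded1 max.cobounded2)+
  \<comment> \<open>Makes \<open>D + \<delta>\<close>, the bound to be proved for products with
    \<open>x\<close>, smaller than \<open>len x / 2 - 3 \<delta>\<close>.\<close>
  obtain m where m: "m \<ge> N" "2 * D + 8 * \<delta> + 1 \<le> len (g m)" using gbig by blast
  define x where "x = g m"
  have xG: "x \<in> carrier G" using g by (simp add: x_def)
  show thesis
  proof (rule that[OF xG])
    show "gprod (pt x) (pt (inv x)) < len x / 2 - \<delta>"
      using gg[OF m(1) m(1)] m(2) delta_nonneg unfolding x_def by linarith
    fix K
    \<comment> \<open>Half of this length exceeds \<open>K\<close> by more than the loss
      \<open>3 D + 2 \<delta>\<close> in the second estimate for conjugates.\<close>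
    obtain i where i: "i \<ge> N" "2 * \<bar>K\<bar> + 8 * D + 8 * \<delta> + 1 \<le> len (g i)" using gbig by blast
    \<comment> \<open>Makes \<open>Y b\<close> and \<open>inv Y b\<close> follow
      \<open>h j b\<close> for at least \<open>len x\<close>, which no product with
      \<open>x b\<close> or \<open>inv x b\<close> can exceed.\<close>
    obtain j where j: "j \<ge> N" "len x + D + \<delta> \<le> len (h j)" using hbig by blast
    define Y where "Y = h j \<otimes> g i \<otimes> inv (h j)"
    have YG: "Y \<in> carrier G" using g h by (simp add: Y_def)
    have big: "2 * D + 2 * \<delta> < len (g i)" using i DN(6) delta_nonneg by linarith
    note Y = conjugate_estimates[OF h(3) g(3) h'g[OF j(1) i(1)] gg[OF i(1) i(1)] big, folded Y_def]
    have x0: "0 \<le> len x" using xG by (rule len_nonneg)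
    have "K \<le> len Y" using Y(1) i(2) j(2) DN(6) delta_nonneg x0 by linarith
    moreover have "gprod (pt Y) (pt (inv Y)) \<le> len Y / 2 - K"
      using Y(2) i(2) DN(6) delta_nonneg by linarith
    moreover have "gprod (pt u) (pt v) < len x / 2 - 3 * \<delta>" if "u \<in> {Y, inv Y}" "v \<in> {x, inv x}" for u v
    proof -
      have uh: "len (h j) - D - \<delta> \<le> gprod (pt u) (pt (h j))" using that(1) Y(3,4) by auto
      have v: "v \<in> carrier G" "len v = len x" and u: "u \<in> carrier G" using that xG YG by auto
      have "gprod (pt (h j)) (pt v) \<le> D"
        using that(2) hg[OF j(1) m(1)] by (auto simp: x_def)
      moreover have "gprod (pt u) (pt v) \<le> len x" using gprod_le_len(1)[of v "pt u"] v u by simp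
      ultimately have "gprod (pt u) (pt v) \<le> D + \<delta>"
        using four_point_le[of "pt (h j)" "pt u" "pt v" "gprod (pt u) (pt v)"] uh j(2) u v h(3)
        by (simp add: gprod_sym[of "pt (h j)" "pt u"])
      then show ?thesis using m(2) delta_nonneg by (simp add: x_def)
    qed
    ultimately show "\<exists>Y\<in>carrier G. K \<le> len Y \<and> gprod (pt Y) (pt (inv Y)) \<le> len Y / 2 - K \<and>
      (\<forall>u\<in>{Y, inv Y}. \<forall>v\<in>{x, inv x}. gprod (pt u) (pt v) < len x / 2 - 3 * \<delta>)"
      using YG by blast
  qed
qed

section \<open>Excluding a fixed limit point\<close>

text \<open>The point \<open>y g b = g y b\<close> would be far out in the direction of
  \<open>y b\<close> and also in that of \<open>g b\<close>, although these directions are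
  separated.\<close>

lemma commuting_not_in_general_position:
  assumes G: "g \<in> carrier G" "y \<in> carrier G" and comm: "y \<otimes> g = g \<otimes> y"
    and D: "gprod (pt g) (pt y) \<le> D" "gprod (pt g) (pt (inv y)) \<le> D"
    and big: "2 * D + \<delta> < len g" "2 * D + \<delta> < len y"
  shows False
proof -
  define p where "p = \<phi> y (pt g)"
  have p: "p \<in> M" "p = \<phi> g (pt y)" using G comm by (simp_all add: p_def flip: act_mult)
  have 1: "len y - D \<le> gprod p (pt y)" using gprod_act[of y "pt g"] D G by (simp add: p_def)
  have "len y + len g - 2 * D \<le> d b p"
    using dist_act_base[of y "pt g"] D G by (simp add: p_def flip: len_def)
  moreover have "d p (pt g) = len y"
    using dist_act[of g "pt y" b] G by (simp add: p(2) len_def dist_sym[of "pt y" b])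
  ultimately have "len g - D \<le> gprod p (pt g)"
    using dist_eq[of p "pt g"] p G by (simp flip: len_def)
  then show False
    using four_point[of "pt g" p "pt y"] 1 D big p G gprod_sym[of p "pt g"] by simp
qed

lemma pow_mem_halfspace:
  assumes y: "y \<in> carrier G" and disj: "halfspace y \<inter> halfspace (inv y) = {}"
  shows "pt (y [^] Suc k) \<in> halfspace y"
proof (induction k)
  case 0
  then show ?case using y by (simp add: halfspace_def gprod_self dist_nonneg len_def)
next
  case (Suc k)
  have "pt (y [^] Suc (Suc k)) = \<phi> y (pt (y [^] Suc k))"
    using y nat_pow_Suc2[OF y, of "Suc k"] by (metis base act_mult nat_pow_closed)
  moreover have "pt (y [^] Suc k) \<notin> halfspace (inv y)" using Suc disj by blast
  moreover have "pt (y [^] Suc k) \<in> M" using y by (intro pt_closed nat_pow_closed)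
  ultimately show ?case using act_halfspace[OF y] by metis
qed

text \<open>A loxodromic \<open>x\<close> with attracting point \<open>\<omega>\<close> has \<open>\<bar>x\<^sup>-\<^sup>k s x\<^sup>k\<bar>\<close> bounded in \<open>k\<close> for every \<open>s\<close> fixing
  \<open>\<omega>\<close>. By properness some power of \<open>x\<close> then commutes with \<open>s\<close>, hence some power of \<open>x\<close> is central, and
  all limit points are limits of powers of \<open>x\<close>.\<close>

lemma no_fixed_limit_point:
  assumes S: "finite_generating_set G S" and pair: "limit_pair \<omega> \<eta>" "\<eta> \<noteq> \<omega>"
    and fixed: "\<And>g. g \<in> carrier G \<Longrightarrow> bact g \<omega> = \<omega>"
    and third: "\<And>u v. \<exists>\<zeta> \<zeta>'. limit_pair \<zeta> \<zeta>' \<and> \<zeta> \<noteq> u \<and> \<zeta> \<noteq> v"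
  shows False
proof -
  have finS: "finite S" and SG: "S \<subseteq> carrier G" and genS: "generate G S = carrier G"
    using S by (auto simp: finite_generating_set_def)
  obtain g where g: "\<omega> \<in> bdry" "\<eta> \<in> bdry" "\<And>n. g n \<in> carrier G"
    "(\<lambda>n. pt (g n)) \<in> \<omega>" "(\<lambda>n. pt (inv (g n))) \<in> \<eta>" using pair(1) by (rule limit_pairE) blast
  define p where "p n = pt (g n)" for n
  have p: "p \<in> \<omega>" "p n \<in> M" for n using g by (simp_all add: p_def[abs_def])
  obtain D N where D: "\<forall>i\<ge>N. \<forall>j\<ge>N. gprod (p i) (pt (inv (g j))) \<le> D"
    using bdry_bounded[OF g(1,4) g(2,5)] pair(2) unfolding p_def by metis
  obtain n1 where "\<forall>i\<ge>n1. 2 * D + 4 * \<delta> + 1 \<le> len (g i)"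
    using bdry_len_unbounded[OF g(1,4)] by blast
  then have m: "2 * D + 4 * \<delta> + 1 \<le> len (g (max n1 N))" by simp
  \<comment> \<open>A long element with \<open>x b\<close> and \<open>inv x b\<close> separated is
    loxodromic. The sequence \<open>p\<close>, which represents \<omega>, also stays away from
    \<open>inv x b\<close>.\<close>
  define x where "x = g (max n1 N)"
  have x: "x \<in> carrier G" "2 * D + 4 * \<delta> + 1 \<le> len x" and px: "\<And>i. i \<ge> N \<Longrightarrow> gprod (p i) (pt (inv x)) \<le> D"
    using m g(3) D by (auto simp: x_def)
  have D0: "0 \<le> D" using px[of N] gprod_nonneg[of "p N" "pt (inv x)"] p x by simp
  have xx: "gprod (pt x) (pt (inv x)) \<le> D"
    using px[of "max n1 N"] by (simp add: p_def x_def)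
  have disj: "halfspace x \<inter> halfspace (inv x) = {}"
    using xx x delta_nonneg by (intro halfspaces_disjoint) auto
  have xG: "x [^] k \<in> carrier G" for k :: nat using x by simp
  have inv_pow: "gprod (p i) (pt (inv (x [^] Suc k))) \<le> D + \<delta>" if i: "i \<ge> N" for i k
  proof -
    have "pt (inv (x [^] Suc k)) \<in> halfspace (inv x)"
      using pow_mem_halfspace[of "inv x" k] x disj nat_pow_inv[OF x(1), of "Suc k"] by auto
    then have "len x / 2 \<le> gprod (pt (inv (x [^] Suc k))) (pt (inv x))"
      using x by (simp add: halfspace_def)
    moreover have "pt (inv (x [^] Suc k)) \<in> M" using x by (intro pt_closed inv_closed xG)
    ultimately show ?thesis
      using four_point[of "p i" "pt (inv (x [^] Suc k))" "pt (inv x)"] px[OF i] x delta_nonneg p by simp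
  qed
  have bounded: "len (inv (x [^] Suc k) \<otimes> s \<otimes> x [^] Suc k) \<le> 5 * len s + 2 * D + 8 * \<delta>"
    if s: "s \<in> carrier G" for s k
  proof -
    define X where "X = x [^] Suc k"
    have X: "X \<in> carrier G" using xG by (simp only: X_def)
    have s0: "0 \<le> len s" using s by (rule len_nonneg)
    \<comment> \<open>A lower bound for the products of neighbours in the chain \<open>X b\<close>,
      \<open>X p_i\<close>, \<open>p_i\<close>, \<open>s X p_i\<close>, \<open>s X b\<close>. The
      two middle links use that \<open>X\<close> and \<open>s X\<close> fix \<omega>; passing from
      \<open>X\<close> to \<open>s X\<close> costs \<open>len s\<close> in the length and again in
      the product with the inverse. Three four-point steps bring in
      \<open>3 \<delta>\<close>.\<close>
    define A where "A = len X - D - \<delta> - 2 * len s"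
    have fix_div: "\<exists>n. \<forall>i\<ge>n. A \<le> gprod (\<phi> h (p i)) (p i)" if h: "h \<in> carrier G" for h
    proof -
      have "(\<lambda>n. \<phi> h (p n)) \<in> \<omega>" using bact_memI[OF p(1), of h] fixed[OF h] by simp
      then have "diverges (\<lambda>n. \<phi> h (p n)) p" using bdry_diverges[OF g(1)] p(1) by blast
      then show ?thesis unfolding diverges_iff by blast
    qed
    obtain i1 where i1: "\<forall>i\<ge>i1. A \<le> gprod (\<phi> X (p i)) (p i)" using fix_div[OF X] by blast
    obtain i2 where i2: "\<forall>i\<ge>i2. A \<le> gprod (\<phi> (s \<otimes> X) (p i)) (p i)"
      using fix_div[of "s \<otimes> X"] s X by blast
    define i where "i = i1 + i2 + N"
    have i: "i \<ge> i1" "i \<ge> i2" "i \<ge> N" by (auto simp: i_def)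
    define U where "U = \<phi> X (p i)"
    define V where "V = \<phi> (s \<otimes> X) (p i)"
    have UV: "U \<in> M" "V \<in> M" using X s p by (simp_all add: U_def V_def)
    have pX: "gprod (p i) (pt (inv X)) \<le> D + \<delta>" using inv_pow[OF i(3), of k] by (simp only: X_def)
    have a1: "A \<le> gprod (pt X) U"
      using gprod_act[OF X p(2), of i] pX s0 gprod_sym[OF UV(1), of "pt X"] X by (simp add: A_def U_def)
    have a2: "A \<le> gprod U (p i)" using i1[rule_format, OF i(1)] by (simp only: U_def)
    have a3: "A \<le> gprod (p i) V" 
      using i2[rule_format, OF i(2)] by (simp only: gprod_sym[OF p(2) UV(2)] V_def[symmetric])
    have a4: "A \<le> gprod V (pt (s \<otimes> X))"
    proof -
      have "d (pt (inv (s \<otimes> X))) (pt (inv X)) = len s"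
        using dist_act[of "inv X" "pt (inv s)" b] s X len_inv[OF s] dist_sym[of "pt (inv s)" b]
        by (simp add: inv_mult_group act_mult len_def)
      then have "gprod (p i) (pt (inv (s \<otimes> X))) \<le> D + \<delta> + len s"
        using gprod_lipschitz[of "pt (inv (s \<otimes> X))" "pt (inv X)" "p i"] pX s X p
        by (simp add: gprod_sym[of "p i"])
      moreover have "len X \<le> len (s \<otimes> X) + len s"
        using dist_act_base_ge[of s "pt X"] s X by (simp add: len_def act_mult)
      ultimately show ?thesis using gprod_act[of "s \<otimes> X" "p i"] s X p by (simp add: A_def V_def)
    qed
    have "A - \<delta> \<le> gprod (pt X) (p i)" using four_point_le[OF _ UV(1) p(2) a1 a2] X by simp
    then have "A - \<delta> - \<delta> \<le> gprod (pt X) V"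
      using four_point_le[of "pt X" "p i" V "A - \<delta>"] a3 X UV p delta_nonneg by simp
    then have "A - \<delta> - \<delta> - \<delta> \<le> gprod (pt X) (pt (s \<otimes> X))"
      using four_point_le[of "pt X" V "pt (s \<otimes> X)" "A - \<delta> - \<delta>"] a4 X s UV delta_nonneg by simp
    moreover have "len (inv X \<otimes> s \<otimes> X) = d (pt X) (pt (s \<otimes> X))"
      using dist_act_left[of X b "pt (s \<otimes> X)"] X s by (simp add: len_def act_mult)
    moreover have "d (pt X) (pt (s \<otimes> X)) = len X + len (s \<otimes> X) - 2 * gprod (pt X) (pt (s \<otimes> X))"
      using dist_eq[of "pt X" "pt (s \<otimes> X)"] X s by (simp add: len_def)
    moreover have "len (s \<otimes> X) \<le> len s + len X" using len_mult s X by simp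
    ultimately have "len (inv X \<otimes> s \<otimes> X) \<le> 5 * len s + 2 * D + 8 * \<delta>"
      by (simp add: A_def)
    then show ?thesis by (simp only: X_def)
  qed
  have "\<exists>n>0. x [^] (n::nat) \<otimes> s = s \<otimes> x [^] n" if s: "s \<in> S" for s
  proof -
    have sG: "s \<in> carrier G" using s SG by blast
    define f where "f k = inv (x [^] Suc k) \<otimes> s \<otimes> x [^] Suc k" for k
    have fG: "f k \<in> carrier G" for k using sG xG unfolding f_def by (intro m_closed inv_closed)
    \<comment> \<open>Bounded length and properness leave finitely many conjugates, so two of them
      agree, which says that a power of \<open>x\<close> commutes with \<open>s\<close>.\<close>
    have "finite (range f)"
    proof (rule finite_subset[OF _ finite_orbit_ball])
      show "range f \<subseteq> {g \<in> carrier G. d b (pt g) \<le> 5 * len s + 2 * D + 8 * \<delta>}"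
        using bounded[OF sG] fG by (auto simp: f_def len_def simp del: nat_pow_Suc)
    qed
    then have "\<not> inj f" using range_inj_infinite by blast
    then obtain i j where ij: "f i = f j" "i < j"
      unfolding inj_def by (metis linorder_neqE_nat)
    define n where "n = j - i"
    have xj: "x [^] Suc j = x [^] n \<otimes> x [^] Suc i" "x [^] Suc j = x [^] Suc i \<otimes> x [^] n"
      using nat_pow_mult[OF x(1), of n "Suc i"] nat_pow_mult[OF x(1), of "Suc i" n] ij(2)
      by (simp_all add: n_def del: nat_pow_Suc)
    note G = xG[of "Suc i"] xG[of n] sG
    have "inv (x [^] Suc i) \<otimes> s \<otimes> x [^] Suc i = inv (x [^] Suc i) \<otimes> (inv (x [^] n) \<otimes> s \<otimes> x [^] n) \<otimes> x [^] Suc i"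
    proof -
      have "inv (x [^] Suc j) = inv (x [^] Suc i) \<otimes> inv (x [^] n)"
        unfolding xj(1) by (rule inv_mult_group[OF G(2,1)])
      then have "f j = inv (x [^] Suc i) \<otimes> inv (x [^] n) \<otimes> s \<otimes> (x [^] n \<otimes> x [^] Suc i)"
        unfolding f_def xj(1)[symmetric] by simp
      then show ?thesis using ij(1) G by (simp add: f_def m_assoc del: nat_pow_Suc)
    qed
    then have "s = inv (x [^] n) \<otimes> s \<otimes> x [^] n"
      using G by (simp del: nat_pow_Suc)
    then have "x [^] n \<otimes> s = s \<otimes> x [^] n"
      using G by (metis inv_closed inv_solve_left m_assoc m_closed)
    then show ?thesis using ij(2) by (intro exI[of _ n]) (simp add: n_def)
  qed
  then obtain e where e: "\<And>s. s \<in> S \<Longrightarrow> 0 < e s \<and> x [^] (e s :: nat) \<otimes> s = s \<otimes> x [^] e s" by metis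
  \<comment> \<open>A common multiple of the exponents: powers of \<open>x^E\<close> commute with
    all generators.\<close>
  define E where "E = (\<Prod>s\<in>S. e s)"
  have E0: "0 < E" unfolding E_def using e by (intro prod_pos) auto
  have central: "x [^] (E * k) \<otimes> h = h \<otimes> x [^] (E * k)" if h: "h \<in> carrier G" for h and k :: nat
  proof -
    define y where "y = x [^] (E * k)"
    have y: "y \<in> carrier G" using x by (simp add: y_def)
    have gen: "y \<otimes> s = s \<otimes> y" if s: "s \<in> S" for s
    proof -
      have "E * k = e s * (prod e (S - {s}) * k)"
        unfolding E_def using prod.remove[OF finS s, of e] by simp
      then have "y = (x [^] e s) [^] (prod e (S - {s}) * k)"
        unfolding y_def by (simp only: nat_pow_pow[OF x(1)])
      then show ?thesis using group_commutes_pow[of "x [^] e s" s] e[OF s] s SG xG by auto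
    qed
    have "h \<in> generate G S" using h genS by simp
    then have "y \<otimes> h = h \<otimes> y"
    proof induction
      case one
      then show ?case using y by simp
    next
      case (incl s)
      then show ?case by (rule gen)
    next
      case (inv s)
      then have sG: "s \<in> carrier G" using SG by blast
      then have "y \<otimes> inv s = inv s \<otimes> (s \<otimes> y) \<otimes> inv s" using y by (simp add: m_assoc) (simp flip: m_assoc)
      also have "\<dots> = inv s \<otimes> (y \<otimes> s) \<otimes> inv s" using gen[OF inv] by simp
      also have "\<dots> = inv s \<otimes> y" using y sG by (simp add: m_assoc)
      finally show ?case .
    next
      case (eng h1 h2)
      have "h1 \<in> carrier G" "h2 \<in> carrier G" using eng genS by auto
      then show ?case using eng y by (metis m_assoc)
    qed
    then show ?thesis by (simp add: y_def)
  qed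
  have pow_neq: "x [^] Suc k \<noteq> \<one>" for k
  proof
    assume "x [^] Suc k = \<one>"
    then have "b \<in> halfspace x" using pow_mem_halfspace[OF x(1) disj, of k] by (simp del: nat_pow_Suc)
    then have "len x / 2 \<le> gprod b (pt x)" by (simp add: halfspace_def)
    also have "\<dots> = 0" using x by (simp add: gromov_product_def dist_sym[of "pt x" b])
    finally show False using x D0 delta_nonneg by simp
  qed
  define y where "y k = x [^] (E * k)" for k
  have yG: "y k \<in> carrier G" for k using x by (simp add: y_def)
  have "inj y"
  proof (rule injI)
    have *: "\<not> i < j" if "y i = y j" for i j
    proof
      assume "i < j"
      then obtain k where k: "E * j = E * i + Suc k"
        using E0 by (metis add_Suc_right less_iff_Suc_add mult_less_cancel1)
      have "y j = y i \<otimes> x [^] Suc k" unfolding y_def k by (simp only: nat_pow_mult[OF x(1)])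
      then have "x [^] Suc k = \<one>" using that yG xG by (metis l_cancel_one)
      then show False using pow_neq by blast
    qed
    show "i = j" if "y i = y j" for i j using *[of i j] *[of j i] that by force
  qed
  then have "\<exists>n. \<forall>i\<ge>n. C \<le> len (y i)" for C using inj_len_unbounded yG by blast
  from limit_subsequence[OF yG this] obtain r \<eta>1 \<eta>2 where r: "strict_mono r"
    and \<eta>1: "\<eta>1 \<in> bdry" "(\<lambda>n. pt (y (r n))) \<in> \<eta>1"
    and \<eta>2: "\<eta>2 \<in> bdry" "(\<lambda>n. pt (inv (y (r n)))) \<in> \<eta>2" by blast
  \<comment> \<open>A limit point different from both limits of the central powers and their
    inverses supplies long elements \<open>h i\<close> in general position to them, although they
    commute.\<close>
  obtain \<zeta> \<zeta>' where \<zeta>: "limit_pair \<zeta> \<zeta>'" "\<zeta> \<noteq> \<eta>1" "\<zeta> \<noteq> \<eta>2" using third by blast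
  obtain h where h: "\<zeta> \<in> bdry" "\<zeta>' \<in> bdry" "\<And>n. h n \<in> carrier G"
    "(\<lambda>n. pt (h n)) \<in> \<zeta>" "(\<lambda>n. pt (inv (h n))) \<in> \<zeta>'" using \<zeta>(1) by (rule limit_pairE) blast
  obtain D1 N1 where D1: "\<forall>i\<ge>N1. \<forall>j\<ge>N1. gprod (pt (h i)) (pt (y (r j))) \<le> D1"
    using bdry_bounded[OF h(1,4) \<eta>1 \<zeta>(2)] by blast
  obtain D2 N2 where D2: "\<forall>i\<ge>N2. \<forall>j\<ge>N2. gprod (pt (h i)) (pt (inv (y (r j)))) \<le> D2"
    using bdry_bounded[OF h(1,4) \<eta>2 \<zeta>(3)] by blast
  define B where "B = max D1 D2"
  obtain N3 where N3: "\<forall>i\<ge>N3. 2 * B + \<delta> + 1 \<le> len (h i)" using bdry_len_unbounded[OF h(1,4)] by blast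
  obtain N4 where N4: "\<forall>i\<ge>N4. 2 * B + \<delta> + 1 \<le> len (y (r i))" using bdry_len_unbounded[OF \<eta>1] by blast
  define i where "i = N1 + N2 + N3 + N4"
  have i: "i \<ge> N1" "i \<ge> N2" "i \<ge> N3" "i \<ge> N4" by (auto simp: i_def)
  show False
  proof (rule commuting_not_in_general_position[OF h(3) yG])
    show "y (r i) \<otimes> h i = h i \<otimes> y (r i)" unfolding y_def by (rule central[OF h(3)])
    show "gprod (pt (h i)) (pt (y (r i))) \<le> B" "gprod (pt (h i)) (pt (inv (y (r i)))) \<le> B"
      using D1 D2 i by (auto simp: B_def intro: max.coboundedI1 max.coboundedI2)
    show "2 * B + \<delta> < len (h i)" "2 * B + \<delta> < len (y (r i))"
      using N3 N4 i by fastforce+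
  qed
qed

text \<open>Once no limit point is fixed, any two limit points, equal or not, form a limit pair. The
  pair of the first two supplies \<open>x\<close>, and the third paired with itself supplies the
  conjugators for \<open>Y\<close>.\<close>

lemma kazhdan_constant_upto_eq_0_if_three_limit_points:
  assumes S: "finite_generating_set G S"
    and lim: "limit_pair \<xi>1 \<eta>1" "limit_pair \<xi>2 \<eta>2" "limit_pair \<xi>3 \<eta>3"
    and ne: "\<xi>1 \<noteq> \<xi>2" "\<xi>1 \<noteq> \<xi>3" "\<xi>2 \<noteq> \<xi>3"
    and r: "card S + 2 \<le> r"
  shows "kazhdan_constant_upto r G = 0"
proof -
  have third: "\<exists>\<zeta> \<zeta>'. limit_pair \<zeta> \<zeta>' \<and> \<zeta> \<noteq> u \<and> \<zeta> \<noteq> v" for u v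
    using lim ne by metis
  have no_fixed: "\<exists>g\<in>carrier G. bact g \<omega> \<noteq> \<omega>" if \<omega>: "limit_pair \<omega> \<omega>'" for \<omega> \<omega>'
  proof (rule ccontr)
    assume "\<not> ?thesis"
    then have fixed: "\<And>g. g \<in> carrier G \<Longrightarrow> bact g \<omega> = \<omega>" by blast
    \<comment> \<open>If \<omega> is only known to be paired with itself, a pair \<open>u\<close>,
      \<open>v\<close> with \<open>u\<close> different from \<omega> helps: either \<open>v\<close>
      is \<omega> and the pair is reversed, or composition pairs \<omega> with
      \<open>v\<close>.\<close>
    obtain \<eta> where "limit_pair \<omega> \<eta>" "\<eta> \<noteq> \<omega>"
    proof (cases "\<omega>' = \<omega>")
      case True
      obtain u v where uv: "limit_pair u v" "u \<noteq> \<omega>" using third by blast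
      show thesis
      proof (cases "v = \<omega>")
        case True
        then show thesis using that limit_pair_sym uv by blast
      next
        case False
        then show thesis using that limit_pair_compose[OF \<omega>, of u v] uv \<open>\<omega>' = \<omega>\<close> by blast
      qed
    qed (use that \<omega> in blast)
    then show False using no_fixed_limit_point[OF S _ _ fixed third] by blast
  qed
  \<comment> \<open>Composition fails only if \<eta> = \<xi>'; then \<eta> is first translated by an
    element that does not fix it.\<close>
  have all: "limit_pair \<xi> \<eta>'" if 1: "limit_pair \<xi> \<eta>" and 2: "limit_pair \<eta>' \<xi>'" for \<xi> \<eta> \<xi>' \<eta>'
  proof (cases "\<eta> = \<xi>'")
    case True
    obtain g where g: "g \<in> carrier G" "bact g \<eta> \<noteq> \<eta>" using no_fixed[OF limit_pair_sym[OF 1]] by blast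
    show ?thesis
      using limit_pair_compose[OF limit_pair_translate[OF 1 g(1)] limit_pair_sym[OF 2]] g True by blast
  qed (use limit_pair_compose[OF 1 limit_pair_sym[OF 2]] in blast)
  have "limit_pair \<xi>1 \<xi>2" "limit_pair \<xi>3 \<xi>3" using all lim by blast+
  from schottky_sequence_if_limit_pairs[OF this ne(1) ne(2)[symmetric] ne(3)[symmetric]]
  obtain x where x: "x \<in> carrier G" "gprod (pt x) (pt (inv x)) < len x / 2 - \<delta>"
    "\<And>K. \<exists>Y\<in>carrier G. K \<le> len Y \<and> gprod (pt Y) (pt (inv Y)) \<le> len Y / 2 - K \<and>
      (\<forall>u\<in>{Y, inv Y}. \<forall>v\<in>{x, inv x}. gprod (pt u) (pt v) < len x / 2 - 3 * \<delta>)" by blast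
  show ?thesis by (rule kazhdan_constant_upto_eq_0_if_schottky_sequence[OF x S r])
qed

section \<open>From the boundary topology to limit pairs\<close>

text \<open>Replacing \<open>p\<close> and \<open>q\<close> by other representatives of the same
  boundary points changes late products by at most \<open>2 \<delta>\<close>, one four-point step
  for each side.\<close>

lemma boundary_product_le:
  assumes \<xi>: "\<xi> \<in> bdry" "p \<in> \<xi>" and \<eta>: "\<eta> \<in> bdry" "q \<in> \<eta>"
    and le: "\<And>i j. \<lbrakk>i \<ge> n; j \<ge> n\<rbrakk> \<Longrightarrow> gprod (p i) (q j) \<le> D"
  shows "boundary_product d b \<xi> \<eta> \<le> ereal (D + 2 * \<delta>)"
  unfolding boundary_product_def
proof (intro SUP_least)
  fix p' q' assume p': "p' \<in> \<xi>" and q': "q' \<in> \<eta>"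
  obtain k where k: "\<forall>i\<ge>k. \<forall>j\<ge>k. D + 2 * \<delta> + 1 \<le> gprod (p i) (p' j)"
    using bdry_diverges[OF \<xi> p'] unfolding diverges_iff by blast
  obtain l where l: "\<forall>i\<ge>l. \<forall>j\<ge>l. D + 2 * \<delta> + 1 \<le> gprod (q' i) (q j)"
    using bdry_diverges[OF \<eta>(1) q' \<eta>(2)] unfolding diverges_iff by blast
  define m where "m = max n (max k l)"
  have m: "m \<ge> n" "m \<ge> k" "m \<ge> l" by (auto simp: m_def)
  have "gprod (p' i) (q' j) \<le> D + 2 * \<delta>" if "i \<ge> m" "j \<ge> m" for i j
  proof (rule ccontr)
    assume "\<not> ?thesis"
    then have "D + 2 * \<delta> < gprod (p' i) (q' j)" by simp
    moreover have "D + 2 * \<delta> + 1 \<le> gprod (p m) (p' i)" "D + 2 * \<delta> + 1 \<le> gprod (q' j) (q m)"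
      using k l m that by auto
    moreover have "gprod (p m) (q m) \<le> D" using le m by blast
    ultimately show False
      using four_point[of "p m" "p' i" "q' j"] four_point[of "p m" "q' j" "q m"]
        bdry_range[OF \<xi>] bdry_range[OF \<xi>(1) p'] bdry_range[OF \<eta>] bdry_range[OF \<eta>(1) q']
        delta_nonneg by auto
  qed
  then have "\<forall>\<^sub>F x in sequentially \<times>\<^sub>F sequentially.
      (case x of (i, j) \<Rightarrow> ereal (gprod (p' i) (q' j))) \<le> ereal (D + 2 * \<delta>)"
    unfolding eventually_prod_sequentially by auto
  then have "Liminf (sequentially \<times>\<^sub>F sequentially) (\<lambda>(i, j). ereal (gprod (p' i) (q' j)))
      \<le> Liminf (sequentially \<times>\<^sub>F sequentially) (\<lambda>_ :: nat \<times> nat. ereal (D + 2 * \<delta>))"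
    by (rule Liminf_mono)
  also have "\<dots> = ereal (D + 2 * \<delta>)"
    by (rule Liminf_const) (simp add: prod_filter_eq_bot)
  finally show "Liminf (sequentially \<times>\<^sub>F sequentially) (\<lambda>(i, j). ereal (gprod (p' i) (q' j)))
      \<le> ereal (D + 2 * \<delta>)" .
qed

lemma boundary_product_bounded:
  assumes \<xi>: "\<xi> \<in> bdry" and \<eta>: "\<eta> \<in> bdry" and "\<xi> \<noteq> \<eta>"
  shows "\<exists>R. boundary_product d b \<xi> \<eta> \<le> ereal R"
proof -
  obtain p q where pq: "p \<in> \<xi>" "q \<in> \<eta>" using bdry_nonempty \<xi> \<eta> by blast
  obtain D n where "\<forall>i\<ge>n. \<forall>j\<ge>n. gprod (p i) (q j) \<le> D"
    using bdry_bounded[OF \<xi> pq(1) \<eta> pq(2)] assms(3) by blast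
  then show ?thesis using boundary_product_le[OF \<xi> pq(1) \<eta> pq(2)] by blast
qed

lemma boundary_product_self:
  assumes \<xi>: "\<xi> \<in> bdry"
  shows "boundary_product d b \<xi> \<xi> = \<infinity>"
proof -
  obtain p where p: "p \<in> \<xi>" using bdry_nonempty \<xi> by blast
  have "ereal C \<le> boundary_product d b \<xi> \<xi>" for C
  proof -
    obtain n where "\<forall>i\<ge>n. \<forall>j\<ge>n. C \<le> gprod (p i) (p j)"
      using bdry_diverges[OF \<xi> p p] unfolding diverges_iff by blast
    then have "\<forall>\<^sub>F x in sequentially \<times>\<^sub>F sequentially.
        ereal C \<le> (case x of (i, j) \<Rightarrow> ereal (gprod (p i) (p j)))"
      unfolding eventually_prod_sequentially by auto
    then have "ereal C \<le> Liminf (sequentially \<times>\<^sub>F sequentially) (\<lambda>(i, j). ereal (gprod (p i) (p j)))"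
      by (rule Liminf_bounded)
    then show ?thesis unfolding boundary_product_def using p by (meson SUP_upper2)
  qed
  then show ?thesis by (metis ereal_top)
qed

text \<open>This says that the translates \<open>g n \<zeta>\<close> converge to \<open>\<xi>\<close>: they stay away from every other
  boundary point.\<close>

lemma boundary_product_translate_bounded:
  assumes G: "\<And>n. g n \<in> carrier G"
    and \<xi>: "\<xi> \<in> bdry" "(\<lambda>n. pt (g n)) \<in> \<xi>" and \<eta>: "\<eta> \<in> bdry" "(\<lambda>n. pt (inv (g n))) \<in> \<eta>"
    and \<zeta>: "\<zeta> \<in> bdry" "\<zeta> \<noteq> \<eta>" and \<theta>: "\<theta> \<in> bdry" "\<theta> \<noteq> \<xi>"
  shows "\<exists>R N. \<forall>n\<ge>N. boundary_product d b \<theta> (bact (g n) \<zeta>) \<le> ereal R"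
proof -
  obtain q u where q: "q \<in> \<zeta>" and u: "u \<in> \<theta>" using bdry_nonempty \<zeta>(1) \<theta>(1) by blast
  obtain D1 N1 where D1: "\<forall>i\<ge>N1. \<forall>j\<ge>N1. gprod (q i) (pt (inv (g j))) \<le> D1"
    using bdry_bounded[OF \<zeta>(1) q \<eta> \<zeta>(2)] by blast
  obtain D2 N2 where D2: "\<forall>i\<ge>N2. \<forall>j\<ge>N2. gprod (u i) (pt (g j)) \<le> D2"
    using bdry_bounded[OF \<theta>(1) u \<xi> \<theta>(2)] by blast
  obtain N3 where N3: "\<forall>n\<ge>N3. D1 + D2 + \<delta> + 1 \<le> len (g n)"
    using bdry_len_unbounded[OF \<xi>] by blast
  have "boundary_product d b \<theta> (bact (g n) \<zeta>) \<le> ereal (D2 + \<delta> + 2 * \<delta>)"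
    if n: "n \<ge> max N1 (max N2 N3)" for n
  proof (rule boundary_product_le[OF \<theta>(1) u bact_closed[OF G \<zeta>(1)] bact_memI[OF q]])
    fix i j assume i: "i \<ge> max N1 N2" and j: "j \<ge> max N1 N2"
    have M: "u i \<in> M" "q j \<in> M" using bdry_range[OF \<theta>(1) u] bdry_range[OF \<zeta>(1) q] by auto
    have "gprod (q j) (pt (inv (g n))) \<le> D1" using D1 j n by simp
    then have "len (g n) - D1 \<le> gprod (\<phi> (g n) (q j)) (pt (g n))"
      using gprod_act[OF G M(2), of n] by simp
    moreover have "gprod (u i) (pt (g n)) \<le> D2" using D2 i n by simp
    moreover have "D1 + D2 + \<delta> + 1 \<le> len (g n)" using N3 n by simp
    ultimately show "gprod (u i) (\<phi> (g n) (q j)) \<le> D2 + \<delta>"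
      using four_point[of "u i" "\<phi> (g n) (q j)" "pt (g n)"] M G by auto
  qed
  then show ?thesis by blast
qed

text \<open>A subsequence has limits \<xi> and \<eta> of \<open>g n b\<close> and of the inverses,
  and \<open>a\<close> must be \<xi>. Otherwise the translates of one boundary point \<zeta> other
  than \<open>r\<close> and \<eta> accumulate only at \<xi>, and removing them and \<xi> leaves an
  open neighbourhood of \<open>a\<close> that they never enter.\<close>

lemma limit_set_imp_limit_pair:
  assumes a: "a \<in> limit_set (boundary_topology M d b) (carrier G) bact"
    and three: "\<And>u v. \<exists>\<zeta>\<in>bdry. \<zeta> \<noteq> u \<and> \<zeta> \<noteq> v"
  shows "\<exists>\<eta>. limit_pair a \<eta>"
proof -
  let ?X = "boundary_topology M d b"
  note top = topspace_boundary_topology[of M d b]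
  obtain g r where aX: "a \<in> bdry" and g: "range g \<subseteq> carrier G" "inj (g :: nat \<Rightarrow> 'a)"
    and conv: "\<forall>K. compactin ?X K \<and> K \<subseteq> bdry - {r} \<longrightarrow> (\<forall>U. openin ?X U \<and> a \<in> U \<longrightarrow>
      (\<forall>\<^sub>F n in sequentially. \<forall>x\<in>K. bact (g n) x \<in> U))"
    using a unfolding limit_set_def top mem_Collect_eq by (elim conjE exE) (rule that)
  have gG: "g n \<in> carrier G" for n using g(1) by blast
  have "\<exists>n. \<forall>i\<ge>n. C \<le> len (g i)" for C by (rule inj_len_unbounded[OF g(2) gG])
  from limit_subsequence[OF gG this] obtain s \<xi> \<eta> where s: "strict_mono s"
    and \<xi>: "\<xi> \<in> bdry" "(\<lambda>n. pt (g (s n))) \<in> \<xi>" and \<eta>: "\<eta> \<in> bdry" "(\<lambda>n. pt (inv (g (s n)))) \<in> \<eta>"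
    by blast
  have "a = \<xi>"
  proof (rule ccontr)
    assume ne: "a \<noteq> \<xi>"
    obtain \<zeta> where \<zeta>: "\<zeta> \<in> bdry" "\<zeta> \<noteq> r" "\<zeta> \<noteq> \<eta>" using three by blast
    define z where "z n = bact (g (s n)) \<zeta>" for n
    have z: "z n \<in> bdry" for n using bact_closed[OF gG \<zeta>(1)] by (simp add: z_def)
    have away: "\<exists>R N. \<forall>n\<ge>N. boundary_product d b \<theta> (z n) \<le> ereal R" if "\<theta> \<in> bdry" "\<theta> \<noteq> \<xi>" for \<theta>
      unfolding z_def by (rule boundary_product_translate_bounded[OF gG \<xi> \<eta> \<zeta>(1,3) that])
    obtain R0 N0 where N0: "\<forall>n\<ge>N0. boundary_product d b a (z n) \<le> ereal R0" using away[OF aX ne] by blast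
    \<comment> \<open>From \<open>N0\<close> on the products of \<open>a\<close> with the translates
      are finite, whereas its product with itself is infinite; so \<open>a\<close> is none of the
      removed translates. Their limit \<xi> must be removed as well for \<open>U\<close> to be
      open.\<close>
    define U where "U = bdry - insert \<xi> (z ` {N0..})"
    have aU: "a \<in> U" using aX ne N0 boundary_product_self[OF aX] by (auto simp: U_def)
    have "openin ?X U"
      unfolding openin_boundary_topology
    proof (intro conjI ballI)
      show "U \<subseteq> bdry" by (auto simp: U_def)
      fix \<theta> assume \<theta>U: "\<theta> \<in> U"
      then have \<theta>: "\<theta> \<in> bdry" "\<theta> \<noteq> \<xi>" by (auto simp: U_def)
      obtain R1 N1 where N1: "\<forall>n\<ge>N1. boundary_product d b \<theta> (z n) \<le> ereal R1" using away[OF \<theta>] by blast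
      obtain R2 where R2: "boundary_product d b \<theta> \<xi> \<le> ereal R2"
        using boundary_product_bounded[OF \<theta>(1) \<xi>(1) \<theta>(2)] by blast
      \<comment> \<open>The restriction to \<open>n \<ge> N0\<close> matters: \<theta> may coincide
        with an earlier translate, and then the product is infinite.\<close>
      have "\<exists>R. n \<ge> N0 \<longrightarrow> boundary_product d b \<theta> (z n) \<le> ereal R" for n
        using boundary_product_bounded[OF \<theta>(1) z[of n]] \<theta>U by (auto simp: U_def)
      then obtain f where f: "\<And>n. n \<ge> N0 \<Longrightarrow> boundary_product d b \<theta> (z n) \<le> ereal (f n)" by metis
      define R where "R = Max ({R1, R2} \<union> f ` {..<N1})"
      have R: "R1 \<le> R" "R2 \<le> R" "\<And>n. n < N1 \<Longrightarrow> f n \<le> R"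
        unfolding R_def by (rule Max_ge; simp)+
      have "boundary_product d b \<theta> \<xi>' \<le> ereal R" if "\<xi>' \<in> insert \<xi> (z ` {N0..})" for \<xi>'
      proof (cases "\<xi>' = \<xi>")
        case True
        then show ?thesis using R2 R(2) by (meson ereal_less_eq(3) order_trans)
      next
        case False
        then have "\<xi>' \<in> z ` {N0..}" using that by simp
        then obtain n where "n \<in> {N0..}" "\<xi>' = z n" by (rule imageE)
        then have n: "n \<ge> N0" "\<xi>' = z n" by simp_all
        show ?thesis
        proof (cases "n < N1")
          case True
          then have "ereal (f n) \<le> ereal R" using R(3) by simp
          then show ?thesis using f[OF n(1)] unfolding n(2) by (rule order_trans[rotated])
        next
          case False
          then have "boundary_product d b \<theta> (z n) \<le> ereal R1" using N1 by simp
          moreover have "ereal R1 \<le> ereal R" using R(1) by simp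
          ultimately show ?thesis unfolding n(2) by (rule order_trans)
        qed
      qed
      then show "\<exists>R::real. {\<eta> \<in> bdry. ereal R < boundary_product d b \<theta> \<eta>} \<subseteq> U"
        by (intro exI[of _ R]) (auto simp: U_def not_le[symmetric])
    qed
    moreover have "compactin ?X {\<zeta>}" using \<zeta>(1) by (simp add: top)
    moreover have "{\<zeta>} \<subseteq> bdry - {r}" using \<zeta> by simp
    ultimately have "\<forall>\<^sub>F n in sequentially. \<forall>x\<in>{\<zeta>}. bact (g n) x \<in> U"
      using aU conv[rule_format, of "{\<zeta>}" U] by simp
    then obtain N where N: "\<And>n. n \<ge> N \<Longrightarrow> bact (g n) \<zeta> \<in> U" by (auto simp: eventually_sequentially)
    have "z (max N0 N) \<in> U"
      unfolding z_def using seq_suble[OF s, of "max N0 N"] by (intro N) simp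
    then show False by (simp add: U_def)
  qed
  then show ?thesis using limit_pairI[OF \<xi>(1) \<eta>(1) gG \<xi>(2) \<eta>(2)] by blast
qed

theorem kazhdan_constant_upto_eq_0_if_nonelementary:
  assumes S: "finite_generating_set G S"
    and nonelem: "nonelementary (boundary_topology M d b) (carrier G) bact"
    and r: "card S + 2 \<le> r"
  shows "kazhdan_constant_upto r G = 0"
proof -
  define L where "L = limit_set (boundary_topology M d b) (carrier G) bact"
  have "\<exists>T\<subseteq>L. card T = 3"
  proof (cases "infinite L")
    case True
    then show ?thesis using infinite_arbitrarily_large by blast
  next
    case False
    then have "3 \<le> card L" using nonelem by (simp add: nonelementary_def L_def)
    then show ?thesis using obtain_subset_with_card_n by metis
  qed
  then obtain \<xi>1 \<xi>2 \<xi>3 where L: "\<xi>1 \<in> L" "\<xi>2 \<in> L" "\<xi>3 \<in> L"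
    and ne: "\<xi>1 \<noteq> \<xi>2" "\<xi>1 \<noteq> \<xi>3" "\<xi>2 \<noteq> \<xi>3"
    by (auto simp: card_3_iff)
  have "L \<subseteq> bdry" by (auto simp: L_def limit_set_def topspace_boundary_topology)
  then have "\<exists>\<zeta>\<in>bdry. \<zeta> \<noteq> u \<and> \<zeta> \<noteq> v" for u v using L ne by (metis subsetD)
  then have "\<exists>\<eta>. limit_pair \<xi> \<eta>" if "\<xi> \<in> L" for \<xi>
    using limit_set_imp_limit_pair that unfolding L_def by blast
  then show ?thesis
    using kazhdan_constant_upto_eq_0_if_three_limit_points[OF S _ _ _ ne r] L by metis
qed

end

section \<open>Cayley graphs and cusped spaces\<close>

locale finitely_generated_group = group G for G :: "('a, 'm) monoid_scheme" (structure) +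
  fixes S :: "'a set"
  assumes finite_S: "finite S" and S_closed: "S \<subseteq> carrier G" and generate_S: "generate G S = carrier G"
begin

abbreviation letters :: "'a set" where "letters \<equiv> S \<union> m_inv G ` S"

abbreviation evaluate :: "'a list \<Rightarrow> 'a" where "evaluate w \<equiv> foldr (\<otimes>) w \<one>"

abbreviation wlen :: "'a \<Rightarrow> nat" where "wlen \<equiv> word_length G S"

lemma letters_closed: "letters \<subseteq> carrier G"
  using S_closed by auto

lemma evaluate_closed [simp]: "set w \<subseteq> letters \<Longrightarrow> evaluate w \<in> carrier G"
  by (induction w) (use letters_closed in auto)

lemma evaluate_append:
  "\<lbrakk>set u \<subseteq> letters; set v \<subseteq> letters\<rbrakk> \<Longrightarrow> evaluate (u @ v) = evaluate u \<otimes> evaluate v"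
  by (induction u) (use letters_closed in \<open>auto simp: m_assoc subset_iff\<close>)

lemma inverse_word:
  "set w \<subseteq> letters \<Longrightarrow> \<exists>v. set v \<subseteq> letters \<and> length v = length w \<and> evaluate v = inv (evaluate w)"
proof (induction w)
  case (Cons a w)
  then obtain v where v: "set v \<subseteq> letters" "length v = length w" "evaluate v = inv (evaluate w)" by auto
  have a: "a \<in> letters" "a \<in> carrier G" using Cons letters_closed by auto
  then have ia: "inv a \<in> letters" using S_closed by auto
  have w: "evaluate w \<in> carrier G" using Cons by simp
  have "evaluate (v @ [inv a]) = inv (evaluate (a # w))"
    using v ia a w by (subst evaluate_append) (auto simp: inv_mult_group)
  then show ?case using v ia by (intro exI[of _ "v @ [inv a]"]) auto
qed simp

lemma word_exists: "g \<in> carrier G \<Longrightarrow> \<exists>w. set w \<subseteq> letters \<and> evaluate w = g"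
proof -
  assume "g \<in> carrier G"
  then have "g \<in> generate G S" using generate_S by simp
  then show ?thesis
  proof induction
    case one
    then show ?case by (intro exI[of _ "[]"]) simp
  next
    case (incl h)
    then show ?case using S_closed by (intro exI[of _ "[h]"]) auto
  next
    case (inv h)
    then show ?case using S_closed by (intro exI[of _ "[inv h]"]) auto
  next
    case (eng g h)
    then obtain u v where "set u \<subseteq> letters" "evaluate u = g" "set v \<subseteq> letters" "evaluate v = h" by blast
    then show ?case using evaluate_append by (intro exI[of _ "u @ v"]) auto
  qed
qed

lemma shortest_word:
  assumes "g \<in> carrier G"
  obtains w where "length w = wlen g" "set w \<subseteq> letters" "evaluate w = g"
proof -
  have "\<exists>n w. length w = n \<and> set w \<subseteq> letters \<and> evaluate w = g"
    using word_exists[OF assms] by blast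
  from LeastI_ex[OF this] show thesis using that unfolding word_length_def by blast
qed

lemma wlen_le: "set w \<subseteq> letters \<Longrightarrow> wlen (evaluate w) \<le> length w"
  unfolding word_length_def by (rule Least_le) blast

lemma wlen_one [simp]: "wlen \<one> = 0"
  using wlen_le[of "[]"] by simp

lemma wlen_mult: "\<lbrakk>g \<in> carrier G; h \<in> carrier G\<rbrakk> \<Longrightarrow> wlen (g \<otimes> h) \<le> wlen g + wlen h"
proof -
  assume g: "g \<in> carrier G" and h: "h \<in> carrier G"
  obtain u where u: "length u = wlen g" "set u \<subseteq> letters" "evaluate u = g" using shortest_word[OF g] .
  obtain v where v: "length v = wlen h" "set v \<subseteq> letters" "evaluate v = h" using shortest_word[OF h] .
  show ?thesis using wlen_le[of "u @ v"] evaluate_append[OF u(2) v(2)] u v by (simp del: foldr_append)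
qed

lemma wlen_inv [simp]: "g \<in> carrier G \<Longrightarrow> wlen (inv g) = wlen g"
proof -
  have *: "wlen (inv g) \<le> wlen g" if g: "g \<in> carrier G" for g
  proof -
    obtain u where u: "length u = wlen g" "set u \<subseteq> letters" "evaluate u = g" using shortest_word[OF g] .
    then show ?thesis using inverse_word[OF u(2)] wlen_le by metis
  qed
  assume "g \<in> carrier G"
  then show ?thesis using *[of g] *[of "inv g"] by simp
qed

text \<open>A shortest word is cut after \<open>n\<close> letters. By subadditivity both bounds are
  attained, so \<open>h\<close> lies on a geodesic from the unit to \<open>g\<close>.\<close>

lemma wlen_split:
  assumes g: "g \<in> carrier G" and n: "n \<le> wlen g"
  shows "\<exists>h\<in>carrier G. wlen h \<le> n \<and> wlen (inv h \<otimes> g) \<le> wlen g - n"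
proof -
  obtain u where u: "length u = wlen g" "set u \<subseteq> letters" "evaluate u = g" using shortest_word[OF g] .
  define h where "h = evaluate (take n u)"
  have t: "set (take n u) \<subseteq> letters" "set (drop n u) \<subseteq> letters"
    using u(2) set_take_subset[of n u] set_drop_subset[of n u] by blast+
  have h: "h \<in> carrier G" using t by (simp add: h_def)
  have "g = h \<otimes> evaluate (drop n u)"
    using evaluate_append[OF t] u(3) by (simp add: h_def)
  then have "inv h \<otimes> g = evaluate (drop n u)" using h t by (simp flip: m_assoc)
  then have "wlen (inv h \<otimes> g) \<le> wlen g - n" using wlen_le[OF t(2)] u(1) by simp
  moreover have "wlen h \<le> n" using wlen_le[OF t(1)] by (simp add: h_def)
  ultimately show ?thesis using h by blast
qed

lemma finite_wlen_ball: "finite {g \<in> carrier G. wlen g \<le> n}"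
proof (rule finite_subset)
  show "{g \<in> carrier G. wlen g \<le> n} \<subseteq> evaluate ` {w. set w \<subseteq> letters \<and> length w \<le> n}"
  proof
    fix g assume g: "g \<in> {g \<in> carrier G. wlen g \<le> n}"
    then obtain u where "length u = wlen g" "set u \<subseteq> letters" "evaluate u = g"
      using shortest_word[of g] by blast
    then show "g \<in> evaluate ` {w. set w \<subseteq> letters \<and> length w \<le> n}" using g by auto
  qed
  show "finite (evaluate ` {w. set w \<subseteq> letters \<and> length w \<le> n})"
    using finite_S by (intro finite_imageI finite_lists_length_le) auto
qed

text \<open>The subgroup acts by left multiplication on the whole group with its word metric; the
  shadows are cast by the finite ball of radius \<open>n\<close>.\<close>

lemma hyperbolic_action_subgroup:
  assumes A: "subgroup A G" and hyp: "gromov_hyperbolic (carrier G) (word_metric G S)"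
  shows "\<exists>\<delta>. hyperbolic_action (G\<lparr>carrier := A\<rparr>) (carrier G) (\<otimes>) (word_metric G S) \<one> \<delta>"
proof -
  obtain \<delta>0 where \<delta>0: "\<And>w x y z. \<lbrakk>w \<in> carrier G; x \<in> carrier G; y \<in> carrier G; z \<in> carrier G\<rbrakk> \<Longrightarrow>
      min (gromov_product (word_metric G S) w x y) (gromov_product (word_metric G S) w y z) - \<delta>0
        \<le> gromov_product (word_metric G S) w x z"
    using hyp unfolding gromov_hyperbolic_def by blast
  have AG: "g \<in> carrier G" if "g \<in> A" for g using subgroup.subset[OF A] that by blast
  have sym: "word_metric G S p q = word_metric G S q p" if "p \<in> carrier G" "q \<in> carrier G" for p q
    using wlen_inv[of "inv q \<otimes> p"] that by (simp add: word_metric_def inv_mult_group)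
  interpret GA: group "G\<lparr>carrier := A\<rparr>" using A by (rule subgroup_imp_group)
  have "hyperbolic_action (G\<lparr>carrier := A\<rparr>) (carrier G) (\<otimes>) (word_metric G S) \<one> (max 0 \<delta>0)"
  proof
    fix g h p assume "g \<in> carrier (G\<lparr>carrier := A\<rparr>)" "h \<in> carrier (G\<lparr>carrier := A\<rparr>)" "p \<in> carrier G"
    then show "g \<otimes>\<^bsub>G\<lparr>carrier := A\<rparr>\<^esub> h \<otimes> p = g \<otimes> (h \<otimes> p)" using AG by (simp add: m_assoc)
  next
    fix p q r assume "p \<in> carrier G" "q \<in> carrier G" "r \<in> carrier G"
    then have "inv p \<otimes> r = (inv p \<otimes> q) \<otimes> (inv q \<otimes> r)"
      by (simp add: m_assoc) (simp flip: m_assoc)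
    then show "word_metric G S p r \<le> word_metric G S p q + word_metric G S q r"
      using wlen_mult[of "inv p \<otimes> q" "inv q \<otimes> r"] \<open>p \<in> carrier G\<close> \<open>q \<in> carrier G\<close> \<open>r \<in> carrier G\<close>
      by (simp add: word_metric_def flip: of_nat_add)
  next
    fix g p q assume "g \<in> carrier (G\<lparr>carrier := A\<rparr>)" "p \<in> carrier G" "q \<in> carrier G"
    then have "inv (g \<otimes> p) \<otimes> (g \<otimes> q) = inv p \<otimes> q"
      using AG[of g] by (simp add: inv_mult_group m_assoc) (simp flip: m_assoc)
    then show "word_metric G S (g \<otimes> p) (g \<otimes> q) = word_metric G S p q" by (simp add: word_metric_def)
  next
    fix p q r assume "p \<in> carrier G" "q \<in> carrier G" "r \<in> carrier G"
    then show "gromov_product (word_metric G S) \<one> p q - max 0 \<delta>0 \<le> gromov_product (word_metric G S) \<one> p r \<or>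
        gromov_product (word_metric G S) \<one> q r - max 0 \<delta>0 \<le> gromov_product (word_metric G S) \<one> p r"
      using \<delta>0[of \<one> p q r] by (auto simp: min_def split: if_splits)
  next
    fix R
    show "finite {g \<in> carrier (G\<lparr>carrier := A\<rparr>). word_metric G S \<one> (g \<otimes> \<one>) \<le> R}"
      by (rule finite_subset[OF _ finite_wlen_ball[of "nat \<lfloor>R\<rfloor>"]])
        (use AG in \<open>auto simp: word_metric_def le_nat_floor\<close>)
    define n where "n = nat \<lceil>R\<rceil>"
    \<comment> \<open>The vertex at distance \<open>n\<close> from the unit on a geodesic to
      \<open>p\<close> has Gromov product \<open>n\<close> with \<open>p\<close>.\<close>
    have "\<exists>h\<in>{g \<in> carrier G. wlen g \<le> n}. R \<le> gromov_product (word_metric G S) \<one> p h"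
      if p: "p \<in> carrier G" and n: "real n \<le> word_metric G S \<one> p" for p
    proof -
      have np: "n \<le> wlen p" using n p by (simp add: word_metric_def)
      then obtain h where h: "h \<in> carrier G" "wlen h \<le> n" "wlen (inv h \<otimes> p) \<le> wlen p - n"
        using wlen_split[OF p] by blast
      have "p = h \<otimes> (inv h \<otimes> p)" using p h by (simp flip: m_assoc)
      then have "wlen p \<le> wlen h + wlen (inv h \<otimes> p)" using wlen_mult[of h "inv h \<otimes> p"] p h by simp
      then have "real (wlen (inv h \<otimes> p)) + real n \<le> real (wlen p)" "real n \<le> real (wlen h)"
        using h(3) np by linarith+
      moreover have "word_metric G S p h = real (wlen (inv h \<otimes> p))"
        using sym[OF p h(1)] by (simp add: word_metric_def)
      moreover have "R \<le> real n" by (simp add: n_def real_nat_ceiling_ge)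
      ultimately have "R \<le> gromov_product (word_metric G S) \<one> p h"
        using p h(1) by (simp add: gromov_product_def word_metric_def)
      then show ?thesis using h by blast
    qed
    then show "\<exists>P R'. finite P \<and> P \<subseteq> carrier G \<and> (\<forall>p\<in>carrier G. R' \<le> word_metric G S \<one> p \<longrightarrow>
        (\<exists>q\<in>P. R \<le> gromov_product (word_metric G S) \<one> p q))"
      using finite_wlen_ball[of n] by (intro exI[of _ "{g \<in> carrier G. wlen g \<le> n}"] exI[of _ "real n"]) auto
  qed (use AG sym in \<open>auto simp: word_metric_def\<close>)
  then show ?thesis by blast
qed

end

text \<open>Proper discontinuity on closed balls bounds the orbit. For the shadows, a geodesic from
  \<open>b\<close> to \<open>p\<close> is stopped on a sphere, and compactness of the ball replaces
  the stopping point by one of finitely many points.\<close>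

lemma (in relatively_hyperbolic) hyperbolic_action:
  "\<exists>\<delta>. hyperbolic_action G M \<phi> d b \<delta>"
proof -
  obtain \<delta>0 where \<delta>0: "\<And>w x y z. \<lbrakk>w \<in> M; x \<in> M; y \<in> M; z \<in> M\<rbrakk> \<Longrightarrow>
      min (gromov_product d w x y) (gromov_product d w y z) - \<delta>0 \<le> gromov_product d w x z"
    using hyperbolic unfolding gromov_hyperbolic_def by blast
  interpret grp: group G using group_hom by (simp add: group_hom_def)
  have act: "\<phi> g p \<in> M" if "g \<in> carrier G" "p \<in> M" for g p
    using element_image[OF that refl] .
  have "hyperbolic_action G M \<phi> d b (max 0 \<delta>0)"
  proof
    show "\<phi> \<one>\<^bsub>G\<^esub> p = p" if "p \<in> M" for p using id_eq_one that by (metis restrict_apply')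
    show "\<phi> (g \<otimes>\<^bsub>G\<^esub> h) p = \<phi> g (\<phi> h p)" if "g \<in> carrier G" "h \<in> carrier G" "p \<in> M" for g h p
      using composition_rule that by blast
    fix p q r assume "p \<in> M" "q \<in> M" "r \<in> M"
    then show "gromov_product d b p q - max 0 \<delta>0 \<le> gromov_product d b p r \<or>
        gromov_product d b q r - max 0 \<delta>0 \<le> gromov_product d b p r"
      using \<delta>0[OF basepoint, of p q r] by (auto simp: min_def split: if_splits)
  next
    fix R
    have "{g \<in> carrier G. d b (\<phi> g b) \<le> R} \<subseteq> {g \<in> carrier G. \<phi> g ` mcball b (max 0 R) \<inter> mcball b (max 0 R) \<noteq> {}}"
    proof
      fix g assume g: "g \<in> {g \<in> carrier G. d b (\<phi> g b) \<le> R}"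
      then have "\<phi> g b \<in> mcball b (max 0 R)" using basepoint act by auto
      moreover have "b \<in> mcball b (max 0 R)" using basepoint by simp
      ultimately show "g \<in> {g \<in> carrier G. \<phi> g ` mcball b (max 0 R) \<inter> mcball b (max 0 R) \<noteq> {}}"
        using g by blast
    qed
    then show "finite {g \<in> carrier G. d b (\<phi> g b) \<le> R}"
      using properly_discontinuous[OF proper] finite_subset by blast
    \<comment> \<open>The additional 1 pays for the distance between the point on the geodesic and
      the chosen centre of a unit ball.\<close>
    define R' where "R' = max 0 (R + 1)"
    have "mtotally_bounded (mcball b R')" using proper by (rule compactin_imp_mtotally_bounded)
    then obtain K where K: "finite K" "K \<subseteq> mcball b R'" "mcball b R' \<subseteq> (\<Union>x\<in>K. mball x 1)"
      unfolding mtotally_bounded_def by (meson zero_less_one)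
    have "\<exists>q\<in>K. R \<le> gromov_product d b p q" if p: "p \<in> M" "R' \<le> d b p" for p
    proof -
      obtain \<gamma> where \<gamma>: "\<gamma> 0 = b" "\<gamma> (d b p) = p" "\<gamma> ` {0..d b p} \<subseteq> M"
        "\<And>s t. \<lbrakk>s \<in> {0..d b p}; t \<in> {0..d b p}\<rbrakk> \<Longrightarrow> d (\<gamma> s) (\<gamma> t) = \<bar>s - t\<bar>"
        using geodesic[OF basepoint p(1)] by metis
      define q where "q = \<gamma> R'"
      have R': "0 \<le> R'" "R' \<in> {0..d b p}" using p(2) by (auto simp: R'_def)
      have q: "q \<in> M" "d b q = R'" "d q p = d b p - R'"
        using \<gamma>(1,2,3) \<gamma>(4)[of 0 R'] \<gamma>(4)[of R' "d b p"] R' by (auto simp: q_def)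
      then have "q \<in> mcball b R'" using basepoint by simp
      then obtain k where k: "k \<in> K" "q \<in> mball k 1" using K(3) by blast
      then have kM: "k \<in> M" "d k q < 1" by auto
      have "gromov_product d b p k \<ge> R' - 1"
        using triangle[of b k q] triangle[of p q k] q kM p(1) basepoint commute
        by (simp add: gromov_product_def)
      moreover have "R \<le> R' - 1" by (simp add: R'_def)
      ultimately show ?thesis using k(1) by (meson order_trans)
    qed
    moreover have "K \<subseteq> M" using K(2) by auto
    ultimately show "\<exists>P R'. finite P \<and> P \<subseteq> M \<and> (\<forall>p\<in>M. R' \<le> d b p \<longrightarrow> (\<exists>q\<in>P. R \<le> gromov_product d b p q))"
      using K(1) by blast
  qed (use basepoint act triangle isometric in \<open>auto simp: commute\<close>)
  then show ?thesis by blast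
qed

theorem corollary8p5:
  fixes \<Gamma> :: "'a monoid"
  assumes "group \<Gamma>" and "finitely_generated \<Gamma>"
    and "(\<exists>S. word_hyperbolic_wrt \<Gamma> S \<and> nonelementary_in_hyperbolic \<Gamma> S (carrier \<Gamma>)) \<or>
         (\<exists>(G :: 'a monoid) S A. word_hyperbolic_wrt G S \<and> subgroup A G \<and>
            \<Gamma> = G\<lparr>carrier := A\<rparr> \<and> nonelementary_in_hyperbolic G S A) \<or>
         (\<exists>\<P> (M :: 'x set) d b \<phi>. relatively_hyperbolic \<Gamma> \<P> M d b \<phi> \<and>
            nonelementary (boundary_topology M d b) (carrier \<Gamma>) (boundary_action \<phi>))"
  shows "kazhdan_constant_upto (generating_rank \<Gamma> + 2) \<Gamma> = 0"
proof -
  have "\<exists>n S. finite_generating_set \<Gamma> S \<and> card S = n"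
    using assms(2) by (auto simp: finitely_generated_def)
  from LeastI_ex[OF this] obtain S where S: "finite_generating_set \<Gamma> S" "card S = generating_rank \<Gamma>"
    unfolding generating_rank_def by blast
  then have r: "card S + 2 \<le> generating_rank \<Gamma> + 2" by simp
  \<comment> \<open>A word-hyperbolic group is the case of its own full subgroup. Hyperbolicity and
    limit set refer to the ambient \<open>G\<close> and \<open>T\<close>, while the generating set
    \<open>S\<close> and the rank belong to \<Gamma>.\<close>
  have subgroup_case: "kazhdan_constant_upto (generating_rank \<Gamma> + 2) \<Gamma> = 0"
    if hyp: "word_hyperbolic_wrt G T" and A: "subgroup A G" and \<Gamma>: "\<Gamma> = G\<lparr>carrier := A\<rparr>"
      and ne: "nonelementary_in_hyperbolic G T A" for G :: "'a monoid" and T A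
  proof -
    interpret finitely_generated_group G T
      using hyp
      by (simp add: finitely_generated_group_def finitely_generated_group_axioms_def
          word_hyperbolic_wrt_def finite_generating_set_def)
    obtain \<delta> where "hyperbolic_action \<Gamma> (carrier G) (\<otimes>\<^bsub>G\<^esub>) (word_metric G T) \<one>\<^bsub>G\<^esub> \<delta>"
      using hyperbolic_action_subgroup[OF A] hyp unfolding \<Gamma> word_hyperbolic_wrt_def by blast
    then show ?thesis
      by (rule hyperbolic_action.kazhdan_constant_upto_eq_0_if_nonelementary[OF _ S(1) _ r])
        (use ne in \<open>simp add: nonelementary_in_hyperbolic_def \<Gamma>\<close>)
  qed
  from assms(3) show ?thesis
  proof (elim disjE exE conjE)
    fix T assume "word_hyperbolic_wrt \<Gamma> T" "nonelementary_in_hyperbolic \<Gamma> T (carrier \<Gamma>)"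
    then show ?thesis using group.subgroup_self[OF assms(1)] by (intro subgroup_case) auto
  next
    fix \<P> and M :: "'x set" and d b \<phi>
    assume "relatively_hyperbolic \<Gamma> \<P> M d b \<phi>"
      and ne: "nonelementary (boundary_topology M d b) (carrier \<Gamma>) (boundary_action \<phi>)"
    from relatively_hyperbolic.hyperbolic_action[OF this(1)]
    obtain \<delta> where "hyperbolic_action \<Gamma> M \<phi> d b \<delta>" by blast
    then show ?thesis
      by (rule hyperbolic_action.kazhdan_constant_upto_eq_0_if_nonelementary[OF _ S(1) ne r])
  qed (rule subgroup_case)
qed

end
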